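(* Let $\Omega,\Omega'\subset\mathbb R^d$ be open, let $m\in\mathbb R$, $a\in S^m(\Omega'\times\mathbb R^d)$, and let $\chi\in C^\infty(\Omega,\Omega')$. Then the pull-back of $\mathrm{Op}(a)$ under $\chi$ is a Fourier integral operator with phase function $$\omega_\chi(x,y,\xi)=(\chi(x)-\chi(y))\cdot\xi$$ and symbol $a(\chi(x),\xi)\,|\det D\chi(y)|\in S^m(\Omega\times\Omega\times\mathbb R^d)$. We have $$C_{\omega_\chi}=\{(x,y)\in\Omega^2:\ \chi(x)=\chi(y)\}.$$ Moreover, $\omega_\chi$ is non-degenerate if and only if $\chi$ is a local diffeomorphism.
   Context: $S^m(\Omega'\times\mathbb R^d)$ is the set of $a\in C^\infty(\Omega'\times\mathbb R^d)$ such that for all multi-indices $\alpha,\beta$ there is a constant $C_{\alpha,\beta}$ with $|\partial_x^\alpha\partial_\xi^\beta a(x,\xi)|\le C_{\alpha,\beta}(1+|\xi|)^{m-|\beta|}$; $S^m(\Omega\times\Omega\times\mathbb R^d)$ is the analogous class of symbols (amplitudes) $c(x,y,\xi)$. $\mathrm{Op}(a)u(x)=(2\pi)^{-d}\int_{\mathbb R^d} e^{ix\cdot\xi}a(x,\xi)\hat u(\xi)\,d\xi$, with distribution kernel $K(x,y)=(2\pi)^{-d}\int_{\mathbb R^d} e^{i(x-y)\cdot\xi}a(x,\xi)\,d\xi$. The pull-back under $\chi$ of an operator with kernel $K$ on $\Omega'\times\Omega'$ is the operator with kernel $K^*(x,y)=K(\chi(x),\chi(y))\,|\det D\chi(y)|$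 on $\Omega\times\Omega$ (understood formally, as an oscillatory integral). A Fourier integral operator with phase $\omega(x,y,\xi)$ and symbol (amplitude) $c(x,y,\xi)$ is the operator given by the oscillatory integral $u\mapsto\int e^{i\omega(x,y,\xi)}c(x,y,\xi)u(y)\,dy\,d\xi$ (up to the normalisation $(2\pi)^{-d}$). For $\omega\in C^\infty(\Omega\times\Omega\times\mathbb R^d)$ positively homogeneous of degree one in $\xi$, let $C=\{(x,y,\xi)\in\Omega\times\Omega\times(\mathbb R^d\setminus\{0\}):D_\xi\omega(x,y,\xi)=0\}$, let $C_\omega$ be the projection of $C$ on $\Omega\times\Omega$, and let $R_\omega$ be the complement of $C_\omega$ in $\Omega\times\Omega$; $\omega$ is called a phase function on $R_\omega\times\mathbb R^d$. It is called non-degenerate if at every point of $C$ the differentials $D(\partial\omega/\partial\xi_j)$, $j=1,\dots,d$, are linearly independent.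
   Formalization: The claim that the symbol lies in S^m(Ω×Ω×R^d) is false for general χ (x², exp with a=1); it is proved when |det Dχ| is smooth and all derivatives of χ of order ≥1 are bounded on Ω, and with constants uniform on compact sets when only |det Dχ| is smooth. *)

theory Defs
  imports "HOL-Analysis.Analysis"
begin

section \<open>Smooth functions on open sets\<close>

text \<open>
  A multi-index is represented by a list of basis vectors, so its order is the length of the list.
  For smooth functions the order of the list is irrelevant.
\<close>

fun iter_partial ::
  "'a::euclidean_space list \<Rightarrow> ('a \<Rightarrow> 'b::real_normed_vector) \<Rightarrow> 'a \<Rightarrow> 'b" where
  "iter_partial [] f = f"
| "iter_partial (b # bs) f = (\<lambda>x. frechet_derivative (iter_partial bs f) (at x) b)"

text \<open>
  Meant for open \<open>S\<close>: all iterated partial derivatives exist and are (totally) differentiable on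
  \<open>S\<close>, hence continuous there.  Only the values of \<open>f\<close> on \<open>S\<close> matter.
\<close>

definition smooth_on :: "'a::euclidean_space set \<Rightarrow> ('a \<Rightarrow> 'b::real_normed_vector) \<Rightarrow> bool" where
  "smooth_on S f \<longleftrightarrow>
     (\<forall>bs\<in>lists Basis. \<forall>x\<in>S. iter_partial bs f differentiable (at x))"

definition smooth_map ::
  "'a::euclidean_space set \<Rightarrow> 'b::euclidean_space set \<Rightarrow> ('a \<Rightarrow> 'b) \<Rightarrow> bool" where
  "smooth_map U V f \<longleftrightarrow> smooth_on U f \<and> f ` U \<subseteq> V"

definition test_functions :: "'a::euclidean_space set \<Rightarrow> ('a \<Rightarrow> complex) set" where
  "test_functions U =
     {u. smooth_on UNIV u \<and> compact (closure {x. u x \<noteq> 0}) \<and> closure {x. u x \<noteq> 0} \<subseteq> U}"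

definition local_diffeomorphism ::
  "'a::euclidean_space set \<Rightarrow> ('a \<Rightarrow> 'a) \<Rightarrow> bool" where
  "local_diffeomorphism U f \<longleftrightarrow>
     (\<forall>x\<in>U. \<exists>V W g. open V \<and> x \<in> V \<and> V \<subseteq> U \<and> open W \<and>
        homeomorphism V W f g \<and> smooth_on V f \<and> smooth_on W g)"

text \<open>All derivatives of order at least one are bounded.\<close>

definition bounded_derivatives_on ::
  "'a::euclidean_space set \<Rightarrow> ('a \<Rightarrow> 'b::real_normed_vector) \<Rightarrow> bool" where
  "bounded_derivatives_on U f \<longleftrightarrow>
     (\<forall>bs\<in>lists Basis. bs \<noteq> [] \<longrightarrow> bounded (iter_partial bs f ` U))"

section \<open>Symbols and amplitudes\<close>

definition mixed_partial ::
  "'a::euclidean_space list \<Rightarrow> 'b::euclidean_space list \<Rightarrow> ('a \<times> 'b \<Rightarrow> complex) \<Rightarrow> 'a \<times> 'b \<Rightarrow> complex"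
  where
  "mixed_partial \<alpha> \<beta> = iter_partial (map (\<lambda>b. (b, 0)) \<alpha> @ map (\<lambda>b. (0, b)) \<beta>)"

text \<open>
  The class \<open>S\<^sup>m(U \<times> \<real>\<^sup>d)\<close>, with constants uniform in the base point.  Taking
  \<open>U = \<Omega> \<times> \<Omega>\<close> gives the amplitudes \<open>c((x, y), \<xi>)\<close>.
\<close>

definition symbol_class ::
  "real \<Rightarrow> 'a::euclidean_space set \<Rightarrow> ('a \<times> 'b::euclidean_space \<Rightarrow> complex) set" where
  "symbol_class m U =
     {a. smooth_on (U \<times> UNIV) a \<and>
         (\<forall>\<alpha>\<in>lists Basis. \<forall>\<beta>\<in>lists Basis. \<exists>C. \<forall>x\<in>U. \<forall>\<xi>.
            norm (mixed_partial \<alpha> \<beta> a (x, \<xi>)) \<le> C * (1 + norm \<xi>) powr (m - real (length \<beta>)))}"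

text \<open>
  The same class with constants uniform on compact sets of base points.  The distinction matters
  for pull-backs: the derivatives of a smooth \<open>chi\<close> are bounded on compact sets, but in general
  not on all of \<open>\<Omega>\<close>.
\<close>

definition local_symbol_class ::
  "real \<Rightarrow> 'a::euclidean_space set \<Rightarrow> ('a \<times> 'b::euclidean_space \<Rightarrow> complex) set" where
  "local_symbol_class m U =
     {a. smooth_on (U \<times> UNIV) a \<and>
         (\<forall>K. compact K \<and> K \<subseteq> U \<longrightarrow>
           (\<forall>\<alpha>\<in>lists Basis. \<forall>\<beta>\<in>lists Basis. \<exists>C. \<forall>x\<in>K. \<forall>\<xi>.
              norm (mixed_partial \<alpha> \<beta> a (x, \<xi>)) \<le> C * (1 + norm \<xi>) powr (m - real (length \<beta>))))}"

section \<open>Phase functions\<close>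

definition homogeneous_phase ::
  "(real^'d) set \<Rightarrow> (((real^'d) \<times> (real^'d)) \<times> (real^'d) \<Rightarrow> real) \<Rightarrow> bool" where
  "homogeneous_phase \<Omega> \<omega> \<longleftrightarrow>
     smooth_on ((\<Omega> \<times> \<Omega>) \<times> UNIV) \<omega> \<and>
     (\<forall>x\<in>\<Omega>. \<forall>y\<in>\<Omega>. \<forall>\<xi>. \<forall>t>0. \<omega> ((x, y), t *\<^sub>R \<xi>) = t * \<omega> ((x, y), \<xi>))"

definition D_xi ::
  "(((real^'d) \<times> (real^'d)) \<times> (real^'d) \<Rightarrow> real) \<Rightarrow>
   ((real^'d) \<times> (real^'d)) \<times> (real^'d) \<Rightarrow> real^'d \<Rightarrow> real" where
  "D_xi \<omega> p = (\<lambda>\<eta>. frechet_derivative \<omega> (at p) ((0, 0), \<eta>))"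

definition critical_set ::
  "(real^'d) set \<Rightarrow> (((real^'d) \<times> (real^'d)) \<times> (real^'d) \<Rightarrow> real) \<Rightarrow>
   (((real^'d) \<times> (real^'d)) \<times> (real^'d)) set" where
  "critical_set \<Omega> \<omega> = {p \<in> (\<Omega> \<times> \<Omega>) \<times> (UNIV - {0}). D_xi \<omega> p = (\<lambda>\<eta>. 0)}"

definition C_set ::
  "(real^'d) set \<Rightarrow> (((real^'d) \<times> (real^'d)) \<times> (real^'d) \<Rightarrow> real) \<Rightarrow>
   ((real^'d) \<times> (real^'d)) set" where
  "C_set \<Omega> \<omega> = fst ` critical_set \<Omega> \<omega>"

definition R_set ::
  "(real^'d) set \<Rightarrow> (((real^'d) \<times> (real^'d)) \<times> (real^'d) \<Rightarrow> real) \<Rightarrow>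
   ((real^'d) \<times> (real^'d)) set" where
  "R_set \<Omega> \<omega> = \<Omega> \<times> \<Omega> - C_set \<Omega> \<omega>"

text \<open>
  Linear independence of the family of total differentials (in all \<open>3d\<close> variables) of the
  functions \<open>\<partial>\<omega>/\<partial>\<xi>\<^sub>j\<close>.
\<close>

definition nondegenerate_phase ::
  "(real^'d) set \<Rightarrow> (((real^'d) \<times> (real^'d)) \<times> (real^'d) \<Rightarrow> real) \<Rightarrow> bool" where
  "nondegenerate_phase \<Omega> \<omega> \<longleftrightarrow>
     (\<forall>p\<in>critical_set \<Omega> \<omega>. \<forall>r :: 'd \<Rightarrow> real.
        (\<forall>v. (\<Sum>j\<in>UNIV. r j * frechet_derivative (\<lambda>q. D_xi \<omega> q (axis j 1)) (at p) v) = 0)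
        \<longrightarrow> (\<forall>j. r j = 0))"

section \<open>Oscillatory integrals and the operators they define\<close>

definition cutoffs :: "('a::euclidean_space \<Rightarrow> complex) set" where
  "cutoffs = {\<psi> \<in> test_functions UNIV. \<psi> 0 = 1}"

text \<open>
  An oscillatory integral is handled through the functional \<open>I\<close> sending a compactly supported
  factor \<open>\<theta>(\<xi>)\<close> to the integral with \<open>\<theta>\<close> inserted; it has the value \<open>z\<close> if
  \<open>I (\<psi>(\<epsilon>\<cdot>))\<close> tends to \<open>z\<close> as \<open>\<epsilon>\<close> decreases to \<open>0\<close>, for every cutoff \<open>\<psi>\<close>.
\<close>

definition osc_value :: "(('a::euclidean_space \<Rightarrow> complex) \<Rightarrow> complex) \<Rightarrow> complex \<Rightarrow> bool" where
  "osc_value I z \<longleftrightarrow>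
     (\<forall>\<psi>\<in>cutoffs. ((\<lambda>\<epsilon>. I (\<lambda>\<xi>. \<psi> (\<epsilon> *\<^sub>R \<xi>))) \<longlongrightarrow> z) (at_right 0))"

text \<open>
  A formal kernel assigns to a factor \<open>\<theta>\<close> the kernel \<open>K \<theta> x y\<close> regularised by \<open>\<theta>\<close>;
  its value at \<open>(x, y)\<close>, if there is one, is given by \<open>osc_value (\<lambda>\<theta>. K \<theta> x y)\<close>.
\<close>

type_synonym 'd formal_kernel = "(real^'d \<Rightarrow> complex) \<Rightarrow> real^'d \<Rightarrow> real^'d \<Rightarrow> complex"

definition osc_kernel ::
  "(((real^'d) \<times> (real^'d)) \<times> (real^'d) \<Rightarrow> real) \<Rightarrow>
   (((real^'d) \<times> (real^'d)) \<times> (real^'d) \<Rightarrow> complex) \<Rightarrow> 'd formal_kernel" where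
  "osc_kernel \<omega> c \<theta> x y =
     (\<integral>\<xi>. exp (\<i> * of_real (\<omega> ((x, y), \<xi>))) * c ((x, y), \<xi>) * \<theta> \<xi> \<partial>lborel)
       / of_real ((2 * pi) ^ CARD('d))"

text \<open>
  The operator on \<open>\<Omega>\<close> with formal kernel \<open>K\<close>, as a partial operator given by its graph:
  applied to the test function \<open>u\<close> it has the value \<open>z\<close> at \<open>x\<close>.
\<close>

definition kernel_operator ::
  "(real^'d) set \<Rightarrow> 'd formal_kernel \<Rightarrow> (real^'d \<Rightarrow> complex) \<Rightarrow> real^'d \<Rightarrow> complex \<Rightarrow> bool" where
  "kernel_operator \<Omega> K u x z \<longleftrightarrow>
     osc_value (\<lambda>\<theta>. \<integral>y\<in>\<Omega>. (K \<theta> x y * u y) \<partial>lborel) z"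

text \<open>The Fourier integral operator with phase \<open>\<omega>\<close> and amplitude \<open>c\<close>, again by its graph.\<close>

definition fourier_integral_operator ::
  "(real^'d) set \<Rightarrow> (((real^'d) \<times> (real^'d)) \<times> (real^'d) \<Rightarrow> real) \<Rightarrow>
   (((real^'d) \<times> (real^'d)) \<times> (real^'d) \<Rightarrow> complex) \<Rightarrow>
   (real^'d \<Rightarrow> complex) \<Rightarrow> real^'d \<Rightarrow> complex \<Rightarrow> bool" where
  "fourier_integral_operator \<Omega> \<omega> c u x z \<longleftrightarrow>
     osc_value (\<lambda>\<theta>.
       (\<integral>(y, \<xi>)\<in>\<Omega> \<times> UNIV.
          (exp (\<i> * of_real (\<omega> ((x, y), \<xi>))) * c ((x, y), \<xi>) * u y * \<theta> \<xi>) \<partial>lborel)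
       / of_real ((2 * pi) ^ CARD('d))) z"

section \<open>Pseudodifferential operators and pull-backs\<close>

definition fourier :: "(real^'d \<Rightarrow> complex) \<Rightarrow> real^'d \<Rightarrow> complex" where
  "fourier u \<xi> = (\<integral>y. exp (- \<i> * of_real (y \<bullet> \<xi>)) * u y \<partial>lborel)"

definition Op ::
  "((real^'d) \<times> (real^'d) \<Rightarrow> complex) \<Rightarrow> (real^'d \<Rightarrow> complex) \<Rightarrow> real^'d \<Rightarrow> complex" where
  "Op a u x =
     (\<integral>\<xi>. exp (\<i> * of_real (x \<bullet> \<xi>)) * a (x, \<xi>) * fourier u \<xi> \<partial>lborel)
       / of_real ((2 * pi) ^ CARD('d))"

definition Op_kernel :: "((real^'d) \<times> (real^'d) \<Rightarrow> complex) \<Rightarrow> 'd formal_kernel" where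
  "Op_kernel a = osc_kernel (\<lambda>((x, y), \<xi>). (x - y) \<bullet> \<xi>) (\<lambda>((x, y), \<xi>). a (x, \<xi>))"

definition abs_jacobian_det :: "(real^'d \<Rightarrow> real^'d) \<Rightarrow> real^'d \<Rightarrow> real" where
  "abs_jacobian_det chi y = abs (det (jacobian chi (at y)))"

definition pullback_kernel ::
  "(real^'d \<Rightarrow> real^'d) \<Rightarrow> 'd formal_kernel \<Rightarrow> 'd formal_kernel" where
  "pullback_kernel chi K \<theta> x y = K \<theta> (chi x) (chi y) * of_real (abs_jacobian_det chi y)"

definition pullback_phase ::
  "(real^'d \<Rightarrow> real^'d) \<Rightarrow> ((real^'d) \<times> (real^'d)) \<times> (real^'d) \<Rightarrow> real" where
  "pullback_phase chi = (\<lambda>((x, y), \<xi>). (chi x - chi y) \<bullet> \<xi>)"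

definition pullback_amplitude ::
  "(real^'d \<Rightarrow> real^'d) \<Rightarrow> ((real^'d) \<times> (real^'d) \<Rightarrow> complex) \<Rightarrow>
   ((real^'d) \<times> (real^'d)) \<times> (real^'d) \<Rightarrow> complex" where
  "pullback_amplitude chi a = (\<lambda>((x, y), \<xi>). a (chi x, \<xi>) * of_real (abs_jacobian_det chi y))"

end

theory Submission
  imports Defs
begin

text \<open>
  Substituting \<open>chi\<close> into the regularised kernel of \<open>Op a\<close> and moving the Jacobian factor under the
  integral sign gives literally the regularised kernel with phase \<open>(chi x - chi y) \<bullet> \<xi>\<close> and
  amplitude \<open>a (chi x, \<xi>) * \<bar>det (D chi y)\<bar>\<close> (\<open>pullback_Op_kernel\<close>).  While a cutoff in
  \<open>\<xi>\<close> is present, the double integral has a compactly supported integrand, so Fubini's theorem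
  identifies the operator with this kernel and the Fourier integral operator
  (\<open>kernel_operator_osc_kernel\<close>).

  Three limits have to be shown to exist when the cutoff is removed.  For the operators one integrates
  over \<open>y\<close> first.  The inner integral of \<open>exp (- i chi y \<bullet> \<xi>) * v y\<close> decreases rapidly in
  \<open>\<xi>\<close> as soon as \<open>D chi\<close> is invertible on \<open>\<Omega>\<close>, by integration by parts against the inverse
  Jacobian (\<open>phase_transform_rapid_decay\<close>), and the outer integral converges absolutely.  With
  \<open>chi\<close> the identity this is the case of \<open>Op a\<close> itself; in general it is the case of a local
  diffeomorphism.  For the kernel at a point with \<open>z = chi x - chi y \<noteq> 0\<close> one integrates by parts in
  \<open>\<xi>\<close> instead: each step lowers the order of the symbol or gains a factor \<open>\<epsilon>\<close> from the
  cutoff (\<open>linear_phase_limit\<close>).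

  The symbol estimates follow from the chain rule by induction on the number of derivatives in the base
  point (\<open>symbol_estimate_pullback\<close>); all that matters is whether the coefficients produced by
  \<open>chi\<close> are bounded on the set in question.  For the uniform estimate one also needs that the
  derivatives of \<open>\<bar>det D chi\<bar>\<close>, if they exist, are those of \<open>det D chi\<close> up to sign, even at
  zeros of the determinant (\<open>norm_iter_partial_abs\<close>).

  Finally \<open>D\<^sub>\<xi> \<omega> = chi x - chi y\<close>, which gives the critical set.  The differentials of its
  components are the rows of \<open>(D chi x, - D chi y, 0)\<close>; since the critical set contains all
  points \<open>((x, x), \<xi>)\<close> with \<open>\<xi> \<noteq> 0\<close>, they are independent throughout iff \<open>D chi\<close> is invertible
  everywhere, which by the inverse function theorem means that \<open>chi\<close> is a local diffeomorphism.
\<close>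

section \<open>Calculus of smooth functions\<close>

definition partial_deriv ::
  "'a::euclidean_space \<Rightarrow> ('a \<Rightarrow> 'b::real_normed_vector) \<Rightarrow> 'a \<Rightarrow> 'b" where
  "partial_deriv b f = (\<lambda>x. frechet_derivative f (at x) b)"

lemma iter_partial_append: "iter_partial (bs @ cs) f = iter_partial bs (iter_partial cs f)"
  by (induction bs) auto

lemma iter_partial_snoc: "iter_partial (bs @ [b]) f = iter_partial bs (partial_deriv b f)"
  by (simp add: iter_partial_append partial_deriv_def)

lemma partial_deriv_eq:
  assumes "(f has_derivative f') (at x)"
  shows "partial_deriv b f x = f' b"
  using frechet_derivative_at[OF assms] by (simp add: partial_deriv_def)

lemma frechet_derivative_cong_open:
  assumes "open S" "x \<in> S" "\<And>y. y \<in> S \<Longrightarrow> f y = g y"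
  shows "frechet_derivative f (at x) = frechet_derivative g (at x)"
proof -
  have "(f has_derivative f') (at x) \<longleftrightarrow> (g has_derivative f') (at x)" for f'
    using assms has_derivative_transform_within_open by metis
  then show ?thesis by (simp add: frechet_derivative_def)
qed

lemma iter_partial_cong_open:
  assumes S: "open S" "\<And>y. y \<in> S \<Longrightarrow> f y = g y" and x: "x \<in> S"
  shows "iter_partial bs f x = iter_partial bs g x"
  using x
proof (induction bs arbitrary: x)
  case (Cons b bs)
  then show ?case
    using frechet_derivative_cong_open[OF S(1) Cons.prems, of "iter_partial bs f" "iter_partial bs g"]
    by simp
qed (use S in simp)

lemma differentiable_cong_open:
  assumes "open S" "x \<in> S" "\<And>y. y \<in> S \<Longrightarrow> f y = g y" "f differentiable (at x)"
  shows "g differentiable (at x)"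
  using assms has_derivative_transform_within_open unfolding differentiable_def by metis

text \<open>
  \<^term>\<open>smooth_on\<close> quantifies over all iterated derivatives at once, which gives no handle for
  closure properties: the derivative of a product or of a composition is again built from products
  and compositions, but of one order less.  Counting the order turns each closure property into an
  induction whose step is just the corresponding first-order rule.
\<close>

fun diff_upto ::
  "nat \<Rightarrow> 'a::euclidean_space set \<Rightarrow> ('a \<Rightarrow> 'b::real_normed_vector) \<Rightarrow> bool" where
  "diff_upto 0 S f \<longleftrightarrow> True"
| "diff_upto (Suc n) S f \<longleftrightarrow>
     (\<forall>x\<in>S. f differentiable (at x)) \<and> (\<forall>b\<in>Basis. diff_upto n S (partial_deriv b f))"

lemma diff_upto_iter_partial:
  "diff_upto n S f \<longleftrightarrow>
     (\<forall>bs\<in>lists Basis. length bs < n \<longrightarrow> (\<forall>x\<in>S. iter_partial bs f differentiable (at x)))"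
proof (induction n arbitrary: f)
  case (Suc n)
  show ?case
  proof
    assume L: "diff_upto (Suc n) S f"
    show "\<forall>bs\<in>lists Basis. length bs < Suc n \<longrightarrow> (\<forall>x\<in>S. iter_partial bs f differentiable (at x))"
    proof (intro ballI impI)
      fix bs :: "'a list" and x assume bs: "bs \<in> lists Basis" "length bs < Suc n" and x: "x \<in> S"
      show "iter_partial bs f differentiable (at x)"
      proof (cases bs rule: rev_cases)
        case Nil
        then show ?thesis using L x by simp
      next
        case (snoc cs c)
        then show ?thesis using L bs x Suc by (simp add: iter_partial_snoc)
      qed
    qed
  next
    assume R: "\<forall>bs\<in>lists Basis. length bs < Suc n \<longrightarrow> (\<forall>x\<in>S. iter_partial bs f differentiable (at x))"
    have "f differentiable (at x)" if "x \<in> S" for x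
      using R[rule_format, of "[]"] that by simp
    moreover have "diff_upto n S (partial_deriv b f)" if b: "b \<in> Basis" for b
      unfolding Suc
    proof (intro ballI impI)
      fix bs :: "'a list" and x assume "bs \<in> lists Basis" "length bs < n" "x \<in> S"
      then show "iter_partial bs (partial_deriv b f) differentiable (at x)"
        using R[rule_format, of "bs @ [b]" x] b by (simp add: iter_partial_snoc)
    qed
    ultimately show "diff_upto (Suc n) S f" by simp
  qed
qed simp

lemma smooth_on_diff_upto: "smooth_on S f \<longleftrightarrow> (\<forall>n. diff_upto n S f)"
  unfolding smooth_on_def diff_upto_iter_partial by blast

lemma diff_upto_Suc_imp: "diff_upto (Suc n) S f \<Longrightarrow> diff_upto n S f"
  by (auto simp: diff_upto_iter_partial)

lemma smooth_on_differentiable: "smooth_on S f \<Longrightarrow> x \<in> S \<Longrightarrow> f differentiable (at x)"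
  unfolding smooth_on_def by (metis iter_partial.simps(1) lists.Nil)

lemma smooth_on_has_derivative:
  "smooth_on S f \<Longrightarrow> x \<in> S \<Longrightarrow> (f has_derivative frechet_derivative f (at x)) (at x)"
  using smooth_on_differentiable frechet_derivative_works by blast

lemma smooth_on_partial_deriv: "smooth_on S f \<Longrightarrow> b \<in> Basis \<Longrightarrow> smooth_on S (partial_deriv b f)"
  unfolding smooth_on_diff_upto by (metis diff_upto.simps(2))

lemma smooth_on_iter_partial:
  assumes "smooth_on S f" "bs \<in> lists Basis"
  shows "smooth_on S (iter_partial bs f)"
  using assms unfolding smooth_on_def
  by (metis append_in_lists_conv iter_partial_append)

lemma smooth_on_continuous_on: "smooth_on S f \<Longrightarrow> continuous_on S f"
  by (meson continuous_at_imp_continuous_on differentiable_imp_continuous_within smooth_on_differentiable)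

lemma smooth_on_subset: "smooth_on S f \<Longrightarrow> T \<subseteq> S \<Longrightarrow> smooth_on T f"
  unfolding smooth_on_def by blast

lemma smooth_on_Un: "smooth_on S f \<Longrightarrow> smooth_on T f \<Longrightarrow> smooth_on (S \<union> T) f"
  unfolding smooth_on_def by blast

lemma diff_upto_cong:
  assumes "open S" "\<And>x. x \<in> S \<Longrightarrow> f x = g x" "diff_upto n S f"
  shows "diff_upto n S g"
  unfolding diff_upto_iter_partial
proof (intro ballI impI)
  fix bs :: "'a list" and x assume "bs \<in> lists Basis" "length bs < n" and x: "x \<in> S"
  with assms(3) have "iter_partial bs f differentiable (at x)"
    unfolding diff_upto_iter_partial by blast
  then show "iter_partial bs g differentiable (at x)"
    by (rule differentiable_cong_open[OF assms(1) x, rotated])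
       (rule iter_partial_cong_open[OF assms(1,2)])
qed

lemma smooth_on_cong:
  assumes "open S" "\<And>x. x \<in> S \<Longrightarrow> f x = g x" "smooth_on S f"
  shows "smooth_on S g"
  using assms diff_upto_cong unfolding smooth_on_diff_upto by metis

lemma partial_deriv_eq_on:
  "(\<And>x. x \<in> S \<Longrightarrow> (f has_derivative f' x) (at x)) \<Longrightarrow> x \<in> S \<Longrightarrow> f' x b = partial_deriv b f x"
  by (metis partial_deriv_eq)

text \<open>The induction step in the shape in which all closure properties use it.\<close>

lemma diff_upto_SucI:
  assumes S: "open S" and f: "\<And>x. x \<in> S \<Longrightarrow> (f has_derivative f' x) (at x)"
    and d: "\<And>b. b \<in> Basis \<Longrightarrow> diff_upto n S (\<lambda>x. f' x b)"
  shows "diff_upto (Suc n) S f"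
proof -
  have "diff_upto n S (partial_deriv b f)" if "b \<in> Basis" for b
    using d[OF that] by (rule diff_upto_cong[OF S, rotated]) (rule partial_deriv_eq_on[OF f])
  then show ?thesis using f by (auto intro: differentiableI)
qed

lemma diff_upto_SucD:
  assumes "diff_upto (Suc n) S f" "x \<in> S"
  shows "(f has_derivative (\<lambda>b. partial_deriv b f x)) (at x)"
  using assms by (simp add: partial_deriv_def flip: frechet_derivative_works)

lemma smooth_on_has_partial_deriv:
  assumes "smooth_on S f" "x \<in> S"
  shows "(f has_derivative (\<lambda>b. partial_deriv b f x)) (at x)"
  using smooth_on_has_derivative[OF assms] by (simp add: partial_deriv_def)

lemma diff_upto_const: "open S \<Longrightarrow> diff_upto n S (\<lambda>x. c)"
proof (induction n arbitrary: c)
  case (Suc n)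
  show ?case
    by (rule diff_upto_SucI[where f' = "\<lambda>x b. 0"]) (use Suc in auto)
qed simp

lemma diff_upto_linear: "open S \<Longrightarrow> bounded_linear f \<Longrightarrow> diff_upto n S f"
proof (cases n)
  case (Suc m)
  assume "open S" "bounded_linear f"
  then show ?thesis unfolding Suc
    by (intro diff_upto_SucI[where f' = "\<lambda>x. f"] diff_upto_const) (auto intro: bounded_linear_imp_has_derivative)
qed simp

lemma diff_upto_linear_compose:
  assumes S: "open S" and h: "bounded_linear h"
  shows "diff_upto n S f \<Longrightarrow> diff_upto n S (\<lambda>x. h (f x))"
proof (induction n arbitrary: f)
  case (Suc n)
  show ?case
    by (rule diff_upto_SucI[OF S, where f' = "\<lambda>x b. h (partial_deriv b f x)"])
       (use Suc in \<open>auto intro: bounded_linear.has_derivative[OF h] diff_upto_SucD[OF Suc.prems]\<close>)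
qed simp

lemma diff_upto_add:
  assumes S: "open S"
  shows "diff_upto n S f \<Longrightarrow> diff_upto n S g \<Longrightarrow> diff_upto n S (\<lambda>x. f x + g x)"
proof (induction n arbitrary: f g)
  case (Suc n)
  show ?case
    by (rule diff_upto_SucI[OF S, where f' = "\<lambda>x b. partial_deriv b f x + partial_deriv b g x"])
       (use Suc in \<open>auto intro!: has_derivative_add diff_upto_SucD[OF Suc.prems(1)] diff_upto_SucD[OF Suc.prems(2)]\<close>)
qed simp

lemma diff_upto_sum:
  assumes S: "open S"
  shows "(\<And>i. i \<in> I \<Longrightarrow> diff_upto n S (f i)) \<Longrightarrow> diff_upto n S (\<lambda>x. \<Sum>i\<in>I. f i x)"
  by (induction I rule: infinite_finite_induct) (simp_all add: diff_upto_const diff_upto_add S)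

lemma diff_upto_bilinear:
  assumes S: "open S" and B: "bounded_bilinear B"
  shows "diff_upto n S f \<Longrightarrow> diff_upto n S g \<Longrightarrow> diff_upto n S (\<lambda>x. B (f x) (g x))"
proof (induction n arbitrary: f g)
  case (Suc n)
  show ?case
  proof (rule diff_upto_SucI[OF S, where
        f' = "\<lambda>x b. B (f x) (partial_deriv b g x) + B (partial_deriv b f x) (g x)"])
    show "((\<lambda>x. B (f x) (g x)) has_derivative
            (\<lambda>b. B (f x) (partial_deriv b g x) + B (partial_deriv b f x) (g x))) (at x)" if "x \<in> S" for x
      using that
      by (intro bounded_bilinear.FDERIV[OF B] diff_upto_SucD[OF Suc.prems(1)] diff_upto_SucD[OF Suc.prems(2)])
    show "diff_upto n S (\<lambda>x. B (f x) (partial_deriv b g x) + B (partial_deriv b f x) (g x))"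
      if "b \<in> Basis" for b
      using that Suc.prems diff_upto_Suc_imp[OF Suc.prems(1)] diff_upto_Suc_imp[OF Suc.prems(2)]
      by (auto intro!: diff_upto_add[OF S] Suc.IH)
  qed
qed simp

lemma has_derivative_Basis_sum:
  fixes f :: "'a::euclidean_space \<Rightarrow> 'b::real_normed_vector"
  assumes "(f has_derivative f') (at x)"
  shows "f' v = (\<Sum>i\<in>Basis. (v \<bullet> i) *\<^sub>R f' i)"
proof -
  have "linear f'" using assms has_derivative_linear by blast
  then have "f' (\<Sum>i\<in>Basis. (v \<bullet> i) *\<^sub>R i) = (\<Sum>i\<in>Basis. (v \<bullet> i) *\<^sub>R f' i)"
    by (simp add: linear_sum linear_cmul)
  then show ?thesis by (simp add: euclidean_representation)
qed

lemma diff_upto_compose: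
  fixes f :: "'b::euclidean_space \<Rightarrow> 'c::real_normed_vector" and g :: "'a::euclidean_space \<Rightarrow> 'b"
  assumes S: "open S" and gS: "\<And>x. x \<in> S \<Longrightarrow> g x \<in> T"
  shows "diff_upto n T f \<Longrightarrow> diff_upto n S g \<Longrightarrow> diff_upto n S (\<lambda>x. f (g x))"
proof (induction n arbitrary: f)
  case (Suc n)
  show ?case
  proof (rule diff_upto_SucI[OF S, where
        f' = "\<lambda>x b. \<Sum>i\<in>Basis. (partial_deriv b g x \<bullet> i) *\<^sub>R partial_deriv i f (g x)"])
    fix x assume x: "x \<in> S"
    have df: "(f has_derivative (\<lambda>b. partial_deriv b f (g x))) (at (g x))"
      using diff_upto_SucD[OF Suc.prems(1)] gS[OF x] .
    have "((\<lambda>x. f (g x)) has_derivative (\<lambda>b. partial_deriv (partial_deriv b g x) f (g x))) (at x)"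
      using has_derivative_compose[OF diff_upto_SucD[OF Suc.prems(2) x] df] .
    moreover have "(\<Sum>i\<in>Basis. (partial_deriv b g x \<bullet> i) *\<^sub>R partial_deriv i f (g x)) =
        partial_deriv (partial_deriv b g x) f (g x)" for b
      using has_derivative_Basis_sum[OF df, of "partial_deriv b g x"] by (rule sym)
    ultimately show "((\<lambda>x. f (g x)) has_derivative
        (\<lambda>b. \<Sum>i\<in>Basis. (partial_deriv b g x \<bullet> i) *\<^sub>R partial_deriv i f (g x))) (at x)"
      by simp
  next
    fix b :: 'a assume b: "b \<in> Basis"
    have g: "diff_upto n S (\<lambda>x. partial_deriv b g x \<bullet> i)" for i
      using Suc.prems(2) b by (intro diff_upto_linear_compose[OF S bounded_linear_inner_left]) simp
    have f: "diff_upto n S (\<lambda>x. partial_deriv i f (g x))" if "i \<in> Basis" for i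
      by (rule Suc.IH) (use Suc.prems that diff_upto_Suc_imp in auto)
    show "diff_upto n S (\<lambda>x. \<Sum>i\<in>Basis. (partial_deriv b g x \<bullet> i) *\<^sub>R partial_deriv i f (g x))"
      by (intro diff_upto_sum[OF S] diff_upto_bilinear[OF S bounded_bilinear_scaleR] g f)
  qed
qed simp

lemma smooth_on_const: "open S \<Longrightarrow> smooth_on S (\<lambda>x. c)"
  by (simp add: smooth_on_diff_upto diff_upto_const)

lemma smooth_on_linear: "open S \<Longrightarrow> bounded_linear f \<Longrightarrow> smooth_on S f"
  by (simp add: smooth_on_diff_upto diff_upto_linear)

lemma smooth_on_linear_compose:
  "open S \<Longrightarrow> bounded_linear h \<Longrightarrow> smooth_on S f \<Longrightarrow> smooth_on S (\<lambda>x. h (f x))"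
  by (simp add: smooth_on_diff_upto diff_upto_linear_compose)

lemma smooth_on_add: "open S \<Longrightarrow> smooth_on S f \<Longrightarrow> smooth_on S g \<Longrightarrow> smooth_on S (\<lambda>x. f x + g x)"
  by (simp add: smooth_on_diff_upto diff_upto_add)

lemma smooth_on_sum:
  "open S \<Longrightarrow> (\<And>i. i \<in> I \<Longrightarrow> smooth_on S (f i)) \<Longrightarrow> smooth_on S (\<lambda>x. \<Sum>i\<in>I. f i x)"
  by (simp add: smooth_on_diff_upto diff_upto_sum)

lemma smooth_on_bilinear:
  "bounded_bilinear B \<Longrightarrow> open S \<Longrightarrow> smooth_on S f \<Longrightarrow> smooth_on S g \<Longrightarrow> smooth_on S (\<lambda>x. B (f x) (g x))"
  by (simp add: smooth_on_diff_upto diff_upto_bilinear)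

lemmas smooth_on_mult = smooth_on_bilinear[OF bounded_bilinear_mult]
lemmas smooth_on_inner = smooth_on_bilinear[OF bounded_bilinear_inner]

lemma smooth_on_compose:
  "open S \<Longrightarrow> smooth_on T f \<Longrightarrow> smooth_on S g \<Longrightarrow> (\<And>x. x \<in> S \<Longrightarrow> g x \<in> T) \<Longrightarrow>
     smooth_on S (\<lambda>x. f (g x))"
  unfolding smooth_on_diff_upto by (rule allI, rule diff_upto_compose[where T = T]) auto

lemma smooth_on_minus: "open S \<Longrightarrow> smooth_on S f \<Longrightarrow> smooth_on S (\<lambda>x. - f x)"
  by (rule smooth_on_linear_compose[OF _ bounded_linear_minus[OF bounded_linear_ident]])

lemma smooth_on_diff: "open S \<Longrightarrow> smooth_on S f \<Longrightarrow> smooth_on S g \<Longrightarrow> smooth_on S (\<lambda>x. f x - g x)"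
  using smooth_on_add[OF _ _ smooth_on_minus, of S f g] by simp

lemma smooth_on_of_real:
  "open S \<Longrightarrow> smooth_on S f \<Longrightarrow> smooth_on S (\<lambda>x. complex_of_real (f x))"
  by (rule smooth_on_linear_compose[OF _ bounded_linear_of_real])

lemma smooth_on_prod:
  fixes f :: "'i \<Rightarrow> 'a::euclidean_space \<Rightarrow> 'b::{real_normed_algebra,comm_ring_1}"
  assumes "open S"
  shows "(\<And>i. i \<in> I \<Longrightarrow> smooth_on S (f i)) \<Longrightarrow> smooth_on S (\<lambda>x. \<Prod>i\<in>I. f i x)"
  by (induction I rule: infinite_finite_induct) (simp_all add: smooth_on_const smooth_on_mult assms)

lemma smooth_on_Pair:
  fixes f :: "'a::euclidean_space \<Rightarrow> 'b::real_normed_vector" and g :: "'a \<Rightarrow> 'c::real_normed_vector"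
  assumes S: "open S" and "smooth_on S f" "smooth_on S g"
  shows "smooth_on S (\<lambda>x. (f x, g x))"
proof -
  have "smooth_on S (\<lambda>x. (f x, 0::'c) + (0::'b, g x))"
    using assms
    by (intro smooth_on_add smooth_on_linear_compose[OF S, of "\<lambda>y. (y, 0)"]
        smooth_on_linear_compose[OF S, of "\<lambda>y. (0, y)"])
       (auto intro: bounded_linear_Pair bounded_linear_zero bounded_linear_ident)
  then show ?thesis by simp
qed

lemma smooth_on_vec_nth: "open S \<Longrightarrow> smooth_on S f \<Longrightarrow> smooth_on S (\<lambda>x. f x $ i)"
  by (rule smooth_on_linear_compose[OF _ bounded_linear_vec_nth])

lemma smooth_on_fst: "open S \<Longrightarrow> smooth_on S f \<Longrightarrow> smooth_on S (\<lambda>x. fst (f x))"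
  by (rule smooth_on_linear_compose[OF _ bounded_linear_fst])

lemma smooth_on_snd: "open S \<Longrightarrow> smooth_on S f \<Longrightarrow> smooth_on S (\<lambda>x. snd (f x))"
  by (rule smooth_on_linear_compose[OF _ bounded_linear_snd])

lemma smooth_on_ident: "open S \<Longrightarrow> smooth_on S (\<lambda>x. x)"
  by (rule smooth_on_linear[OF _ bounded_linear_ident])

lemma smooth_on_exp:
  fixes f :: "'a::euclidean_space \<Rightarrow> complex"
  assumes S: "open S" and f: "smooth_on S f"
  shows "smooth_on S (\<lambda>x. exp (f x))"
proof -
  have "diff_upto n S (\<lambda>x. exp (f x))" for n
  proof (induction n)
    case (Suc n)
    show ?case
    proof (rule diff_upto_SucI[OF S, where f' = "\<lambda>x b. exp (f x) * partial_deriv b f x"])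
      show "((\<lambda>x. exp (f x)) has_derivative (\<lambda>b. exp (f x) * partial_deriv b f x)) (at x)"
        if "x \<in> S" for x
        using has_derivative_compose[OF smooth_on_has_partial_deriv[OF f that]
            DERIV_exp[unfolded has_field_derivative_def]] by simp
      show "diff_upto n S (\<lambda>x. exp (f x) * partial_deriv b f x)" if "b \<in> Basis" for b
        using Suc smooth_on_partial_deriv[OF f that]
        by (intro diff_upto_bilinear[OF S bounded_bilinear_mult]) (simp_all add: smooth_on_diff_upto)
    qed
  qed simp
  then show ?thesis by (simp add: smooth_on_diff_upto)
qed

lemma smooth_on_inverse:
  fixes f :: "'a::euclidean_space \<Rightarrow> real"
  assumes S: "open S" and f: "smooth_on S f" and nz: "\<And>x. x \<in> S \<Longrightarrow> f x \<noteq> 0"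
  shows "smooth_on S (\<lambda>x. inverse (f x))"
proof -
  have "diff_upto n S (\<lambda>x. inverse (f x))" for n
  proof (induction n)
    case (Suc n)
    show ?case
    proof (rule diff_upto_SucI[OF S, where
          f' = "\<lambda>x b. - (inverse (f x) * partial_deriv b f x * inverse (f x))"])
      show "((\<lambda>x. inverse (f x)) has_derivative
          (\<lambda>b. - (inverse (f x) * partial_deriv b f x * inverse (f x)))) (at x)" if "x \<in> S" for x
        using Deriv.has_derivative_inverse[OF nz[OF that] smooth_on_has_partial_deriv[OF f that]] .
      show "diff_upto n S (\<lambda>x. - (inverse (f x) * partial_deriv b f x * inverse (f x)))"
        if "b \<in> Basis" for b
        using Suc smooth_on_partial_deriv[OF f that]
        by (intro diff_upto_linear_compose[OF S bounded_linear_minus[OF bounded_linear_ident]]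
            diff_upto_bilinear[OF S bounded_bilinear_mult]) (simp_all add: smooth_on_diff_upto)
    qed
  qed simp
  then show ?thesis by (simp add: smooth_on_diff_upto)
qed

lemma smooth_on_det:
  fixes F :: "'a::euclidean_space \<Rightarrow> real^'n^'n"
  assumes S: "open S" and F: "\<And>i j. smooth_on S (\<lambda>x. F x $ i $ j)"
  shows "smooth_on S (\<lambda>x. det (F x))"
  unfolding det_def by (intro smooth_on_sum smooth_on_mult smooth_on_prod smooth_on_const S F)

lemma jacobian_nth: "jacobian f (at x) $ i $ j = partial_deriv (axis j 1) f x $ i"
  by (simp add: jacobian_def matrix_def partial_deriv_def)

lemma smooth_on_jacobian:
  fixes f :: "real^'n \<Rightarrow> real^'m"
  assumes "open S" "smooth_on S f"
  shows "smooth_on S (\<lambda>x. jacobian f (at x) $ i $ j)"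
  unfolding jacobian_nth using assms
  by (intro smooth_on_vec_nth smooth_on_partial_deriv) (auto simp: axis_in_Basis_iff)

section \<open>Test functions and their integrals\<close>

lemma test_functionsI:
  assumes "smooth_on UNIV v" "compact K" "K \<subseteq> U" "\<And>x. x \<notin> K \<Longrightarrow> v x = 0"
  shows "v \<in> test_functions U"
proof -
  have "closure {x. v x \<noteq> 0} \<subseteq> K"
    using assms by (intro closure_minimal compact_imp_closed) auto
  then show ?thesis
    using assms compact_Int_closed[of K "closure {x. v x \<noteq> 0}"]
    by (auto simp: test_functions_def Int_absorb1)
qed

lemma test_functions_support:
  assumes "v \<in> test_functions U"
  obtains K where "compact K" "K \<subseteq> U" "\<And>x. x \<notin> K \<Longrightarrow> v x = 0"
proof (rule that[of "closure {x. v x \<noteq> 0}"])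
  show "v x = 0" if "x \<notin> closure {x. v x \<noteq> 0}" for x
    using that closure_subset[of "{x. v x \<noteq> 0}"] by blast
qed (use assms in \<open>auto simp: test_functions_def\<close>)

lemma test_functions_smooth: "v \<in> test_functions U \<Longrightarrow> smooth_on UNIV v"
  by (simp add: test_functions_def)

lemma test_functions_continuous: "v \<in> test_functions U \<Longrightarrow> continuous_on UNIV v"
  by (simp add: test_functions_smooth smooth_on_continuous_on)

lemma test_functions_zero_outside: "v \<in> test_functions U \<Longrightarrow> x \<notin> U \<Longrightarrow> v x = 0"
  by (rule test_functions_support) auto

text \<open>
  The set \<open>U\<close> and the complement of the support of \<open>v\<close> are open and cover the space; on the
  latter the product vanishes, whatever values \<open>f\<close> takes there.
\<close>

lemma test_functions_mult:
  assumes U: "open U" and f: "smooth_on U f" and v: "v \<in> test_functions U"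
  shows "(\<lambda>x. f x * v x) \<in> test_functions U"
proof -
  have smooth: "smooth_on UNIV v" by (rule test_functions_smooth[OF v])
  obtain K where K: "compact K" "K \<subseteq> U" "\<And>x. x \<notin> K \<Longrightarrow> v x = 0"
    using test_functions_support[OF v] by blast
  have K_open: "open (- K)" using K compact_imp_closed by auto
  have "smooth_on (- K) (\<lambda>x. f x * v x)"
    by (rule smooth_on_cong[OF K_open _ smooth_on_const[OF K_open, of 0]]) (simp add: K)
  moreover have "smooth_on U (\<lambda>x. f x * v x)"
    using smooth_on_mult[OF U f smooth_on_subset[OF smooth]] by simp
  ultimately have "smooth_on (U \<union> - K) (\<lambda>x. f x * v x)" by (intro smooth_on_Un)
  moreover have "U \<union> - K = UNIV" using K by auto
  ultimately show ?thesis by (intro test_functionsI[of _ K]) (use K in auto)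
qed

lemma test_functions_sum:
  assumes "finite I" "\<And>i. i \<in> I \<Longrightarrow> f i \<in> test_functions U"
  shows "(\<lambda>x. \<Sum>i\<in>I. f i x) \<in> test_functions U"
  using assms
proof (induction I rule: finite_induct)
  case empty
  show ?case by (rule test_functionsI[of _ "{}"]) (auto intro: smooth_on_const)
next
  case (insert i I)
  have f: "f i \<in> test_functions U" and g: "(\<lambda>x. \<Sum>i\<in>I. f i x) \<in> test_functions U"
    using insert by auto
  obtain K where K: "compact K" "K \<subseteq> U" "\<And>x. x \<notin> K \<Longrightarrow> f i x = 0"
    using test_functions_support[OF f] by blast
  obtain L where L: "compact L" "L \<subseteq> U" "\<And>x. x \<notin> L \<Longrightarrow> (\<Sum>i\<in>I. f i x) = 0"
    using test_functions_support[OF g] by blast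
  show ?case
    by (rule test_functionsI[of _ "K \<union> L"]) (use K L insert.hyps test_functions_smooth[OF f] test_functions_smooth[OF g] in \<open>auto intro!: smooth_on_add\<close>)
qed

lemma test_functions_partial_deriv:
  assumes "v \<in> test_functions U" "b \<in> Basis"
  shows "partial_deriv b v \<in> test_functions U"
proof -
  have smooth: "smooth_on UNIV v" by (rule test_functions_smooth[OF assms(1)])
  obtain K where K: "compact K" "K \<subseteq> U" "\<And>x. x \<notin> K \<Longrightarrow> v x = 0"
    using test_functions_support[OF assms(1)] by blast
  have "partial_deriv b v x = 0" if "x \<notin> K" for x
    using frechet_derivative_cong_open[of "- K" x v "\<lambda>x. 0"] K that open_Compl[OF compact_imp_closed[OF K(1)]]
    by (simp add: partial_deriv_def)
  then show ?thesis
    using K smooth assms by (intro test_functionsI[of _ K] smooth_on_partial_deriv)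
qed

lemma integrable_compact_support:
  fixes f :: "'a::euclidean_space \<Rightarrow> 'b::{banach,second_countable_topology}"
  assumes "compact K" "continuous_on K f" "\<And>x. x \<notin> K \<Longrightarrow> f x = 0"
  shows "integrable lborel f"
proof -
  have "indicator K x *\<^sub>R f x = f x" for x using assms(3) by (cases "x \<in> K") auto
  then show ?thesis using borel_integrable_compact[OF assms(1,2)] by simp
qed

lemma test_functions_integrable:
  assumes "v \<in> test_functions U"
  shows "integrable lborel v"
proof -
  obtain K where "compact K" "K \<subseteq> U" "\<And>x. x \<notin> K \<Longrightarrow> v x = 0"
    using test_functions_support[OF assms] by blast
  then show ?thesis
    using continuous_on_subset[OF test_functions_continuous[OF assms]]
    by (intro integrable_compact_support[of K]) auto
qed

lemma test_functions_bounded: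
  assumes "v \<in> test_functions U"
  obtains B where "B > 0" "\<And>x. norm (v x) \<le> B"
proof -
  obtain K where K: "compact K" "K \<subseteq> U" "\<And>x. x \<notin> K \<Longrightarrow> v x = 0"
    using test_functions_support[OF assms] by blast
  have "bounded (v ` K)"
    using K continuous_on_subset[OF test_functions_continuous[OF assms]]
    by (intro compact_imp_bounded compact_continuous_image) auto
  then obtain B where B: "B > 0" "\<And>x. x \<in> K \<Longrightarrow> norm (v x) \<le> B"
    unfolding bounded_pos by auto
  have "norm (v x) \<le> B" for x using K B by (cases "x \<in> K") auto
  with B(1) that show ?thesis by blast
qed

text \<open>The partial derivatives are test functions themselves, hence bounded.\<close>

lemma test_functions_lipschitz:
  assumes v: "v \<in> test_functions U"
  obtains B where "B \<ge> 0" "\<And>x y. norm (v x - v y) \<le> B * norm (x - y)"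
proof -
  have "\<exists>C. C > 0 \<and> (\<forall>x. norm (partial_deriv b v x) \<le> C)" if "b \<in> Basis" for b
    using test_functions_bounded[OF test_functions_partial_deriv[OF v that]] by metis
  then obtain C where C: "\<And>b. b \<in> Basis \<Longrightarrow> C b > 0"
    "\<And>b x. b \<in> Basis \<Longrightarrow> norm (partial_deriv b v x) \<le> C b"
    by metis
  have "norm (v x - v y) \<le> sum C Basis * norm (x - y)" for x y
  proof (rule differentiable_bound[of UNIV v "\<lambda>x b. partial_deriv b v x"])
    fix x
    show d: "(v has_derivative (\<lambda>b. partial_deriv b v x)) (at x)"
      using smooth_on_has_partial_deriv[OF test_functions_smooth[OF v]] by simp
    show "onorm (\<lambda>b. partial_deriv b v x) \<le> sum C Basis"
      by (rule onorm_componentwise_le[OF has_derivative_bounded_linear[OF d]]) (intro sum_mono C(2))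
  qed auto
  moreover have "sum C Basis \<ge> 0" using C(1) by (intro sum_nonneg less_imp_le)
  ultimately show ?thesis using that by blast
qed

lemma has_vector_derivative_iff_quotient:
  "(f has_vector_derivative D) (at t) \<longleftrightarrow> ((\<lambda>h. (f (t + h) - f t) /\<^sub>R h) \<longlongrightarrow> D) (at 0)"
proof -
  have "norm (f (t + h) - f t - h *\<^sub>R D) / norm h = norm ((f (t + h) - f t) /\<^sub>R h - D)" if "h \<noteq> 0" for h
  proof -
    have "(f (t + h) - f t) /\<^sub>R h - D = (f (t + h) - f t - h *\<^sub>R D) /\<^sub>R h"
      using that by (simp add: scaleR_diff_right)
    then show ?thesis by (simp add: divide_inverse_commute)
  qed
  then have "((\<lambda>h. norm (f (t + h) - f t - h *\<^sub>R D) / norm h) \<longlongrightarrow> 0) (at 0) \<longleftrightarrow>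
      ((\<lambda>h. norm ((f (t + h) - f t) /\<^sub>R h - D)) \<longlongrightarrow> 0) (at 0)"
    by (intro tendsto_cong) (simp add: eventually_at_filter)
  then show ?thesis
    by (simp add: has_vector_derivative_def has_derivative_at bounded_linear_scaleR_left
        tendsto_norm_zero_iff LIM_zero_iff)
qed

text \<open>
  The difference quotients of \<open>v\<close> have integral \<open>0\<close> by translation invariance, are dominated
  because \<open>v\<close> is Lipschitz with compact support, and converge to the partial derivative.
\<close>

lemma integral_partial_deriv_eq_0:
  fixes v :: "'a::euclidean_space \<Rightarrow> complex"
  assumes v: "v \<in> test_functions U" and b: "b \<in> Basis"
  shows "(\<integral>x. partial_deriv b v x \<partial>lborel) = 0"
proof -
  obtain K where K: "compact K" "K \<subseteq> U" "\<And>x. x \<notin> K \<Longrightarrow> v x = 0"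
    using test_functions_support[OF v] by blast
  obtain R where R: "\<And>x. x \<in> K \<Longrightarrow> norm x \<le> R"
    using compact_imp_bounded[OF K(1)] unfolding bounded_iff by auto
  obtain B where B: "B \<ge> 0" "\<And>x y. norm (v x - v y) \<le> B * norm (x - y)"
    using test_functions_lipschitz[OF v] by metis
  define h where "h n = 1 / real (Suc n)" for n
  have h: "h n > 0" "h n \<le> 1" for n by (auto simp: h_def)
  define q where "q n x = (v (x + h n *\<^sub>R b) - v x) /\<^sub>R h n" for n x
  have int_v: "integrable lborel v" by (rule test_functions_integrable[OF v])
  have shift: "integrable lborel (\<lambda>x. v (x + c))" "(\<integral>x. v (x + c) \<partial>lborel) = (\<integral>x. v x \<partial>lborel)" for c
    using integrable_distr_eq[of "(+) c" lborel borel v] integral_distr[of "(+) c" lborel borel v]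
      int_v borel_measurable_integrable[OF int_v]
    by (simp_all add: lborel_distr_plus add.commute)
  have int_q: "(\<integral>x. q n x \<partial>lborel) = 0" for n
    unfolding q_def using shift int_v by simp
  have lim: "(\<lambda>n. q n x) \<longlonglongrightarrow> partial_deriv b v x" for x
  proof -
    have d: "(v has_derivative (\<lambda>b. partial_deriv b v x)) (at x)"
      using smooth_on_has_partial_deriv[OF test_functions_smooth[OF v]] by simp
    have "((\<lambda>t. v (x + t *\<^sub>R b)) has_vector_derivative partial_deriv b v x) (at 0)"
    proof -
      have "((\<lambda>t. v (x + t *\<^sub>R b)) has_derivative (\<lambda>t. partial_deriv (t *\<^sub>R b) v x)) (at 0)"
        by (rule has_derivative_compose[of "\<lambda>t. x + t *\<^sub>R b" "\<lambda>t. t *\<^sub>R b"])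
           (use d in \<open>auto intro!: derivative_eq_intros\<close>)
      moreover have "partial_deriv (t *\<^sub>R b) v x = t *\<^sub>R partial_deriv b v x" for t
        using has_derivative_linear[OF d] linear_cmul by blast
      ultimately show ?thesis by (simp add: has_vector_derivative_def)
    qed
    then have "((\<lambda>t. (v (x + t *\<^sub>R b) - v x) /\<^sub>R t) \<longlongrightarrow> partial_deriv b v x) (at 0)"
      by (simp add: has_vector_derivative_iff_quotient)
    moreover have "filterlim h (at 0) sequentially"
    proof -
      have "h \<longlonglongrightarrow> 0" unfolding h_def using LIMSEQ_inverse_real_of_nat by (simp add: inverse_eq_divide)
      then show ?thesis using h(1) by (simp add: filterlim_at less_imp_neq[symmetric] eventually_sequentially)
    qed
    ultimately show ?thesis unfolding q_def by (rule filterlim_compose)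
  qed
  have bound: "norm (q n x) \<le> B * indicator (cball 0 (R + 1)) x" for n x
  proof (cases "norm x \<le> R + 1")
    case True
    have "norm (v (x + h n *\<^sub>R b) - v x) \<le> B * h n"
      using B(2)[of "x + h n *\<^sub>R b" x] b h(1)[of n] by simp
    then have "norm (v (x + h n *\<^sub>R b) - v x) / h n \<le> B"
      using h(1)[of n] by (simp add: pos_divide_le_eq)
    then show ?thesis using True h(1)[of n] by (simp add: q_def divide_inverse_commute)
  next
    case False
    have "norm x \<le> norm (x + h n *\<^sub>R b) + norm (h n *\<^sub>R b)"
      using norm_triangle_ineq4[of "x + h n *\<^sub>R b" "h n *\<^sub>R b"] by simp
    then have "norm x \<le> norm (x + h n *\<^sub>R b) + 1"
      using b h[of n] by simp
    then have "x + h n *\<^sub>R b \<notin> K" "x \<notin> K" using False R[of x] R[of "x + h n *\<^sub>R b"] by auto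
    then show ?thesis using K(3) False by (simp add: q_def)
  qed
  have "(\<lambda>n. \<integral>x. q n x \<partial>lborel) \<longlonglongrightarrow> (\<integral>x. partial_deriv b v x \<partial>lborel)"
  proof (rule integral_dominated_convergence[where w = "\<lambda>x. B * indicator (cball (0::'a) (R + 1)) x"])
    show "partial_deriv b v \<in> borel_measurable lborel"
      using test_functions_integrable[OF test_functions_partial_deriv[OF v b]] by simp
    show "q n \<in> borel_measurable lborel" for n
      unfolding q_def using shift(1)[of "h n *\<^sub>R b"] int_v
      by (intro borel_measurable_scaleR borel_measurable_diff) (simp_all add: borel_measurable_integrable)
    show "integrable lborel (\<lambda>x. B * indicator (cball (0::'a) (R + 1)) x)"
      using emeasure_lborel_cball_finite[of "0::'a" "R + 1"]
      by (intro integrable_mult_right integrable_real_indicator) auto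
  qed (use lim bound in auto)
  then show ?thesis by (simp add: int_q LIMSEQ_const_iff)
qed

lemma nn_integral_inverse_square: "(\<integral>\<^sup>+x. ennreal (1 / (1 + \<bar>x\<bar>)\<^sup>2) \<partial>(lborel :: real measure)) < \<infinity>"
proof -
  let ?f = "\<lambda>x::real. 1 / (1 + \<bar>x\<bar>)\<^sup>2"
  have [measurable]: "?f \<in> borel_measurable borel" by measurable
  have "((\<lambda>x::real. - 1 / (1 + x)) \<longlongrightarrow> 0) at_top"
    by (intro tendsto_divide_0[OF tendsto_const] filterlim_at_top_imp_at_infinity
        filterlim_tendsto_add_at_top[OF tendsto_const] filterlim_ident)
  then have "(\<integral>\<^sup>+x. ennreal (?f x) * indicator {0..} x \<partial>lborel) = ennreal (0 - (- 1 / (1 + 0)))"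
    by (intro nn_integral_FTC_atLeast)
       (auto intro!: derivative_eq_intros simp: power2_eq_square divide_simps)
  then have pos: "(\<integral>\<^sup>+x. ennreal (?f x) * indicator {0..} x \<partial>lborel) = 1" by simp
  have neg: "(\<integral>\<^sup>+x. ennreal (?f x) * indicator {..0} x \<partial>lborel) = 1"
    by (subst nn_integral_real_affine[where c = "-1" and t = 0])
       (use pos in \<open>auto simp: indicator_def cong: if_cong\<close>)
  have "(\<integral>\<^sup>+x. ennreal (?f x) \<partial>lborel) \<le>
      (\<integral>\<^sup>+x. ennreal (?f x) * indicator {0..} x + ennreal (?f x) * indicator {..0} x \<partial>lborel)"
    by (intro nn_integral_mono) (auto simp: indicator_def)
  also have "\<dots> = 1 + 1"
    by (subst nn_integral_add) (simp_all add: pos neg)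
  finally show ?thesis by (simp add: order.strict_trans1)
qed

text \<open>
  Each factor \<open>1 + \<bar>x \<bullet> b\<bar>\<close> is at most \<open>1 + norm x\<close>, which dominates the function by a
  product of functions of one coordinate; two powers per coordinate make each of them integrable.
\<close>

lemma integrable_polynomial_decay:
  assumes s: "s \<le> - 2 * real DIM('a)"
  shows "integrable lborel (\<lambda>x::'a::euclidean_space. (1 + norm x) powr s)"
proof -
  have [measurable]: "(\<lambda>x::'a. (1 + norm x) powr s) \<in> borel_measurable borel" by measurable
  have le: "(1 + norm x) powr s \<le> (\<Prod>b\<in>Basis. 1 / (1 + \<bar>x \<bullet> b\<bar>)\<^sup>2)" for x :: 'a
  proof -
    have "(\<Prod>b\<in>Basis. (1 + \<bar>x \<bullet> b\<bar>)\<^sup>2) \<le> (\<Prod>b\<in>(Basis::'a set). (1 + norm x)\<^sup>2)"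
      by (intro prod_mono conjI power_mono add_left_mono Basis_le_norm) auto
    also have "\<dots> = (1 + norm x) powr (2 * real DIM('a))"
      using powr_realpow[of "1 + norm x" "2 * DIM('a)"] by (simp add: power_mult add_pos_nonneg)
    finally have "inverse ((1 + norm x) powr (2 * real DIM('a))) \<le> inverse (\<Prod>b\<in>Basis. (1 + \<bar>x \<bullet> b\<bar>)\<^sup>2)"
      by (intro le_imp_inverse_le prod_pos) auto
    moreover have "(1 + norm x) powr s \<le> (1 + norm x) powr (- (2 * real DIM('a)))"
      using s by (intro powr_mono) auto
    ultimately show ?thesis
      by (simp add: powr_minus prod_dividef inverse_eq_divide)
  qed
  have "(\<integral>\<^sup>+x. ennreal ((1 + norm x) powr s) \<partial>(lborel :: 'a measure)) \<le>
      (\<integral>\<^sup>+x. (\<Prod>b\<in>Basis. ennreal (1 / (1 + \<bar>(x::'a) \<bullet> b\<bar>)\<^sup>2)) \<partial>lborel)"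
    using le by (intro nn_integral_mono) (simp add: prod_ennreal ennreal_leI)
  also have "\<dots> = (\<Prod>b\<in>(Basis::'a set). (\<integral>\<^sup>+x. ennreal (1 / (1 + \<bar>x\<bar>)\<^sup>2) \<partial>lborel))"
    by (rule nn_integral_lborel_prod[where f = "\<lambda>b x. ennreal (1 / (1 + \<bar>x\<bar>)\<^sup>2)"]) auto
  also have "\<dots> < \<infinity>"
    using nn_integral_inverse_square by (simp add: power_less_top_ennreal)
  finally show ?thesis by (intro integrableI_bounded) auto
qed

lemma integrable_polynomial_bound:
  fixes f :: "'a::euclidean_space \<Rightarrow> 'b::{banach,second_countable_topology}"
  assumes "f \<in> borel_measurable borel" "s \<le> - 2 * real DIM('a)"
    and "\<And>x. norm (f x) \<le> C * (1 + norm x) powr s"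
  shows "integrable lborel f"
proof (rule Bochner_Integration.integrable_bound)
  show "integrable lborel (\<lambda>x::'a. C * (1 + norm x) powr s)"
    by (intro integrable_mult_right integrable_polynomial_decay assms)
  show "AE x in lborel. norm (f x) \<le> norm (C * (1 + norm x) powr s)"
    using assms(3) order_trans[OF _ abs_ge_self] by auto
qed (use assms in simp)

text \<open>Removing a cutoff from an absolutely convergent integral.\<close>

lemma tendsto_integral_cutoff:
  fixes h :: "'a::euclidean_space \<Rightarrow> complex"
  assumes h: "integrable lborel h" and psi: "\<psi> \<in> test_functions UNIV"
  shows "((\<lambda>\<epsilon>. \<integral>x. h x * \<psi> (\<epsilon> *\<^sub>R x) \<partial>lborel) \<longlongrightarrow> (\<integral>x. h x \<partial>lborel) * \<psi> 0) (at_right 0)"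
proof -
  obtain B where B: "B > 0" "\<And>x. norm (\<psi> x) \<le> B" using test_functions_bounded[OF psi] by metis
  have cont: "continuous_on UNIV \<psi>" by (rule test_functions_continuous[OF psi])
  have [measurable]: "\<psi> \<in> borel_measurable borel"
    using cont by (rule borel_measurable_continuous_onI)
  have [measurable]: "h \<in> borel_measurable borel"
    using borel_measurable_integrable[OF h] by simp
  have "(\<lambda>n. \<integral>x. h x * \<psi> (S n *\<^sub>R x) \<partial>lborel) \<longlonglongrightarrow> (\<integral>x. h x * \<psi> 0 \<partial>lborel)"
    if S: "S \<longlonglongrightarrow> 0" for S :: "nat \<Rightarrow> real"
  proof (rule integral_dominated_convergence[where w = "\<lambda>x. norm (h x) * B"])
    have "(\<lambda>n. h x * \<psi> (S n *\<^sub>R x)) \<longlonglongrightarrow> h x * \<psi> 0" for x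
    proof -
      have "(\<lambda>n. S n *\<^sub>R x) \<longlonglongrightarrow> 0 *\<^sub>R x" by (intro tendsto_intros S)
      then have "(\<lambda>n. \<psi> (S n *\<^sub>R x)) \<longlonglongrightarrow> \<psi> 0"
        using cont continuous_on_tendsto_compose[of UNIV \<psi>] by simp
      then show ?thesis by (intro tendsto_intros)
    qed
    then show "AE x in lborel. (\<lambda>n. h x * \<psi> (S n *\<^sub>R x)) \<longlonglongrightarrow> h x * \<psi> 0" by simp
    show "AE x in lborel. norm (h x * \<psi> (S n *\<^sub>R x)) \<le> norm (h x) * B" for n
      using B(2) by (simp add: norm_mult mult_left_mono)
    show "integrable lborel (\<lambda>x. norm (h x) * B)"
      using h by (intro integrable_mult_left integrable_norm)
  qed simp_all
  then have "((\<lambda>\<epsilon>. \<integral>x. h x * \<psi> (\<epsilon> *\<^sub>R x) \<partial>lborel) \<longlongrightarrow> (\<integral>x. h x * \<psi> 0 \<partial>lborel)) (at_right 0)"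
    by (intro tendsto_at_right_sequentially[OF zero_less_one])
  then show ?thesis by simp
qed

section \<open>The inverse Jacobian\<close>

lemma matrix_mul_matrix_inv:
  fixes A :: "real^'n^'n"
  assumes "det A \<noteq> 0"
  shows "A ** matrix_inv A = mat 1" "matrix_inv A ** A = mat 1"
proof -
  have "\<exists>B. A ** B = mat 1 \<and> B ** A = mat 1"
    using assms unfolding invertible_det_nz[symmetric] invertible_def .
  then have "A ** matrix_inv A = mat 1 \<and> matrix_inv A ** A = mat 1"
    unfolding matrix_inv_def by (rule someI_ex)
  then show "A ** matrix_inv A = mat 1" "matrix_inv A ** A = mat 1" by auto
qed

lemma matrix_inv_cramer:
  fixes A :: "real^'n^'n"
  assumes "det A \<noteq> 0"
  shows "matrix_inv A $ k $ j = det (\<chi> i l. if l = k then axis j 1 $ i else A $ i $ l) / det A"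
proof -
  have "A ** matrix_inv A = mat 1"
    by (rule matrix_mul_matrix_inv[OF assms])
  then have "A *v (matrix_inv A *v axis j 1) = axis j 1"
    by (simp add: matrix_vector_mul_assoc)
  then have "matrix_inv A *v axis j 1 =
      (\<chi> k. det (\<chi> i l. if l = k then axis j 1 $ i else A $ i $ l) / det A)"
    using cramer[OF assms] by blast
  then have "(matrix_inv A *v axis j 1) $ k =
      det (\<chi> i l. if l = k then axis j 1 $ i else A $ i $ l) / det A"
    by simp
  then show ?thesis by (simp add: matrix_vector_mult_basis column_def)
qed

text \<open>By Cramer's rule the entries of the inverse are rational functions of the entries.\<close>

lemma smooth_on_matrix_inv:
  fixes F :: "'a::euclidean_space \<Rightarrow> real^'n^'n"
  assumes S: "open S" and F: "\<And>i j. smooth_on S (\<lambda>x. F x $ i $ j)"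
    and nz: "\<And>x. x \<in> S \<Longrightarrow> det (F x) \<noteq> 0"
  shows "smooth_on S (\<lambda>x. matrix_inv (F x) $ k $ j)"
proof -
  have entry: "smooth_on S (\<lambda>x. (\<chi> i l. if l = k then axis j 1 $ i else F x $ i $ l) $ i $ l)" for i l
    using F by (cases "l = k") (simp_all add: smooth_on_const[OF S])
  have "smooth_on S (\<lambda>x. det (\<chi> i l. if l = k then axis j 1 $ i else F x $ i $ l) * inverse (det (F x)))"
    by (intro smooth_on_mult smooth_on_det smooth_on_inverse entry F S nz)
  then show ?thesis
    by (rule smooth_on_cong[OF S, rotated]) (simp add: matrix_inv_cramer nz divide_inverse)
qed

section \<open>Decay of integrals without stationary points\<close>

text \<open>
  The Fourier transform of the push-forward of the measure \<open>v dy\<close> under \<open>chi\<close>; for the identity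
  map it is \<^const>\<open>fourier\<close>.  As an integral over the source it makes sense without a change of
  variables, also where \<open>chi\<close> is not injective.
\<close>

definition phase_transform ::
  "(real^'d \<Rightarrow> real^'d) \<Rightarrow> (real^'d \<Rightarrow> complex) \<Rightarrow> real^'d \<Rightarrow> complex" where
  "phase_transform chi v \<xi> = (\<integral>y. exp (- \<i> * of_real (chi y \<bullet> \<xi>)) * v y \<partial>lborel)"

lemma test_functions_exp_mult:
  assumes "open \<Omega>" "smooth_on \<Omega> chi" "v \<in> test_functions \<Omega>"
  shows "(\<lambda>y. exp (- \<i> * of_real (chi y \<bullet> \<xi>)) * v y) \<in> test_functions \<Omega>"
  using assms
  by (intro test_functions_mult smooth_on_exp smooth_on_mult smooth_on_of_real smooth_on_inner
      smooth_on_const)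

text \<open>
  Since \<open>D chi\<close> is invertible with inverse \<open>M\<close>, the exponential \<open>E y = exp (- i chi y \<bullet> \<xi>)\<close>
  satisfies \<open>\<xi>\<^sub>j E = i * (\<Sum>k. M\<^sub>k\<^sub>j \<partial>\<^sub>k E)\<close>.  Moving the derivatives to the
  other factor turns multiplication by \<open>\<xi>\<^sub>j\<close> into a differential operator acting on \<open>v\<close>.
\<close>

lemma phase_transform_mult_component:
  fixes \<Omega> :: "(real^'d) set"
  assumes \<Omega>: "open \<Omega>" and chi: "smooth_on \<Omega> chi"
    and nz: "\<And>y. y \<in> \<Omega> \<Longrightarrow> det (jacobian chi (at y)) \<noteq> 0"
    and v: "v \<in> test_functions \<Omega>"
  shows "\<exists>w\<in>test_functions \<Omega>. \<forall>\<xi>. phase_transform chi w \<xi> = \<i> * of_real (\<xi> $ j) * phase_transform chi v \<xi>"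
proof -
  define J where "J y = jacobian chi (at y)" for y
  \<comment> \<open>The transpose of the operator \<open>\<Sum>k. M\<^sub>k\<^sub>j \<partial>\<^sub>k\<close> maps \<open>v\<close> to \<open>- (\<Sum>k. \<partial>\<^sub>k (M\<^sub>k\<^sub>j v))\<close>, which is \<open>- w\<close> below.\<close>
  define u where "u k = (\<lambda>y. complex_of_real (matrix_inv (J y) $ k $ j) * v y)" for k
  have u: "u k \<in> test_functions \<Omega>" for k
    unfolding u_def J_def
    by (intro test_functions_mult smooth_on_of_real smooth_on_matrix_inv smooth_on_jacobian \<Omega> chi nz v)
  define w where "w = (\<lambda>y. \<Sum>k\<in>UNIV. partial_deriv (axis k 1) (u k) y)"
  have w: "w \<in> test_functions \<Omega>"
    unfolding w_def using u
    by (intro test_functions_sum test_functions_partial_deriv) (auto simp: axis_in_Basis_iff)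
  have "phase_transform chi w \<xi> = \<i> * of_real (\<xi> $ j) * phase_transform chi v \<xi>" for \<xi>
  proof -
    define E where "E y = exp (- \<i> * complex_of_real (chi y \<bullet> \<xi>))" for y
    have Eu: "(\<lambda>y. E y * u k y) \<in> test_functions \<Omega>" for k
      unfolding E_def by (rule test_functions_exp_mult[OF \<Omega> chi u])
    have pointwise: "(\<Sum>k\<in>UNIV. partial_deriv (axis k 1) (\<lambda>y. E y * u k y) y) =
        E y * w y - \<i> * of_real (\<xi> $ j) * (E y * v y)" for y
    proof (cases "y \<in> \<Omega>")
      case True
      have dchi: "(chi has_derivative (\<lambda>b. partial_deriv b chi y)) (at y)"
        by (rule smooth_on_has_partial_deriv[OF chi True])
      have "((\<lambda>y. - \<i> * complex_of_real (chi y \<bullet> \<xi>)) has_derivative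
          (\<lambda>b. - \<i> * complex_of_real (partial_deriv b chi y \<bullet> \<xi>))) (at y)"
        by (intro has_derivative_mult_right has_derivative_of_real has_derivative_inner_left dchi)
      then have dE: "(E has_derivative (\<lambda>b. E y * (- \<i> * complex_of_real (partial_deriv b chi y \<bullet> \<xi>)))) (at y)"
        unfolding E_def
        using has_derivative_compose[OF _ DERIV_exp[unfolded has_field_derivative_def]] by blast
      have du: "(u k has_derivative (\<lambda>b. partial_deriv b (u k) y)) (at y)" for k
        using smooth_on_has_partial_deriv[OF test_functions_smooth[OF u]] by simp
      have deriv: "partial_deriv b (\<lambda>y. E y * u k y) y =
          E y * partial_deriv b (u k) y - \<i> * of_real ((partial_deriv b chi y \<bullet> \<xi>) * (matrix_inv (J y) $ k $ j)) * (E y * v y)"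
        for b k
        using partial_deriv_eq[OF has_derivative_mult[OF dE du]] by (simp add: u_def algebra_simps)
      have "(\<Sum>k\<in>UNIV. (partial_deriv (axis k 1) chi y \<bullet> \<xi>) * (matrix_inv (J y) $ k $ j)) =
          (\<Sum>k\<in>UNIV. \<Sum>l\<in>UNIV. \<xi> $ l * (J y $ l $ k * matrix_inv (J y) $ k $ j))"
        by (simp add: inner_vec_def J_def jacobian_nth sum_distrib_left sum_distrib_right mult_ac)
      also have "\<dots> = (\<Sum>l\<in>UNIV. \<Sum>k\<in>UNIV. \<xi> $ l * (J y $ l $ k * matrix_inv (J y) $ k $ j))"
        by (rule sum.swap)
      also have "\<dots> = (\<Sum>l\<in>UNIV. \<xi> $ l * (J y ** matrix_inv (J y)) $ l $ j)"
        by (simp add: matrix_matrix_mult_def sum_distrib_left)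
      also have "J y ** matrix_inv (J y) = mat 1"
        unfolding J_def by (rule matrix_mul_matrix_inv[OF nz[OF True]])
      also have "(\<Sum>l\<in>UNIV. \<xi> $ l * (mat 1 :: real^'d^'d) $ l $ j) = \<xi> $ j"
        by (simp add: mat_def if_distrib cong: if_cong)
      finally have inv: "(\<Sum>k\<in>UNIV. (partial_deriv (axis k 1) chi y \<bullet> \<xi>) * (matrix_inv (J y) $ k $ j)) = \<xi> $ j" .
      show ?thesis
        unfolding deriv sum_subtractf w_def sum_distrib_left[symmetric] sum_distrib_right[symmetric]
          of_real_sum[symmetric] inv ..
    next
      case False
      then show ?thesis
        using test_functions_zero_outside[OF test_functions_partial_deriv[OF Eu]]
          test_functions_zero_outside[OF v] test_functions_zero_outside[OF w]
        by (simp add: axis_in_Basis_iff)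
    qed
    have int: "integrable lborel (\<lambda>y. E y * w y)" "integrable lborel (\<lambda>y. E y * v y)"
      unfolding E_def
      by (rule test_functions_integrable[OF test_functions_exp_mult[OF \<Omega> chi]], rule w v)+
    have "(\<integral>y. (\<Sum>k\<in>UNIV. partial_deriv (axis k 1) (\<lambda>y. E y * u k y) y) \<partial>lborel) =
        (\<Sum>k\<in>UNIV. \<integral>y. partial_deriv (axis k 1) (\<lambda>y. E y * u k y) y \<partial>lborel)"
      using test_functions_integrable[OF test_functions_partial_deriv[OF Eu]]
      by (intro Bochner_Integration.integral_sum) (auto simp: axis_in_Basis_iff)
    also have "\<dots> = 0"
      using integral_partial_deriv_eq_0[OF Eu] by (simp add: axis_in_Basis_iff)
    finally have "(\<integral>y. E y * w y \<partial>lborel) = \<i> * of_real (\<xi> $ j) * (\<integral>y. E y * v y \<partial>lborel)"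
      unfolding pointwise using int by simp
    then show ?thesis by (simp add: phase_transform_def E_def)
  qed
  with w show ?thesis by blast
qed

lemma phase_transform_rapid_decay:
  fixes \<Omega> :: "(real^'d) set"
  assumes \<Omega>: "open \<Omega>" and chi: "smooth_on \<Omega> chi"
    and nz: "\<And>y. y \<in> \<Omega> \<Longrightarrow> det (jacobian chi (at y)) \<noteq> 0"
    and v: "v \<in> test_functions \<Omega>"
  shows "\<exists>C. \<forall>\<xi>. (1 + norm \<xi>) ^ N * norm (phase_transform chi v \<xi>) \<le> C"
  using v
proof (induction N arbitrary: v)
  case 0
  have "norm (phase_transform chi v \<xi>) \<le> (\<integral>y. norm (v y) \<partial>lborel)" for \<xi>
    unfolding phase_transform_def
    by (rule order_trans[OF integral_norm_bound]) (simp add: norm_mult)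
  then show ?case by auto
next
  case (Suc N)
  have "\<exists>w\<in>test_functions \<Omega>. \<forall>\<xi>. phase_transform chi w \<xi> = \<i> * of_real (\<xi> $ j) * phase_transform chi v \<xi>" for j
    by (rule phase_transform_mult_component[OF \<Omega> chi nz Suc.prems])
  then obtain w where w: "\<And>j. w j \<in> test_functions \<Omega>"
    "\<And>j \<xi>. phase_transform chi (w j) \<xi> = \<i> * of_real (\<xi> $ j) * phase_transform chi v \<xi>"
    by metis
  obtain C0 where C0: "\<And>\<xi>. (1 + norm \<xi>) ^ N * norm (phase_transform chi v \<xi>) \<le> C0"
    using Suc.IH[OF Suc.prems] by blast
  have "\<exists>C. \<forall>\<xi>. (1 + norm \<xi>) ^ N * norm (phase_transform chi (w j) \<xi>) \<le> C" for j
    by (rule Suc.IH[OF w(1)])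
  then obtain C where C: "\<And>j \<xi>. (1 + norm \<xi>) ^ N * norm (phase_transform chi (w j) \<xi>) \<le> C j"
    by metis
  have "(1 + norm \<xi>) ^ Suc N * norm (phase_transform chi v \<xi>) \<le> C0 + (\<Sum>j\<in>UNIV. C j)" for \<xi>
  proof -
    let ?g = "(1 + norm \<xi>) ^ N * norm (phase_transform chi v \<xi>)"
    have "(1 + norm \<xi>) ^ Suc N * norm (phase_transform chi v \<xi>) = (1 + norm \<xi>) * ?g"
      by simp
    also have "\<dots> \<le> (1 + (\<Sum>j\<in>UNIV. \<bar>\<xi> $ j\<bar>)) * ?g"
      by (intro mult_right_mono add_left_mono norm_le_l1_cart) auto
    also have "\<dots> = ?g + (\<Sum>j\<in>UNIV. (1 + norm \<xi>) ^ N * norm (phase_transform chi (w j) \<xi>))"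
      by (simp add: w(2) norm_mult ring_distribs sum_distrib_left sum_distrib_right mult_ac)
    also have "\<dots> \<le> C0 + (\<Sum>j\<in>UNIV. C j)"
      by (intro add_mono sum_mono C0 C)
    finally show ?thesis .
  qed
  then show ?case by blast
qed

lemma phase_transform_decay_powr:
  fixes \<Omega> :: "(real^'d) set"
  assumes "open \<Omega>" "smooth_on \<Omega> chi" "\<And>y. y \<in> \<Omega> \<Longrightarrow> det (jacobian chi (at y)) \<noteq> 0"
    "v \<in> test_functions \<Omega>"
  shows "\<exists>C\<ge>0. \<forall>\<xi>. norm (phase_transform chi v \<xi>) \<le> C * (1 + norm \<xi>) powr s"
proof -
  obtain N :: nat where N: "- s \<le> real N" using real_arch_simple by blast
  obtain C where C: "\<And>\<xi>. (1 + norm \<xi>) ^ N * norm (phase_transform chi v \<xi>) \<le> C"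
    using phase_transform_rapid_decay[OF assms] by blast
  have "C \<ge> 0" using C[of 0] by (simp add: order_trans[OF norm_ge_zero])
  have "norm (phase_transform chi v \<xi>) \<le> C * (1 + norm \<xi>) powr s" for \<xi>
  proof -
    have "norm (phase_transform chi v \<xi>) = (1 + norm \<xi>) ^ N * norm (phase_transform chi v \<xi>) * (1 + norm \<xi>) powr (- real N)"
      by (simp add: powr_minus powr_realpow add_pos_nonneg add_nonneg_eq_0_iff)
    also have "\<dots> \<le> C * (1 + norm \<xi>) powr s"
      using N \<open>C \<ge> 0\<close> by (intro mult_mono C powr_mono) auto
    finally show ?thesis .
  qed
  with \<open>C \<ge> 0\<close> show ?thesis by blast
qed

lemma phase_transform_measurable:
  fixes \<Omega> :: "(real^'d) set"
  assumes \<Omega>: "open \<Omega>" and chi: "smooth_on \<Omega> chi" and v: "v \<in> test_functions \<Omega>"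
  shows "phase_transform chi v \<in> borel_measurable borel"
proof -
  let ?F = "\<lambda>(\<xi>, y). exp (- \<i> * complex_of_real (chi y \<bullet> \<xi>)) * v y"
  have "continuous_on (UNIV \<times> \<Omega>) ?F"
    unfolding case_prod_unfold
    by (intro continuous_intros continuous_on_compose2[OF smooth_on_continuous_on[OF chi] continuous_on_snd]
        continuous_on_compose2[OF test_functions_continuous[OF v] continuous_on_snd]) auto
  then have "(\<lambda>p. indicator (UNIV \<times> \<Omega>) p *\<^sub>R ?F p) \<in> borel_measurable borel"
    using \<Omega> by (intro borel_measurable_continuous_on_indicator) (auto intro!: borel_open open_Times)
  moreover have "(\<lambda>p. indicator (UNIV \<times> \<Omega>) p *\<^sub>R ?F p) = ?F"
    using test_functions_zero_outside[OF v] by (auto simp: indicator_def fun_eq_iff)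
  ultimately have "?F \<in> borel_measurable (borel \<Otimes>\<^sub>M lborel)"
    by (simp add: borel_prod[symmetric] cong: measurable_cong_sets sets_pair_measure_cong)
  then show ?thesis
    unfolding phase_transform_def[abs_def] by (rule lborel.borel_measurable_lebesgue_integral)
qed

section \<open>Regularised oscillatory integrals\<close>

lemma test_functions_scale:
  assumes psi: "\<psi> \<in> test_functions UNIV" and "\<epsilon> \<noteq> 0"
  shows "(\<lambda>\<xi>. \<psi> (\<epsilon> *\<^sub>R \<xi>)) \<in> test_functions UNIV"
proof -
  obtain K where K: "compact K" "K \<subseteq> UNIV" "\<And>x. x \<notin> K \<Longrightarrow> \<psi> x = 0"
    using test_functions_support[OF psi] by blast
  show ?thesis
  proof (rule test_functionsI[of _ "(\<lambda>x. (1 / \<epsilon>) *\<^sub>R x) ` K"])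
    show "smooth_on UNIV (\<lambda>\<xi>. \<psi> (\<epsilon> *\<^sub>R \<xi>))"
      by (rule smooth_on_compose[OF _ test_functions_smooth[OF psi]])
         (auto intro: smooth_on_linear bounded_linear_scaleR_right)
    show "compact ((\<lambda>x. (1 / \<epsilon>) *\<^sub>R x) ` K)" by (rule compact_scaling[OF K(1)])
    show "\<psi> (\<epsilon> *\<^sub>R x) = 0" if "x \<notin> (\<lambda>x. (1 / \<epsilon>) *\<^sub>R x) ` K" for x
    proof (rule K(3), rule notI)
      assume "\<epsilon> *\<^sub>R x \<in> K"
      then have "(1 / \<epsilon>) *\<^sub>R (\<epsilon> *\<^sub>R x) \<in> (\<lambda>x. (1 / \<epsilon>) *\<^sub>R x) ` K" by (rule imageI)
      with that \<open>\<epsilon> \<noteq> 0\<close> show False by simp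
    qed
  qed auto
qed

text \<open>
  An oscillatory integral only sees the dilated cutoffs with \<open>\<epsilon> > 0\<close>, which are test functions.
\<close>

lemma osc_value_cong:
  assumes "\<And>\<theta>. \<theta> \<in> test_functions UNIV \<Longrightarrow> I \<theta> = I' \<theta>"
  shows "osc_value I z \<longleftrightarrow> osc_value I' z"
  unfolding osc_value_def
proof (intro ball_cong refl tendsto_cong)
  fix \<psi> :: "'a \<Rightarrow> complex" assume "\<psi> \<in> cutoffs"
  then have "I (\<lambda>\<xi>. \<psi> (\<epsilon> *\<^sub>R \<xi>)) = I' (\<lambda>\<xi>. \<psi> (\<epsilon> *\<^sub>R \<xi>))" if "\<epsilon> > 0" for \<epsilon>
    using that by (intro assms test_functions_scale) (auto simp: cutoffs_def)
  then show "\<forall>\<^sub>F \<epsilon> in at_right 0. I (\<lambda>\<xi>. \<psi> (\<epsilon> *\<^sub>R \<xi>)) = I' (\<lambda>\<xi>. \<psi> (\<epsilon> *\<^sub>R \<xi>))"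
    by (simp add: eventually_at_filter)
qed

lemma integrable_regularised_integrand:
  fixes \<Omega> :: "('a::euclidean_space) set" and A :: "'a \<times> 'b::euclidean_space \<Rightarrow> complex"
  assumes A: "continuous_on (\<Omega> \<times> UNIV) A"
    and u: "u \<in> test_functions \<Omega>" and th: "\<theta> \<in> test_functions UNIV"
  shows "integrable lborel (\<lambda>(y, \<xi>). A (y, \<xi>) * u y * \<theta> \<xi>)"
proof -
  obtain K where K: "compact K" "K \<subseteq> \<Omega>" "\<And>x. x \<notin> K \<Longrightarrow> u x = 0"
    using test_functions_support[OF u] by blast
  obtain L where L: "compact L" "L \<subseteq> UNIV" "\<And>x. x \<notin> L \<Longrightarrow> \<theta> x = 0"
    using test_functions_support[OF th] by blast
  have "continuous_on (K \<times> L) A" using K(2) by (intro continuous_on_subset[OF A]) auto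
  then have "continuous_on (K \<times> L) (\<lambda>(y, \<xi>). A (y, \<xi>) * u y * \<theta> \<xi>)"
    unfolding case_prod_unfold
    by (intro continuous_intros continuous_on_compose2[OF test_functions_continuous[OF u] continuous_on_fst]
        continuous_on_compose2[OF test_functions_continuous[OF th] continuous_on_snd]) auto
  moreover have "(case p of (y, \<xi>) \<Rightarrow> A (y, \<xi>) * u y * \<theta> \<xi>) = 0" if "p \<notin> K \<times> L" for p
    using that K(3)[of "fst p"] L(3)[of "snd p"] by (cases p) auto
  ultimately show ?thesis
    by (intro integrable_compact_support[OF compact_Times[OF K(1) L(1)]])
qed

text \<open>
  Fubini's theorem applies to the regularised integral, whose integrand has compact support in
  \<open>\<Omega> \<times> UNIV\<close>; the two operators therefore agree before any limit is taken.
\<close>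

lemma kernel_operator_osc_kernel:
  fixes \<Omega> :: "(real^'d) set"
  assumes om: "continuous_on (\<Omega> \<times> UNIV) (\<lambda>(y, \<xi>). \<omega> ((x, y), \<xi>))"
    and c: "continuous_on (\<Omega> \<times> UNIV) (\<lambda>(y, \<xi>). c ((x, y), \<xi>))"
    and u: "u \<in> test_functions \<Omega>"
  shows "kernel_operator \<Omega> (osc_kernel \<omega> c) u x z \<longleftrightarrow> fourier_integral_operator \<Omega> \<omega> c u x z"
  unfolding kernel_operator_def fourier_integral_operator_def
proof (rule osc_value_cong)
  fix \<theta> :: "real^'d \<Rightarrow> complex" assume th: "\<theta> \<in> test_functions UNIV"
  let ?A = "\<lambda>(y, \<xi>). exp (\<i> * of_real (\<omega> ((x, y), \<xi>))) * c ((x, y), \<xi>)"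
  let ?F = "\<lambda>(y, \<xi>). exp (\<i> * of_real (\<omega> ((x, y), \<xi>))) * c ((x, y), \<xi>) * u y * \<theta> \<xi>"
  have "continuous_on (\<Omega> \<times> UNIV) ?A"
    using om c unfolding case_prod_unfold by (intro continuous_intros)
  then have int: "integrable lborel ?F"
    using integrable_regularised_integrand[OF _ u th, of ?A] by simp
  have ind: "indicator (\<Omega> \<times> UNIV) p *\<^sub>R ?F p = ?F p" for p
    using test_functions_zero_outside[OF u, of "fst p"] by (auto simp: indicator_def split: prod.splits)
  have "(\<integral>y\<in>\<Omega>. (osc_kernel \<omega> c \<theta> x y * u y) \<partial>lborel) =
      (\<integral>y. (\<integral>\<xi>. ?F (y, \<xi>) \<partial>lborel) / of_real ((2 * pi) ^ CARD('d)) \<partial>lborel)"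
    unfolding set_lebesgue_integral_def osc_kernel_def
  proof (rule Bochner_Integration.integral_cong[OF refl])
    fix y :: "real^'d"
    have "(\<integral>\<xi>. ?F (y, \<xi>) \<partial>lborel) = (\<integral>\<xi>. exp (\<i> * of_real (\<omega> ((x, y), \<xi>))) * c ((x, y), \<xi>) * \<theta> \<xi> * u y \<partial>lborel)"
      by (intro Bochner_Integration.integral_cong refl) (simp add: mult_ac)
    also have "\<dots> = (\<integral>\<xi>. exp (\<i> * of_real (\<omega> ((x, y), \<xi>))) * c ((x, y), \<xi>) * \<theta> \<xi> \<partial>lborel) * u y"
      by (rule integral_mult_left_zero)
    finally show "indicator \<Omega> y *\<^sub>R ((\<integral>\<xi>. exp (\<i> * of_real (\<omega> ((x, y), \<xi>))) * c ((x, y), \<xi>) * \<theta> \<xi> \<partial>lborel)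
          / of_real ((2 * pi) ^ CARD('d)) * u y) = (\<integral>\<xi>. ?F (y, \<xi>) \<partial>lborel) / of_real ((2 * pi) ^ CARD('d))"
      using test_functions_zero_outside[OF u, of y] by (cases "y \<in> \<Omega>") simp_all
  qed
  also have "\<dots> = (\<integral>y. (\<integral>\<xi>. ?F (y, \<xi>) \<partial>lborel) \<partial>lborel) / of_real ((2 * pi) ^ CARD('d))"
    by (rule integral_divide_zero)
  also have "(\<integral>y. (\<integral>\<xi>. ?F (y, \<xi>) \<partial>lborel) \<partial>lborel) = (\<integral>p. ?F p \<partial>lborel)"
    using lborel_pair.integral_fst'[of ?F] int by (simp add: lborel_prod)
  also have "\<dots> = (\<integral>p\<in>\<Omega> \<times> UNIV. ?F p \<partial>lborel)"
    unfolding set_lebesgue_integral_def ind ..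
  finally show "(\<integral>y\<in>\<Omega>. (osc_kernel \<omega> c \<theta> x y * u y) \<partial>lborel) =
      (\<integral>(y, \<xi>)\<in>\<Omega> \<times> UNIV. (exp (\<i> * of_real (\<omega> ((x, y), \<xi>))) * c ((x, y), \<xi>) * u y * \<theta> \<xi>) \<partial>lborel)
        / of_real ((2 * pi) ^ CARD('d))" .
qed

text \<open>
  Integrating over \<open>y\<close> first produces a rapidly decreasing function of \<open>\<xi>\<close>, against which
  the cutoff may be removed by dominated convergence.
\<close>

lemma fourier_integral_operator_separated:
  fixes \<Omega> :: "(real^'d) set"
  assumes \<Omega>: "open \<Omega>" and chi: "smooth_on \<Omega> chi"
    and nz: "\<And>y. y \<in> \<Omega> \<Longrightarrow> det (jacobian chi (at y)) \<noteq> 0"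
    and b: "continuous_on UNIV b" "\<And>\<xi>. norm (b \<xi>) \<le> C * (1 + norm \<xi>) powr m"
    and u: "(\<lambda>y. g y * u y) \<in> test_functions \<Omega>"
    and om: "\<And>y \<xi>. \<omega> ((x, y), \<xi>) = (z - chi y) \<bullet> \<xi>"
    and c: "\<And>y \<xi>. c ((x, y), \<xi>) = b \<xi> * g y"
  shows "fourier_integral_operator \<Omega> \<omega> c u x
    ((\<integral>\<xi>. exp (\<i> * of_real (z \<bullet> \<xi>)) * b \<xi> * phase_transform chi (\<lambda>y. g y * u y) \<xi> \<partial>lborel)
      / of_real ((2 * pi) ^ CARD('d)))"
proof -
  define w where "w = (\<lambda>y. g y * u y)"
  define h where "h \<xi> = exp (\<i> * of_real (z \<bullet> \<xi>)) * b \<xi> * phase_transform chi w \<xi>" for \<xi>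
  have w: "w \<in> test_functions \<Omega>" using u by (simp add: w_def)
  have inner: "(\<integral>(y, \<xi>)\<in>\<Omega> \<times> UNIV.
        (exp (\<i> * of_real (\<omega> ((x, y), \<xi>))) * c ((x, y), \<xi>) * u y * \<theta> \<xi>) \<partial>lborel) = (\<integral>\<xi>. h \<xi> * \<theta> \<xi> \<partial>lborel)"
    if th: "\<theta> \<in> test_functions UNIV" for \<theta>
  proof -
    let ?A = "\<lambda>(y, \<xi>). exp (\<i> * of_real ((z - chi y) \<bullet> \<xi>)) * b \<xi>"
    let ?F = "\<lambda>(y, \<xi>). exp (\<i> * of_real ((z - chi y) \<bullet> \<xi>)) * b \<xi> * w y * \<theta> \<xi>"
    have "continuous_on (\<Omega> \<times> UNIV) ?A"
      unfolding case_prod_unfold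
      by (intro continuous_intros continuous_on_compose2[OF smooth_on_continuous_on[OF chi] continuous_on_fst]
          continuous_on_compose2[OF b(1) continuous_on_snd]) auto
    then have int: "integrable lborel ?F"
      using integrable_regularised_integrand[OF _ w th, of ?A] by simp
    have ind: "indicator (\<Omega> \<times> UNIV) p *\<^sub>R ?F p = ?F p" for p
      using test_functions_zero_outside[OF w, of "fst p"] by (auto simp: indicator_def split: prod.splits)
    have "(\<lambda>(y, \<xi>). exp (\<i> * of_real (\<omega> ((x, y), \<xi>))) * c ((x, y), \<xi>) * u y * \<theta> \<xi>) = ?F"
      by (simp add: om c w_def fun_eq_iff)
    then have "(\<integral>(y, \<xi>)\<in>\<Omega> \<times> UNIV.
        (exp (\<i> * of_real (\<omega> ((x, y), \<xi>))) * c ((x, y), \<xi>) * u y * \<theta> \<xi>) \<partial>lborel) = (\<integral>p\<in>\<Omega> \<times> UNIV. ?F p \<partial>lborel)"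
      by (simp only:)
    also have "\<dots> = (\<integral>p. ?F p \<partial>lborel)"
      unfolding set_lebesgue_integral_def ind ..
    also have "\<dots> = (\<integral>\<xi>. (\<integral>y. ?F (y, \<xi>) \<partial>lborel) \<partial>lborel)"
      using lborel_pair.integral_snd[of "\<lambda>y \<xi>. ?F (y, \<xi>)"] int by (simp add: lborel_prod)
    also have "\<dots> = (\<integral>\<xi>. h \<xi> * \<theta> \<xi> \<partial>lborel)"
    proof (rule Bochner_Integration.integral_cong[OF refl])
      fix \<xi> :: "real^'d"
      have "(\<integral>y. ?F (y, \<xi>) \<partial>lborel) =
          (\<integral>y. (exp (\<i> * of_real (z \<bullet> \<xi>)) * b \<xi> * \<theta> \<xi>) * (exp (- \<i> * of_real (chi y \<bullet> \<xi>)) * w y) \<partial>lborel)"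
        by (intro Bochner_Integration.integral_cong refl)
           (simp add: inner_diff_left right_diff_distrib exp_diff exp_minus divide_inverse mult_ac)
      also have "\<dots> = (exp (\<i> * of_real (z \<bullet> \<xi>)) * b \<xi> * \<theta> \<xi>) * phase_transform chi w \<xi>"
        unfolding phase_transform_def by (rule integral_mult_right_zero)
      finally show "(\<integral>y. ?F (y, \<xi>) \<partial>lborel) = h \<xi> * \<theta> \<xi>" by (simp add: h_def mult_ac)
    qed
    finally show ?thesis .
  qed
  have "integrable lborel h"
  proof -
    \<comment> \<open>The exponent compensates the growth of \<open>b\<close> and leaves an integrable power.\<close>
    obtain D where D: "D \<ge> 0"
      "\<And>\<xi>. norm (phase_transform chi w \<xi>) \<le> D * (1 + norm \<xi>) powr (- 2 * real DIM(real^'d) - m)"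
      using phase_transform_decay_powr[OF \<Omega> chi nz w] by blast
    have "continuous_on UNIV (\<lambda>\<xi>. exp (\<i> * complex_of_real (z \<bullet> \<xi>)) * b \<xi>)"
      by (intro continuous_intros b)
    then have meas: "h \<in> borel_measurable borel"
      unfolding h_def[abs_def]
      by (rule borel_measurable_times[OF borel_measurable_continuous_onI phase_transform_measurable[OF \<Omega> chi w]])
    have "norm (h \<xi>) \<le> (C * D) * (1 + norm \<xi>) powr (- 2 * real DIM(real^'d))" for \<xi>
    proof -
      have "norm (h \<xi>) = norm (b \<xi>) * norm (phase_transform chi w \<xi>)"
        by (simp add: h_def norm_mult)
      also have "\<dots> \<le> (C * (1 + norm \<xi>) powr m) * (D * (1 + norm \<xi>) powr (- 2 * real DIM(real^'d) - m))"
        using order_trans[OF norm_ge_zero b(2)] by (intro mult_mono b(2) D(2)) auto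
      also have "\<dots> = (C * D) * ((1 + norm \<xi>) powr m * (1 + norm \<xi>) powr (- 2 * real DIM(real^'d) - m))"
        by (simp add: mult_ac)
      also have "\<dots> = (C * D) * (1 + norm \<xi>) powr (- 2 * real DIM(real^'d))"
        by (simp only: powr_add[symmetric]) simp
      finally show ?thesis .
    qed
    then show ?thesis by (rule integrable_polynomial_bound[OF meas order_refl])
  qed
  then have "osc_value (\<lambda>\<theta>. (\<integral>\<xi>. h \<xi> * \<theta> \<xi> \<partial>lborel) / of_real ((2 * pi) ^ CARD('d)))
      ((\<integral>\<xi>. h \<xi> \<partial>lborel) / of_real ((2 * pi) ^ CARD('d)))"
    unfolding osc_value_def cutoffs_def using tendsto_integral_cutoff[of h]
    by (fastforce intro!: tendsto_divide)
  then show ?thesis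
    unfolding fourier_integral_operator_def w_def[symmetric] h_def[symmetric]
    by (rule osc_value_cong[THEN iffD2, rotated]) (simp only: inner)
qed

section \<open>Oscillatory integrals with a linear phase\<close>

text \<open>Symbols without base point, i.e. \<open>S\<^sup>m\<close> in the frequency variable alone.\<close>

definition frequency_symbols :: "real \<Rightarrow> ('a::euclidean_space \<Rightarrow> complex) set" where
  "frequency_symbols m =
     {b. smooth_on UNIV b \<and>
         (\<forall>\<beta>\<in>lists Basis. \<exists>C. \<forall>\<xi>.
            norm (iter_partial \<beta> b \<xi>) \<le> C * (1 + norm \<xi>) powr (m - real (length \<beta>)))}"

lemma frequency_symbols_smooth: "b \<in> frequency_symbols m \<Longrightarrow> smooth_on UNIV b"
  by (simp add: frequency_symbols_def)

lemma frequency_symbols_bound: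
  assumes "b \<in> frequency_symbols m"
  obtains C where "C \<ge> 0" "\<And>\<xi>. norm (b \<xi>) \<le> C * (1 + norm \<xi>) powr m"
proof -
  have "\<exists>C. \<forall>\<xi>. norm (iter_partial [] b \<xi>) \<le> C * (1 + norm \<xi>) powr (m - real (length ([] :: 'a list)))"
    using assms lists.Nil unfolding frequency_symbols_def by blast
  then obtain C where C: "\<And>\<xi>. norm (b \<xi>) \<le> C * (1 + norm \<xi>) powr m" by auto
  have "C \<ge> 0" using order_trans[OF norm_ge_zero C[of 0]] by simp
  with C that show ?thesis by blast
qed

lemma frequency_symbols_partial_deriv:
  assumes b: "b \<in> frequency_symbols m" and e: "e \<in> Basis"
  shows "partial_deriv e b \<in> frequency_symbols (m - 1)"
  unfolding frequency_symbols_def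
proof (intro CollectI conjI ballI)
  show "smooth_on UNIV (partial_deriv e b)"
    by (rule smooth_on_partial_deriv[OF frequency_symbols_smooth[OF b] e])
  fix \<beta> :: "'a list" assume "\<beta> \<in> lists Basis"
  then have "\<beta> @ [e] \<in> lists Basis" using e by simp
  then have "\<exists>C. \<forall>\<xi>. norm (iter_partial (\<beta> @ [e]) b \<xi>) \<le>
      C * (1 + norm \<xi>) powr (m - real (length (\<beta> @ [e])))"
    using b unfolding frequency_symbols_def by blast
  then show "\<exists>C. \<forall>\<xi>. norm (iter_partial \<beta> (partial_deriv e b) \<xi>) \<le>
      C * (1 + norm \<xi>) powr (m - 1 - real (length \<beta>))"
    by (simp add: iter_partial_snoc algebra_simps)
qed

text \<open>Derivatives in the second variable may be computed with the base point frozen.\<close>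

lemma iter_partial_slice:
  fixes a :: "'a::euclidean_space \<times> 'b::euclidean_space \<Rightarrow> complex"
  assumes a: "smooth_on (U \<times> UNIV) a" and x: "x \<in> U"
  shows "\<beta> \<in> lists Basis \<Longrightarrow>
    iter_partial \<beta> (\<lambda>\<xi>. a (x, \<xi>)) = (\<lambda>\<xi>. iter_partial (map (\<lambda>b. (0, b)) \<beta>) a (x, \<xi>))"
proof (induction \<beta>)
  case (Cons b \<beta>)
  let ?G = "iter_partial (map (\<lambda>b. (0, b)) \<beta>) a"
  have IH: "iter_partial \<beta> (\<lambda>\<xi>. a (x, \<xi>)) = (\<lambda>\<xi>. ?G (x, \<xi>))"
    using Cons by simp
  have "smooth_on (U \<times> UNIV) ?G"
    using Cons.prems by (intro smooth_on_iter_partial[OF a]) (auto simp: Basis_prod_def)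
  then have G: "(?G has_derivative frechet_derivative ?G (at (x, \<xi>))) (at (x, \<xi>))" for \<xi>
    using x by (intro smooth_on_has_derivative) auto
  have "((\<lambda>\<xi>. ?G (x, \<xi>)) has_derivative (\<lambda>h. frechet_derivative ?G (at (x, \<xi>)) (0, h))) (at \<xi>)" for \<xi>
    by (rule has_derivative_compose[where f = "\<lambda>\<xi>. (x, \<xi>)" and g = ?G])
       (intro has_derivative_Pair has_derivative_const has_derivative_ident G)+
  from frechet_derivative_at[OF this, symmetric] show ?case
    by (simp add: IH)
qed simp

lemma symbol_class_slice:
  assumes a: "a \<in> symbol_class m U" and x: "x \<in> U"
  shows "(\<lambda>\<xi>. a (x, \<xi>)) \<in> frequency_symbols m"
  unfolding frequency_symbols_def
proof (intro CollectI conjI ballI)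
  have smooth: "smooth_on (U \<times> UNIV) a" using a by (simp add: symbol_class_def)
  show "smooth_on UNIV (\<lambda>\<xi>. a (x, \<xi>))"
    by (rule smooth_on_compose[OF _ smooth])
       (use x in \<open>auto intro!: smooth_on_Pair smooth_on_const smooth_on_ident\<close>)
  fix \<beta> :: "'b list" assume \<beta>: "\<beta> \<in> lists Basis"
  have "\<exists>C. \<forall>x\<in>U. \<forall>\<xi>. norm (mixed_partial [] \<beta> a (x, \<xi>)) \<le> C * (1 + norm \<xi>) powr (m - real (length \<beta>))"
    using a \<beta> unfolding symbol_class_def by blast
  then show "\<exists>C. \<forall>\<xi>. norm (iter_partial \<beta> (\<lambda>\<xi>. a (x, \<xi>)) \<xi>) \<le> C * (1 + norm \<xi>) powr (m - real (length \<beta>))"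
    using x by (auto simp: iter_partial_slice[OF smooth x \<beta>] mixed_partial_def)
qed

text \<open>
  On the support of \<open>\<psi> (\<epsilon> *\<^sub>R \<xi>)\<close> the product \<open>\<epsilon> * (1 + norm \<xi>)\<close> is bounded, so every
  power of \<open>\<epsilon>\<close> is worth a power of \<open>1 / (1 + norm \<xi>)\<close>.
\<close>

lemma cutoff_power_bound:
  assumes psi: "\<psi> \<in> test_functions UNIV"
  obtains C where "C \<ge> 0"
    "\<And>\<epsilon> \<xi>. 0 < \<epsilon> \<Longrightarrow> \<epsilon> \<le> 1 \<Longrightarrow> \<epsilon> ^ k * norm (\<psi> (\<epsilon> *\<^sub>R \<xi>)) \<le> C * (1 + norm \<xi>) powr (- real k)"
proof -
  obtain B where B: "B > 0" "\<And>x. norm (\<psi> x) \<le> B" using test_functions_bounded[OF psi] by metis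
  obtain K where K: "compact K" "K \<subseteq> UNIV" "\<And>x. x \<notin> K \<Longrightarrow> \<psi> x = 0"
    using test_functions_support[OF psi] by blast
  obtain R where R: "R > 0" "\<And>x. x \<in> K \<Longrightarrow> norm x \<le> R"
    using compact_imp_bounded[OF K(1)] unfolding bounded_pos by auto
  have "\<epsilon> ^ k * norm (\<psi> (\<epsilon> *\<^sub>R \<xi>)) \<le> ((1 + R) ^ k * B) * (1 + norm \<xi>) powr (- real k)"
    if eps: "0 < \<epsilon>" "\<epsilon> \<le> 1" for \<epsilon> :: real and \<xi>
  proof (cases "\<epsilon> *\<^sub>R \<xi> \<in> K")
    case True
    then have "\<epsilon> * norm \<xi> \<le> R" using R(2)[OF True] eps by simp
    then have "\<epsilon> * (1 + norm \<xi>) \<le> 1 + R" using eps by (simp add: ring_distribs)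
    then have "\<epsilon> ^ k * (1 + norm \<xi>) ^ k \<le> (1 + R) ^ k"
      unfolding power_mult_distrib[symmetric] using eps by (intro power_mono) auto
    then have "\<epsilon> ^ k \<le> (1 + R) ^ k / (1 + norm \<xi>) ^ k"
      by (simp add: pos_le_divide_eq add_pos_nonneg)
    then have "\<epsilon> ^ k \<le> (1 + R) ^ k * (1 + norm \<xi>) powr (- real k)"
      by (simp add: powr_minus powr_realpow add_pos_nonneg divide_inverse)
    then have "\<epsilon> ^ k * norm (\<psi> (\<epsilon> *\<^sub>R \<xi>)) \<le> ((1 + R) ^ k * (1 + norm \<xi>) powr (- real k)) * B"
      using eps R by (intro mult_mono B) auto
    then show ?thesis by (simp add: mult_ac)
  next
    case False
    then show ?thesis using K(3) B R by simp
  qed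
  then show ?thesis using that[of "(1 + R) ^ k * B"] B R by simp
qed

lemma integral_linear_phase_by_parts:
  fixes b \<psi> :: "'a::euclidean_space \<Rightarrow> complex"
  assumes b: "smooth_on UNIV b" and psi: "\<psi> \<in> test_functions UNIV"
    and e: "e \<in> Basis" "z \<bullet> e \<noteq> 0" and eps: "\<epsilon> \<noteq> 0"
  shows "(\<integral>\<xi>. exp (\<i> * of_real (z \<bullet> \<xi>)) * b \<xi> * \<psi> (\<epsilon> *\<^sub>R \<xi>) \<partial>lborel) =
    \<i> / of_real (z \<bullet> e) *
      ((\<integral>\<xi>. exp (\<i> * of_real (z \<bullet> \<xi>)) * partial_deriv e b \<xi> * \<psi> (\<epsilon> *\<^sub>R \<xi>) \<partial>lborel) +
       of_real \<epsilon> * (\<integral>\<xi>. exp (\<i> * of_real (z \<bullet> \<xi>)) * b \<xi> * partial_deriv e \<psi> (\<epsilon> *\<^sub>R \<xi>) \<partial>lborel))"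
proof -
  define E where "E \<xi> = exp (\<i> * complex_of_real (z \<bullet> \<xi>))" for \<xi>
  have E: "smooth_on UNIV E"
    unfolding E_def
    by (intro smooth_on_exp smooth_on_mult smooth_on_const smooth_on_of_real smooth_on_inner smooth_on_ident) auto
  have test: "(\<lambda>\<xi>. E \<xi> * c \<xi> * \<phi> (\<epsilon> *\<^sub>R \<xi>)) \<in> test_functions UNIV"
    if "smooth_on UNIV c" "\<phi> \<in> test_functions UNIV" for c \<phi>
    using that eps by (intro test_functions_mult smooth_on_mult E test_functions_scale) auto
  have dE: "(E has_derivative (\<lambda>h. E \<xi> * (\<i> * complex_of_real (z \<bullet> h)))) (at \<xi>)" for \<xi>
  proof -
    have "((\<lambda>\<xi>. \<i> * complex_of_real (z \<bullet> \<xi>)) has_derivative (\<lambda>h. \<i> * complex_of_real (z \<bullet> h))) (at \<xi>)"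
      by (intro has_derivative_mult_right has_derivative_of_real has_derivative_inner_right has_derivative_ident)
    then show ?thesis
      unfolding E_def using has_derivative_compose[OF _ DERIV_exp[unfolded has_field_derivative_def]] by blast
  qed
  have db: "(b has_derivative (\<lambda>h. partial_deriv h b \<xi>)) (at \<xi>)" for \<xi>
    by (rule smooth_on_has_partial_deriv[OF b]) simp
  have dpsi: "((\<lambda>\<xi>. \<psi> (\<epsilon> *\<^sub>R \<xi>)) has_derivative (\<lambda>h. partial_deriv (\<epsilon> *\<^sub>R h) \<psi> (\<epsilon> *\<^sub>R \<xi>))) (at \<xi>)" for \<xi>
    by (rule has_derivative_compose[OF _ smooth_on_has_partial_deriv[OF test_functions_smooth[OF psi]]])
       (auto intro!: derivative_eq_intros)
  have lin: "partial_deriv (\<epsilon> *\<^sub>R h) \<psi> \<eta> = of_real \<epsilon> * partial_deriv h \<psi> \<eta>" for h \<eta>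
    using linear_cmul[OF has_derivative_linear[OF smooth_on_has_partial_deriv[OF test_functions_smooth[OF psi], of \<eta>]], of \<epsilon> h]
    by (simp add: scaleR_conv_of_real)
  have "partial_deriv e (\<lambda>\<xi>. E \<xi> * b \<xi> * \<psi> (\<epsilon> *\<^sub>R \<xi>)) \<xi> =
      \<i> * of_real (z \<bullet> e) * (E \<xi> * b \<xi> * \<psi> (\<epsilon> *\<^sub>R \<xi>)) + E \<xi> * partial_deriv e b \<xi> * \<psi> (\<epsilon> *\<^sub>R \<xi>) +
      of_real \<epsilon> * (E \<xi> * b \<xi> * partial_deriv e \<psi> (\<epsilon> *\<^sub>R \<xi>))" for \<xi>
    using partial_deriv_eq[OF has_derivative_mult[OF has_derivative_mult[OF dE db] dpsi]]
    by (simp add: lin algebra_simps)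
  then have "0 = (\<integral>\<xi>. \<i> * of_real (z \<bullet> e) * (E \<xi> * b \<xi> * \<psi> (\<epsilon> *\<^sub>R \<xi>)) +
      E \<xi> * partial_deriv e b \<xi> * \<psi> (\<epsilon> *\<^sub>R \<xi>) +
      of_real \<epsilon> * (E \<xi> * b \<xi> * partial_deriv e \<psi> (\<epsilon> *\<^sub>R \<xi>)) \<partial>lborel)"
    using integral_partial_deriv_eq_0[OF test[OF b psi] e(1)] by simp
  also have "\<dots> = \<i> * of_real (z \<bullet> e) * (\<integral>\<xi>. E \<xi> * b \<xi> * \<psi> (\<epsilon> *\<^sub>R \<xi>) \<partial>lborel) +
      (\<integral>\<xi>. E \<xi> * partial_deriv e b \<xi> * \<psi> (\<epsilon> *\<^sub>R \<xi>) \<partial>lborel) +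
      of_real \<epsilon> * (\<integral>\<xi>. E \<xi> * b \<xi> * partial_deriv e \<psi> (\<epsilon> *\<^sub>R \<xi>) \<partial>lborel)"
    using test_functions_integrable[OF test[OF b psi]]
      test_functions_integrable[OF test[OF smooth_on_partial_deriv[OF b e(1)] psi]]
      test_functions_integrable[OF test[OF b test_functions_partial_deriv[OF psi e(1)]]]
    by simp
  finally have eq: "0 = \<i> * of_real (z \<bullet> e) * (\<integral>\<xi>. E \<xi> * b \<xi> * \<psi> (\<epsilon> *\<^sub>R \<xi>) \<partial>lborel) +
      (\<integral>\<xi>. E \<xi> * partial_deriv e b \<xi> * \<psi> (\<epsilon> *\<^sub>R \<xi>) \<partial>lborel) +
      of_real \<epsilon> * (\<integral>\<xi>. E \<xi> * b \<xi> * partial_deriv e \<psi> (\<epsilon> *\<^sub>R \<xi>) \<partial>lborel)" .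
  have solve: "A = \<i> / c * (B + C)" if "0 = \<i> * c * A + B + C" "c \<noteq> 0" for A B C c :: complex
  proof -
    have "B + C = - (\<i> * c * A)"
      using that(1) by (simp add: eq_neg_iff_add_eq_0 add_ac)
    then show ?thesis using that(2) by simp
  qed
  show ?thesis
    using solve[OF eq] e(2) unfolding E_def by simp
qed

text \<open>
  Integration by parts in a direction \<open>e\<close> with \<open>z \<bullet> e \<noteq> 0\<close> either lowers the order of the
  symbol or, if the derivative falls on the cutoff, gains a factor \<open>\<epsilon>\<close>.  Allowing powers of
  \<open>\<epsilon>\<close> in front of the integral makes the two cases alike: both lower \<open>m - k\<close> by one, until
  the integral converges absolutely.  Only the terms without a factor \<open>\<epsilon>\<close> survive in the
  limit, which therefore depends on the cutoff through \<open>\<psi> 0\<close> alone.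
\<close>

lemma linear_phase_limit:
  fixes z :: "'a::euclidean_space"
  assumes e: "e \<in> Basis" "z \<bullet> e \<noteq> 0"
  shows "b \<in> frequency_symbols m \<Longrightarrow> m - real k - real n \<le> - 2 * real DIM('a) - 1 \<Longrightarrow>
    \<exists>L. \<forall>\<psi>\<in>test_functions UNIV.
      ((\<lambda>\<epsilon>. of_real (\<epsilon> ^ k) * (\<integral>\<xi>. exp (\<i> * of_real (z \<bullet> \<xi>)) * b \<xi> * \<psi> (\<epsilon> *\<^sub>R \<xi>) \<partial>lborel))
        \<longlongrightarrow> (if k = 0 then L * \<psi> 0 else 0)) (at_right 0)"
proof (induction n arbitrary: b m k)
  case 0
  define h where "h \<xi> = exp (\<i> * complex_of_real (z \<bullet> \<xi>)) * b \<xi>" for \<xi>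
  obtain C where C: "C \<ge> 0" "\<And>\<xi>. norm (b \<xi>) \<le> C * (1 + norm \<xi>) powr m"
    using frequency_symbols_bound[OF 0(1)] by blast
  have "continuous_on UNIV h"
    unfolding h_def by (intro continuous_intros smooth_on_continuous_on frequency_symbols_smooth[OF 0(1)])
  then have meas: "h \<in> borel_measurable borel" by (rule borel_measurable_continuous_onI)
  have norm_h: "norm (h \<xi>) \<le> C * (1 + norm \<xi>) powr m" for \<xi>
    using C(2)[of \<xi>] by (simp add: h_def norm_mult)
  show ?case
  proof (cases "k = 0")
    case True
    have "integrable lborel h"
      by (rule integrable_polynomial_bound[OF meas _ norm_h]) (use 0(2) True in simp)
    then have "\<forall>\<psi>\<in>test_functions UNIV.
        ((\<lambda>\<epsilon>. \<integral>\<xi>. h \<xi> * \<psi> (\<epsilon> *\<^sub>R \<xi>) \<partial>lborel) \<longlongrightarrow> (\<integral>\<xi>. h \<xi> \<partial>lborel) * \<psi> 0) (at_right 0)"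
      using tendsto_integral_cutoff by blast
    then show ?thesis using True unfolding h_def by auto
  next
    case False
    \<comment> \<open>All powers of \<open>\<epsilon>\<close> but one are spent on decay in \<open>\<xi>\<close>; the last one makes the bound tend
      to \<open>0\<close>.  This is why the assumed exponent has an extra \<open>- 1\<close>.\<close>
    then obtain j where j: "k = Suc j" using not0_implies_Suc by blast
    have "((\<lambda>\<epsilon>. of_real (\<epsilon> ^ k) * (\<integral>\<xi>. h \<xi> * \<psi> (\<epsilon> *\<^sub>R \<xi>) \<partial>lborel)) \<longlongrightarrow> 0) (at_right 0)"
      if psi: "\<psi> \<in> test_functions UNIV" for \<psi>
    proof -
      let ?g = "\<lambda>\<xi>::'a. (1 + norm \<xi>) powr (m - real j)"
      obtain D where D: "D \<ge> 0" "\<And>\<epsilon> \<xi>. 0 < \<epsilon> \<Longrightarrow> \<epsilon> \<le> 1 \<Longrightarrow>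
          \<epsilon> ^ j * norm (\<psi> (\<epsilon> *\<^sub>R \<xi>)) \<le> D * (1 + norm \<xi>) powr (- real j)"
        using cutoff_power_bound[OF psi, of j] by blast
      have g: "integrable lborel (\<lambda>\<xi>. C * D * ?g \<xi>)"
        using 0(2) j by (intro integrable_mult_right integrable_polynomial_decay) simp
      have bound: "norm (of_real (\<epsilon> ^ k) * (\<integral>\<xi>. h \<xi> * \<psi> (\<epsilon> *\<^sub>R \<xi>) \<partial>lborel)) \<le> \<epsilon> * (\<integral>\<xi>. C * D * ?g \<xi> \<partial>lborel)"
        if eps: "0 < \<epsilon>" "\<epsilon> \<le> 1" for \<epsilon> :: real
      proof -
        have "norm (of_real (\<epsilon> ^ j) * (h \<xi> * \<psi> (\<epsilon> *\<^sub>R \<xi>))) \<le> C * D * ?g \<xi>" for \<xi>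
        proof -
          have "norm (of_real (\<epsilon> ^ j) * (h \<xi> * \<psi> (\<epsilon> *\<^sub>R \<xi>))) = norm (h \<xi>) * (\<epsilon> ^ j * norm (\<psi> (\<epsilon> *\<^sub>R \<xi>)))"
            using eps by (simp add: norm_mult norm_power mult_ac)
          also have "\<dots> \<le> (C * (1 + norm \<xi>) powr m) * (D * (1 + norm \<xi>) powr (- real j))"
            using C(1) eps by (intro mult_mono norm_h D(2)) auto
          also have "\<dots> = C * D * ?g \<xi>"
            by (simp add: powr_add[symmetric] mult_ac flip: mult.assoc)
          finally show ?thesis .
        qed
        then have "norm (\<integral>\<xi>. of_real (\<epsilon> ^ j) * (h \<xi> * \<psi> (\<epsilon> *\<^sub>R \<xi>)) \<partial>lborel) \<le> (\<integral>\<xi>. C * D * ?g \<xi> \<partial>lborel)"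
          using C(1) D(1)
          by (intro order_trans[OF Bochner_Integration.integral_norm_bound integral_mono'[OF g]]) simp_all
        then have "\<epsilon> * norm (of_real (\<epsilon> ^ j) * (\<integral>\<xi>. h \<xi> * \<psi> (\<epsilon> *\<^sub>R \<xi>) \<partial>lborel)) \<le> \<epsilon> * (\<integral>\<xi>. C * D * ?g \<xi> \<partial>lborel)"
          using eps by (intro mult_left_mono) (simp_all del: of_real_power)
        then show ?thesis using eps by (simp add: j norm_mult norm_power mult_ac)
      qed
      show ?thesis
      proof (rule Lim_null_comparison)
        show "\<forall>\<^sub>F \<epsilon> in at_right 0. norm (of_real (\<epsilon> ^ k) * (\<integral>\<xi>. h \<xi> * \<psi> (\<epsilon> *\<^sub>R \<xi>) \<partial>lborel)) \<le>
            \<epsilon> * (\<integral>\<xi>. C * D * ?g \<xi> \<partial>lborel)"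
          using bound by (intro eventually_at_rightI[of 0 1]) auto
        show "((\<lambda>\<epsilon>. \<epsilon> * (\<integral>\<xi>. C * D * ?g \<xi> \<partial>lborel)) \<longlongrightarrow> 0) (at_right 0)"
          by (rule tendsto_mult_left_zero) (rule tendsto_ident_at)
      qed
    qed
    then show ?thesis using False unfolding h_def by auto
  qed
next
  case (Suc n)
  have db: "partial_deriv e b \<in> frequency_symbols (m - 1)"
    by (rule frequency_symbols_partial_deriv[OF Suc.prems(1) e(1)])
  obtain L where L: "\<And>\<psi>. \<psi> \<in> test_functions UNIV \<Longrightarrow>
      ((\<lambda>\<epsilon>. of_real (\<epsilon> ^ k) * (\<integral>\<xi>. exp (\<i> * of_real (z \<bullet> \<xi>)) * partial_deriv e b \<xi> * \<psi> (\<epsilon> *\<^sub>R \<xi>) \<partial>lborel))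
        \<longlongrightarrow> (if k = 0 then L * \<psi> 0 else 0)) (at_right 0)"
    using Suc.IH[OF db, of k] Suc.prems(2) by auto
  have gain: "((\<lambda>\<epsilon>. of_real (\<epsilon> ^ Suc k) * (\<integral>\<xi>. exp (\<i> * of_real (z \<bullet> \<xi>)) * b \<xi> * \<psi> (\<epsilon> *\<^sub>R \<xi>) \<partial>lborel))
        \<longlongrightarrow> 0) (at_right 0)" if "\<psi> \<in> test_functions UNIV" for \<psi>
    using Suc.IH[OF Suc.prems(1), of "Suc k"] Suc.prems(2) that by auto
  have "((\<lambda>\<epsilon>. of_real (\<epsilon> ^ k) * (\<integral>\<xi>. exp (\<i> * of_real (z \<bullet> \<xi>)) * b \<xi> * \<psi> (\<epsilon> *\<^sub>R \<xi>) \<partial>lborel))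
        \<longlongrightarrow> (if k = 0 then \<i> / of_real (z \<bullet> e) * L * \<psi> 0 else 0)) (at_right 0)"
    if psi: "\<psi> \<in> test_functions UNIV" for \<psi>
  proof -
    have lim: "((\<lambda>\<epsilon>. \<i> / of_real (z \<bullet> e) *
        (of_real (\<epsilon> ^ k) * (\<integral>\<xi>. exp (\<i> * of_real (z \<bullet> \<xi>)) * partial_deriv e b \<xi> * \<psi> (\<epsilon> *\<^sub>R \<xi>) \<partial>lborel) +
         of_real (\<epsilon> ^ Suc k) * (\<integral>\<xi>. exp (\<i> * of_real (z \<bullet> \<xi>)) * b \<xi> * partial_deriv e \<psi> (\<epsilon> *\<^sub>R \<xi>) \<partial>lborel)))
        \<longlongrightarrow> \<i> / of_real (z \<bullet> e) * ((if k = 0 then L * \<psi> 0 else 0) + 0)) (at_right 0)"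
      by (intro tendsto_mult tendsto_const tendsto_add L psi gain test_functions_partial_deriv e)
    have "\<forall>\<^sub>F \<epsilon> in at_right 0. \<i> / of_real (z \<bullet> e) *
        (of_real (\<epsilon> ^ k) * (\<integral>\<xi>. exp (\<i> * of_real (z \<bullet> \<xi>)) * partial_deriv e b \<xi> * \<psi> (\<epsilon> *\<^sub>R \<xi>) \<partial>lborel) +
         of_real (\<epsilon> ^ Suc k) * (\<integral>\<xi>. exp (\<i> * of_real (z \<bullet> \<xi>)) * b \<xi> * partial_deriv e \<psi> (\<epsilon> *\<^sub>R \<xi>) \<partial>lborel)) =
        of_real (\<epsilon> ^ k) * (\<integral>\<xi>. exp (\<i> * of_real (z \<bullet> \<xi>)) * b \<xi> * \<psi> (\<epsilon> *\<^sub>R \<xi>) \<partial>lborel)"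
    proof (rule eventually_at_rightI[of 0 1])
      fix \<epsilon> :: real assume "\<epsilon> \<in> {0<..<1}"
      then have eps: "\<epsilon> \<noteq> 0" by simp
      show "\<i> / of_real (z \<bullet> e) *
        (of_real (\<epsilon> ^ k) * (\<integral>\<xi>. exp (\<i> * of_real (z \<bullet> \<xi>)) * partial_deriv e b \<xi> * \<psi> (\<epsilon> *\<^sub>R \<xi>) \<partial>lborel) +
         of_real (\<epsilon> ^ Suc k) * (\<integral>\<xi>. exp (\<i> * of_real (z \<bullet> \<xi>)) * b \<xi> * partial_deriv e \<psi> (\<epsilon> *\<^sub>R \<xi>) \<partial>lborel)) =
        of_real (\<epsilon> ^ k) * (\<integral>\<xi>. exp (\<i> * of_real (z \<bullet> \<xi>)) * b \<xi> * \<psi> (\<epsilon> *\<^sub>R \<xi>) \<partial>lborel)"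
        unfolding integral_linear_phase_by_parts[OF frequency_symbols_smooth[OF Suc.prems(1)] psi e eps]
        by (simp add: algebra_simps)
    qed simp
    from Lim_transform_eventually[OF lim this] show ?thesis
      by (cases "k = 0") (simp_all add: mult.assoc)
  qed
  then show ?case by blast
qed

lemma Op_kernel_eq:
  fixes a :: "(real^'d) \<times> (real^'d) \<Rightarrow> complex"
  shows "Op_kernel a \<theta> p q =
    (\<integral>\<xi>. exp (\<i> * of_real ((p - q) \<bullet> \<xi>)) * a (p, \<xi>) * \<theta> \<xi> \<partial>lborel) / of_real ((2 * pi) ^ CARD('d))"
  by (simp add: Op_kernel_def osc_kernel_def)

lemma Op_kernel_converges_off_diagonal:
  fixes a :: "(real^'d) \<times> (real^'d) \<Rightarrow> complex"
  assumes a: "a \<in> symbol_class m U" and p: "p \<in> U" and "p \<noteq> q"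
  shows "\<exists>k. osc_value (\<lambda>\<theta>. Op_kernel a \<theta> p q) k"
proof -
  obtain e where e: "e \<in> Basis" "(p - q) \<bullet> e \<noteq> 0"
    using \<open>p \<noteq> q\<close> euclidean_eq_iff[of p q] by (auto simp: inner_diff_left)
  obtain n :: nat where n: "m + 2 * real DIM(real^'d) + 1 \<le> real n" using real_arch_simple by blast
  have "m - real 0 - real n \<le> - 2 * real DIM(real^'d) - 1" using n by simp
  then obtain L where L: "\<And>\<psi>. \<psi> \<in> test_functions UNIV \<Longrightarrow>
      ((\<lambda>\<epsilon>. \<integral>\<xi>. exp (\<i> * of_real ((p - q) \<bullet> \<xi>)) * a (p, \<xi>) * \<psi> (\<epsilon> *\<^sub>R \<xi>) \<partial>lborel)
        \<longlongrightarrow> L * \<psi> 0) (at_right 0)"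
    using linear_phase_limit[OF e symbol_class_slice[OF a p], of 0 n] by auto
  have "osc_value (\<lambda>\<theta>. Op_kernel a \<theta> p q) (L / of_real ((2 * pi) ^ CARD('d)))"
    unfolding osc_value_def Op_kernel_eq
  proof
    fix \<psi> :: "real^'d \<Rightarrow> complex" assume "\<psi> \<in> cutoffs"
    then have psi: "\<psi> \<in> test_functions UNIV" "\<psi> 0 = 1" by (auto simp: cutoffs_def)
    show "((\<lambda>\<epsilon>. (\<integral>\<xi>. exp (\<i> * of_real ((p - q) \<bullet> \<xi>)) * a (p, \<xi>) * \<psi> (\<epsilon> *\<^sub>R \<xi>) \<partial>lborel)
          / of_real ((2 * pi) ^ CARD('d))) \<longlongrightarrow> L / of_real ((2 * pi) ^ CARD('d))) (at_right 0)"
      using L[OF psi(1)] psi(2) by (intro tendsto_divide tendsto_const) auto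
  qed
  then show ?thesis by blast
qed

section \<open>Functions with bounded derivatives\<close>

lemma iter_partial_linear_compose:
  assumes S: "open S" and h: "bounded_linear h" and f: "smooth_on S f"
  shows "bs \<in> lists Basis \<Longrightarrow> x \<in> S \<Longrightarrow> iter_partial bs (\<lambda>x. h (f x)) x = h (iter_partial bs f x)"
proof (induction bs arbitrary: x)
  case (Cons b bs)
  have "frechet_derivative (iter_partial bs (\<lambda>x. h (f x))) (at x) =
      frechet_derivative (\<lambda>x. h (iter_partial bs f x)) (at x)"
    using Cons by (intro frechet_derivative_cong_open[OF S]) auto
  also have "\<dots> = (\<lambda>v. h (frechet_derivative (iter_partial bs f) (at x) v))"
    using Cons.prems smooth_on_iter_partial[OF f, of bs]
    by (intro frechet_derivative_at[symmetric] bounded_linear.has_derivative[OF h] smooth_on_has_derivative) auto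
  finally show ?case by simp
qed simp

lemma iter_partial_add:
  assumes S: "open S" and f: "smooth_on S f" and g: "smooth_on S g"
  shows "bs \<in> lists Basis \<Longrightarrow> x \<in> S \<Longrightarrow>
    iter_partial bs (\<lambda>x. f x + g x) x = iter_partial bs f x + iter_partial bs g x"
proof (induction bs arbitrary: x)
  case (Cons b bs)
  have "frechet_derivative (iter_partial bs (\<lambda>x. f x + g x)) (at x) =
      frechet_derivative (\<lambda>x. iter_partial bs f x + iter_partial bs g x) (at x)"
    using Cons by (intro frechet_derivative_cong_open[OF S]) auto
  also have "\<dots> = (\<lambda>v. frechet_derivative (iter_partial bs f) (at x) v + frechet_derivative (iter_partial bs g) (at x) v)"
    using Cons.prems smooth_on_iter_partial[OF f, of bs] smooth_on_iter_partial[OF g, of bs]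
    by (intro frechet_derivative_at[symmetric] has_derivative_add smooth_on_has_derivative) auto
  finally show ?case by simp
qed simp

lemma iter_partial_zero: "iter_partial bs (\<lambda>x. 0) = (\<lambda>x. 0)"
  by (induction bs) auto

lemma iter_partial_sum:
  assumes S: "open S" and "finite I" "\<And>i. i \<in> I \<Longrightarrow> smooth_on S (f i)" "bs \<in> lists Basis" "x \<in> S"
  shows "iter_partial bs (\<lambda>x. \<Sum>i\<in>I. f i x) x = (\<Sum>i\<in>I. iter_partial bs (f i) x)"
  using assms(2,3)
proof (induction I rule: finite_induct)
  case (insert i I)
  then show ?case
    using assms iter_partial_add[OF S, of "f i" "\<lambda>x. \<Sum>i\<in>I. f i x" bs x] smooth_on_sum[OF S, of I f]
    by simp
qed (simp add: iter_partial_zero)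

text \<open>
  The smooth functions on \<open>S\<close> all of whose derivatives, including the function itself, are
  bounded on \<open>K\<close>.  With \<open>K\<close> compact every smooth function qualifies; \<open>K = S\<close> is the
  uniform version.
\<close>

definition bounded_smooth ::
  "'a::euclidean_space set \<Rightarrow> 'a set \<Rightarrow> ('a \<Rightarrow> 'b::real_normed_vector) \<Rightarrow> bool" where
  "bounded_smooth S K f \<longleftrightarrow> smooth_on S f \<and> (\<forall>bs\<in>lists Basis. bounded (iter_partial bs f ` K))"

lemma bounded_smooth_compact:
  assumes "smooth_on S f" "compact K" "K \<subseteq> S"
  shows "bounded_smooth S K f"
  unfolding bounded_smooth_def using assms
  by (auto intro!: compact_imp_bounded compact_continuous_image
      intro: continuous_on_subset[OF smooth_on_continuous_on[OF smooth_on_iter_partial]])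

lemma bounded_smooth_cong:
  assumes S: "open S" "K \<subseteq> S" and "\<And>x. x \<in> S \<Longrightarrow> f x = g x" and f: "bounded_smooth S K f"
  shows "bounded_smooth S K g"
proof -
  have "iter_partial bs f ` K = iter_partial bs g ` K" for bs
    using assms iter_partial_cong_open[OF S(1), of f g] by (intro image_cong) auto
  then show ?thesis
    using f smooth_on_cong[OF S(1) assms(3)] by (simp add: bounded_smooth_def)
qed

lemma bounded_smooth_partial_deriv:
  assumes "bounded_smooth S K f" "b \<in> Basis"
  shows "bounded_smooth S K (partial_deriv b f)"
  unfolding bounded_smooth_def
proof (intro conjI ballI)
  show "smooth_on S (partial_deriv b f)"
    using assms by (intro smooth_on_partial_deriv) (auto simp: bounded_smooth_def)
  fix bs :: "'a list" assume "bs \<in> lists Basis"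
  then have "bs @ [b] \<in> lists Basis" using assms by simp
  then have "bounded (iter_partial (bs @ [b]) f ` K)"
    using assms unfolding bounded_smooth_def by blast
  then show "bounded (iter_partial bs (partial_deriv b f) ` K)" by (simp add: iter_partial_snoc)
qed

lemma bounded_smooth_zero: "open S \<Longrightarrow> bounded_smooth S K (\<lambda>x. 0)"
  by (auto simp: bounded_smooth_def smooth_on_const iter_partial_zero bounded_iff)

lemma bounded_smooth_const: "open S \<Longrightarrow> bounded_smooth S K (\<lambda>x. c)"
proof -
  assume S: "open S"
  have "iter_partial bs (\<lambda>x::'a. c) = (\<lambda>x. if bs = [] then c else 0)" for bs
    by (induction bs) (auto simp: if_distrib cong: if_cong)
  then have "bounded (iter_partial bs (\<lambda>x::'a. c) ` K)" for bs
    by (auto simp: bounded_iff)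
  with S show ?thesis by (simp add: bounded_smooth_def smooth_on_const)
qed

lemma bounded_smooth_linear_compose:
  assumes S: "open S" "K \<subseteq> S" and h: "bounded_linear h" and f: "bounded_smooth S K f"
  shows "bounded_smooth S K (\<lambda>x. h (f x))"
  unfolding bounded_smooth_def
proof (intro conjI ballI)
  have smooth: "smooth_on S f" using f by (simp add: bounded_smooth_def)
  show "smooth_on S (\<lambda>x. h (f x))" by (rule smooth_on_linear_compose[OF S(1) h smooth])
  fix bs :: "'a list" assume bs: "bs \<in> lists Basis"
  have "iter_partial bs (\<lambda>x. h (f x)) ` K = h ` (iter_partial bs f ` K)"
    unfolding image_image using S(2)
    by (intro image_cong iter_partial_linear_compose[OF S(1) h smooth bs]) auto
  moreover have "bounded (h ` (iter_partial bs f ` K))"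
    using f bs by (intro bounded_linear_image[OF _ h]) (simp add: bounded_smooth_def)
  ultimately show "bounded (iter_partial bs (\<lambda>x. h (f x)) ` K)" by simp
qed

lemma bounded_smooth_add:
  assumes S: "open S" "K \<subseteq> S" and f: "bounded_smooth S K f" and g: "bounded_smooth S K g"
  shows "bounded_smooth S K (\<lambda>x. f x + g x)"
  unfolding bounded_smooth_def
proof (intro conjI ballI)
  have smooth: "smooth_on S f" "smooth_on S g" using f g by (simp_all add: bounded_smooth_def)
  show "smooth_on S (\<lambda>x. f x + g x)" by (rule smooth_on_add[OF S(1) smooth])
  fix bs :: "'a list" assume bs: "bs \<in> lists Basis"
  have "iter_partial bs (\<lambda>x. f x + g x) ` K = (\<lambda>x. iter_partial bs f x + iter_partial bs g x) ` K"
    using S(2) by (intro image_cong iter_partial_add[OF S(1) smooth bs]) auto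
  moreover have "bounded ((\<lambda>x. iter_partial bs f x + iter_partial bs g x) ` K)"
    using f g bs by (intro bounded_plus_comp) (auto simp: bounded_smooth_def)
  ultimately show "bounded (iter_partial bs (\<lambda>x. f x + g x) ` K)" by simp
qed

lemma bounded_smooth_sum:
  "open S \<Longrightarrow> K \<subseteq> S \<Longrightarrow> (\<And>i. i \<in> I \<Longrightarrow> bounded_smooth S K (f i)) \<Longrightarrow> bounded_smooth S K (\<lambda>x. \<Sum>i\<in>I. f i x)"
  by (induction I rule: infinite_finite_induct) (simp_all add: bounded_smooth_zero bounded_smooth_add)

lemma partial_deriv_mult:
  fixes f g :: "'a::euclidean_space \<Rightarrow> 'b::real_normed_algebra"
  assumes "smooth_on S f" "smooth_on S g" "x \<in> S"
  shows "partial_deriv b (\<lambda>x. f x * g x) x = f x * partial_deriv b g x + partial_deriv b f x * g x"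
  using partial_deriv_eq[OF has_derivative_mult[OF smooth_on_has_partial_deriv[OF assms(1,3)]
        smooth_on_has_partial_deriv[OF assms(2,3)]]] .

lemma bounded_smooth_mult:
  fixes f g :: "'a::euclidean_space \<Rightarrow> 'b::real_normed_algebra"
  assumes S: "open S" "K \<subseteq> S"
  shows "bounded_smooth S K f \<Longrightarrow> bounded_smooth S K g \<Longrightarrow> bounded_smooth S K (\<lambda>x. f x * g x)"
proof -
  have "bounded_smooth S K f \<Longrightarrow> bounded_smooth S K g \<Longrightarrow> bs \<in> lists Basis \<Longrightarrow>
      bounded (iter_partial bs (\<lambda>x. f x * g x) ` K)" for bs and f g :: "'a \<Rightarrow> 'b"
  proof (induction bs arbitrary: f g rule: rev_induct)
    case Nil
    have "bounded (iter_partial [] f ` K)" "bounded (iter_partial [] g ` K)"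
      using Nil lists.Nil unfolding bounded_smooth_def by blast+
    then obtain A B where AB: "\<And>x. x \<in> K \<Longrightarrow> norm (f x) \<le> A" "\<And>x. x \<in> K \<Longrightarrow> norm (g x) \<le> B"
      unfolding bounded_iff by auto
    have "norm (f x * g x) \<le> A * B" if "x \<in> K" for x
      using AB[OF that] by (intro order_trans[OF norm_mult_ineq] mult_mono) (auto intro: order_trans[OF norm_ge_zero])
    then show ?case by (auto simp: bounded_iff)
  next
    case (snoc b bs)
    let ?u = "\<lambda>x. f x * partial_deriv b g x" and ?v = "\<lambda>x. partial_deriv b f x * g x"
    have b: "b \<in> Basis" "bs \<in> lists Basis" using snoc.prems(3) by auto
    have fg: "smooth_on S f" "smooth_on S g" using snoc.prems by (simp_all add: bounded_smooth_def)
    have smooth: "smooth_on S ?u" "smooth_on S ?v"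
      using fg b by (intro smooth_on_mult S smooth_on_partial_deriv; simp)+
    have "iter_partial (bs @ [b]) (\<lambda>x. f x * g x) x = iter_partial bs ?u x + iter_partial bs ?v x" if "x \<in> S" for x
    proof -
      have "iter_partial bs (partial_deriv b (\<lambda>x. f x * g x)) x = iter_partial bs (\<lambda>x. ?u x + ?v x) x"
        using partial_deriv_mult[OF fg] by (intro iter_partial_cong_open[OF S(1) _ that]) simp
      then show ?thesis using iter_partial_add[OF S(1) smooth b(2) that] by (simp add: iter_partial_snoc)
    qed
    then have "iter_partial (bs @ [b]) (\<lambda>x. f x * g x) ` K = (\<lambda>x. iter_partial bs ?u x + iter_partial bs ?v x) ` K"
      using S(2) by (intro image_cong) auto
    then show ?case
      using snoc.IH[OF snoc.prems(1) bounded_smooth_partial_deriv[OF snoc.prems(2) b(1)] b(2)]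
        snoc.IH[OF bounded_smooth_partial_deriv[OF snoc.prems(1) b(1)] snoc.prems(2) b(2)]
      by (simp add: bounded_plus_comp)
  qed
  moreover assume f: "bounded_smooth S K f" and g: "bounded_smooth S K g"
  moreover have "smooth_on S (\<lambda>x. f x * g x)"
    using f g by (intro smooth_on_mult[OF S(1)]) (simp_all add: bounded_smooth_def)
  ultimately show "bounded_smooth S K (\<lambda>x. f x * g x)"
    unfolding bounded_smooth_def[of _ _ "\<lambda>x. f x * g x"] by blast
qed

lemma bounded_smooth_prod:
  fixes f :: "'i \<Rightarrow> 'a::euclidean_space \<Rightarrow> 'b::{real_normed_algebra,comm_ring_1}"
  shows "open S \<Longrightarrow> K \<subseteq> S \<Longrightarrow> (\<And>i. i \<in> I \<Longrightarrow> bounded_smooth S K (f i)) \<Longrightarrow> bounded_smooth S K (\<lambda>x. \<Prod>i\<in>I. f i x)"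
  by (induction I rule: infinite_finite_induct) (simp_all add: bounded_smooth_const bounded_smooth_mult)

text \<open>Composition with a projection, which maps each basis vector to a basis vector or to \<open>0\<close>.\<close>

lemma bounded_smooth_projection:
  fixes p :: "'a::euclidean_space \<Rightarrow> 'b::euclidean_space" and f :: "'b \<Rightarrow> 'c::real_normed_vector"
  assumes S: "open S" and p: "bounded_linear p" "\<And>x. x \<in> S \<Longrightarrow> p x \<in> T"
    and basis: "\<And>b. b \<in> Basis \<Longrightarrow> p b \<in> Basis \<or> p b = 0"
  shows "bounded_smooth T T f \<Longrightarrow> bounded_smooth S S (\<lambda>x. f (p x))"
proof -
  have partial: "partial_deriv b (\<lambda>x. f (p x)) x = partial_deriv (p b) f (p x)"
    if "smooth_on T f" "x \<in> S" for f :: "'b \<Rightarrow> 'c" and b x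
    using partial_deriv_eq[OF has_derivative_compose[OF bounded_linear_imp_has_derivative[OF p(1)]
        smooth_on_has_partial_deriv[OF that(1) p(2)[OF that(2)]]]] .
  have "bounded_smooth T T f \<Longrightarrow> bs \<in> lists Basis \<Longrightarrow> bounded (iter_partial bs (\<lambda>x. f (p x)) ` S)"
    for bs and f :: "'b \<Rightarrow> 'c"
  proof (induction bs arbitrary: f rule: rev_induct)
    case Nil
    have "bounded (iter_partial [] f ` T)"
      using Nil lists.Nil unfolding bounded_smooth_def by blast
    then show ?case using p(2) by (auto elim!: bounded_subset)
  next
    case (snoc b bs)
    have b: "b \<in> Basis" "bs \<in> lists Basis" using snoc.prems by auto
    have f: "smooth_on T f" using snoc.prems by (simp add: bounded_smooth_def)
    have eq: "iter_partial (bs @ [b]) (\<lambda>x. f (p x)) ` S = iter_partial bs (\<lambda>x. partial_deriv (p b) f (p x)) ` S"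
      unfolding iter_partial_snoc
      using partial[OF f] by (intro image_cong iter_partial_cong_open[OF S]) auto
    show ?case
    proof (cases "p b = 0")
      case True
      have "partial_deriv 0 f (p x) = 0" if "x \<in> S" for x
        using linear_0[OF has_derivative_linear[OF smooth_on_has_partial_deriv[OF f p(2)[OF that]]]] .
      then have "iter_partial bs (\<lambda>x. partial_deriv (p b) f (p x)) ` S = iter_partial bs (\<lambda>x. 0) ` S"
        using True by (intro image_cong iter_partial_cong_open[OF S]) auto
      then show ?thesis unfolding eq by (auto simp: iter_partial_zero bounded_iff)
    next
      case False
      then have "p b \<in> Basis" using basis[OF b(1)] by simp
      then show ?thesis
        unfolding eq by (intro snoc.IH bounded_smooth_partial_deriv snoc.prems b)
    qed
  qed
  moreover have "smooth_on S (\<lambda>x. f (p x))" if "smooth_on T f" for f :: "'b \<Rightarrow> 'c"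
    using smooth_on_compose[OF S that smooth_on_linear[OF S p(1)] p(2)] .
  ultimately show "bounded_smooth T T f \<Longrightarrow> bounded_smooth S S (\<lambda>x. f (p x))"
    by (simp add: bounded_smooth_def)
qed

text \<open>
  The derivatives of \<open>\<bar>d\<bar>\<close>, where they exist, are those of \<open>d\<close> up to sign: this is clear off
  the zero set and in its interior, and the remaining points are limits of points where
  \<open>d\<close> does not vanish.
\<close>

lemma norm_iter_partial_abs:
  fixes d :: "'a::euclidean_space \<Rightarrow> real"
  assumes S: "open S" and d: "smooth_on S d" and ad: "smooth_on S (\<lambda>x. \<bar>d x\<bar>)"
    and bs: "bs \<in> lists Basis" and x: "x \<in> S"
  shows "norm (iter_partial bs (\<lambda>x. \<bar>d x\<bar>) x) = norm (iter_partial bs d x)"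
proof -
  let ?P = "{x \<in> S. 0 < d x}" and ?N = "{x \<in> S. d x < 0}"
  have "open (S \<inter> d -` {0<..})" "open (S \<inter> d -` {..<0})"
    by (intro continuous_open_preimage smooth_on_continuous_on[OF d] S open_greaterThan open_lessThan)+
  moreover have "S \<inter> d -` {0<..} = ?P" "S \<inter> d -` {..<0} = ?N" by auto
  ultimately have open_P: "open ?P" and open_N: "open ?N" by simp_all
  have nonzero: "norm (iter_partial bs (\<lambda>x. \<bar>d x\<bar>) y) = norm (iter_partial bs d y)" if "y \<in> ?P \<union> ?N" for y
  proof (cases "y \<in> ?P")
    case True
    then show ?thesis using iter_partial_cong_open[OF open_P _ True, of "\<lambda>x. \<bar>d x\<bar>" d bs] by simp
  next
    case False
    then have y: "y \<in> ?N" using that by blast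
    have "iter_partial bs (\<lambda>x. \<bar>d x\<bar>) y = iter_partial bs (\<lambda>x. - d x) y"
      by (rule iter_partial_cong_open[OF open_N _ y]) simp
    also have "\<dots> = - iter_partial bs d y"
      using y by (intro iter_partial_linear_compose[OF S bounded_linear_minus[OF bounded_linear_ident] d bs]) simp
    finally show ?thesis by simp
  qed
  show ?thesis
  proof (cases "x \<in> closure (?P \<union> ?N)")
    case True
    then obtain y where y: "\<And>n. y n \<in> ?P \<union> ?N" "y \<longlonglongrightarrow> x"
      unfolding closure_sequential by blast
    have yS: "y n \<in> S" for n using y(1)[of n] by blast
    have lim: "(\<lambda>n. norm (iter_partial bs f (y n))) \<longlonglongrightarrow> norm (iter_partial bs f x)" if "smooth_on S f" for f :: "'a \<Rightarrow> real"
      by (intro tendsto_norm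
          continuous_on_tendsto_compose[OF smooth_on_continuous_on[OF smooth_on_iter_partial[OF that bs]] y(2) x])
         (simp add: yS)
    show ?thesis
      using lim[OF ad] lim[OF d] unfolding nonzero[OF y(1)] by (rule LIMSEQ_unique)
  next
    case False
    have open_Z: "open (S - closure (?P \<union> ?N))" by (rule open_Diff[OF S closed_closure])
    have zero: "d y = 0" if "y \<in> S - closure (?P \<union> ?N)" for y
    proof (rule ccontr)
      assume "d y \<noteq> 0"
      with that have "y \<in> ?P \<union> ?N" by auto
      with that closure_subset[of "?P \<union> ?N"] show False by blast
    qed
    have "iter_partial bs (\<lambda>x. \<bar>d x\<bar>) x = iter_partial bs d x"
    proof (rule iter_partial_cong_open[OF open_Z])
      show "x \<in> S - closure (?P \<union> ?N)" using x False by (rule DiffI)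
      show "\<bar>d y\<bar> = d y" if "y \<in> S - closure (?P \<union> ?N)" for y
        unfolding zero[OF that] by (rule abs_zero)
    qed
    then show ?thesis by simp
  qed
qed

section \<open>Pull-back of symbols\<close>

text \<open>
  By the chain rule each derivative in the base point produces a sum of terms of the same form,
  with \<open>b\<close> replaced by one of its derivatives and the coefficient \<open>c\<close> by a product involving
  a derivative of \<open>X\<close>; the order in \<open>\<xi>\<close> does not change.
\<close>

lemma symbol_estimate_pullback:
  fixes b :: "'a::euclidean_space \<times> 'c::euclidean_space \<Rightarrow> complex"
    and X :: "'p::euclidean_space \<Rightarrow> 'a"
  assumes S: "open S" "K \<subseteq> S" and U: "open U" and X: "smooth_on S X" "\<And>p. p \<in> S \<Longrightarrow> X p \<in> U"
    and dX: "\<And>e. e \<in> Basis \<Longrightarrow> bounded_smooth S K (partial_deriv e X)"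
  shows "\<alpha> \<in> lists Basis \<Longrightarrow> smooth_on (U \<times> UNIV) b \<Longrightarrow> bounded_smooth S K c \<Longrightarrow>
    (\<And>\<gamma>. \<gamma> \<in> lists Basis \<Longrightarrow> \<exists>C. \<forall>x\<in>U. \<forall>\<xi>.
       norm (iter_partial (map (\<lambda>e. (e, 0)) \<gamma>) b (x, \<xi>)) \<le> C * (1 + norm \<xi>) powr s) \<Longrightarrow>
    \<exists>C. \<forall>p\<in>K. \<forall>\<xi>.
      norm (iter_partial (map (\<lambda>e. (e, 0)) \<alpha>) (\<lambda>q. b (X (fst q), snd q) * c (fst q)) (p, \<xi>))
        \<le> C * (1 + norm \<xi>) powr s"
proof (induction \<alpha> arbitrary: b c rule: rev_induct)
  case Nil
  obtain C where C: "\<And>x \<xi>. x \<in> U \<Longrightarrow> norm (b (x, \<xi>)) \<le> C * (1 + norm \<xi>) powr s"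
    using Nil.prems(4)[of "[]"] by auto
  have "bounded (iter_partial [] c ` K)"
    using Nil.prems(3) lists.Nil unfolding bounded_smooth_def by blast
  then obtain D where D: "D > 0" "\<And>p. p \<in> K \<Longrightarrow> norm (c p) \<le> D"
    unfolding bounded_pos by auto
  have "norm (b (X p, \<xi>) * c p) \<le> (C * D) * (1 + norm \<xi>) powr s" if p: "p \<in> K" for p \<xi>
  proof -
    have Xp: "X p \<in> U" using X(2) S(2) p by blast
    have "norm (b (X p, \<xi>) * c p) \<le> (C * (1 + norm \<xi>) powr s) * D"
      unfolding norm_mult using order_trans[OF norm_ge_zero C[OF Xp]]
      by (intro mult_mono C[OF Xp] D(2)[OF p]) auto
    then show ?thesis by (simp add: mult_ac)
  qed
  then show ?case by auto
next
  case (snoc e \<alpha>)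
  have e: "e \<in> Basis" "\<alpha> \<in> lists Basis" using snoc.prems(1) by auto
  have open_SU: "open (S \<times> (UNIV :: 'c set))" using S(1) by (intro open_Times) auto
  have c: "smooth_on S c" using snoc.prems(3) by (simp add: bounded_smooth_def)
  define F where "F g k = (\<lambda>q::'p \<times> 'c. (g (X (fst q), snd q) :: complex) * (k (fst q) :: complex))" for g k
  have smooth_F: "smooth_on (S \<times> UNIV) (F g k)" if "smooth_on (U \<times> UNIV) g" "smooth_on S k" for g k
    unfolding F_def
  proof (rule smooth_on_mult[OF open_SU])
    show "smooth_on (S \<times> UNIV) (\<lambda>q::'p \<times> 'c. g (X (fst q), snd q))"
      by (rule smooth_on_compose[OF open_SU that(1)])
         (use X open_SU in \<open>auto intro!: smooth_on_Pair smooth_on_compose[OF _ X(1)] smooth_on_fst smooth_on_snd smooth_on_ident\<close>)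
    show "smooth_on (S \<times> UNIV) (\<lambda>q::'p \<times> 'c. k (fst q))"
      by (rule smooth_on_compose[where g = fst, OF open_SU that(2) smooth_on_linear[OF open_SU bounded_linear_fst]])
         auto
  qed
  define c' where "c' i = (\<lambda>p. complex_of_real (partial_deriv e X p \<bullet> i) * c p)" for i
  define b' where "b' i = partial_deriv (i, 0) b" for i
  have c': "bounded_smooth S K (c' i)" for i
    unfolding c'_def
    by (intro bounded_smooth_mult[OF S] snoc.prems(3) bounded_smooth_linear_compose[OF S bounded_linear_of_real]
        bounded_smooth_linear_compose[OF S bounded_linear_inner_left] dX e)
  have dc: "bounded_smooth S K (partial_deriv e c)"
    by (rule bounded_smooth_partial_deriv[OF snoc.prems(3) e(1)])
  have b': "smooth_on (U \<times> UNIV) (b' i)" if "i \<in> Basis" for i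
    unfolding b'_def by (rule smooth_on_partial_deriv[OF snoc.prems(2)]) (use that in \<open>simp add: Basis_prod_def\<close>)
  have chain: "partial_deriv (e, 0) (F b c) q = (\<Sum>i\<in>Basis. F (b' i) (c' i) q) + F b (partial_deriv e c) q"
    if q: "q \<in> S \<times> UNIV" for q
  proof -
    obtain p \<xi> where q_eq: "q = (p, \<xi>)" "p \<in> S" using q by auto
    have dXp: "(X has_derivative (\<lambda>h. partial_deriv h X p)) (at p)"
      by (rule smooth_on_has_partial_deriv[OF X(1) q_eq(2)])
    have dbp: "(b has_derivative (\<lambda>h. partial_deriv h b (X p, \<xi>))) (at (X p, \<xi>))"
      using X(2)[OF q_eq(2)] by (intro smooth_on_has_partial_deriv[OF snoc.prems(2)]) simp
    have "((\<lambda>q. (X (fst q), snd q)) has_derivative (\<lambda>h. (partial_deriv (fst h) X p, snd h))) (at (p, \<xi>))"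
      by (intro has_derivative_Pair has_derivative_snd has_derivative_ident
          has_derivative_compose[where f = fst and g = X])
         (use dXp in \<open>auto intro: has_derivative_fst[OF has_derivative_ident]\<close>)
    from has_derivative_compose[OF this, of b] dbp
    have 1: "((\<lambda>q. b (X (fst q), snd q)) has_derivative
        (\<lambda>h. partial_deriv (partial_deriv (fst h) X p, snd h) b (X p, \<xi>))) (at (p, \<xi>))"
      by simp
    have 2: "((\<lambda>q. c (fst q)) has_derivative (\<lambda>h. partial_deriv (fst h) c p)) (at (p, \<xi>))"
      by (rule has_derivative_compose[where f = fst and g = c])
         (use smooth_on_has_partial_deriv[OF c q_eq(2)] in \<open>auto intro: has_derivative_fst[OF has_derivative_ident]\<close>)
    have sum_b: "partial_deriv (v, 0) b (X p, \<xi>) = (\<Sum>i\<in>Basis. of_real (v \<bullet> i) * b' i (X p, \<xi>))" for v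
    proof -
      have "((\<lambda>x. b (x, \<xi>)) has_derivative (\<lambda>h. partial_deriv (h, 0) b (X p, \<xi>))) (at (X p))"
        by (rule has_derivative_compose[where f = "\<lambda>x. (x, \<xi>)" and g = b])
           (intro has_derivative_Pair has_derivative_const has_derivative_ident dbp)+
      from has_derivative_Basis_sum[OF this, of v] show ?thesis
        by (simp add: b'_def scaleR_conv_of_real)
    qed
    show ?thesis
      using partial_deriv_eq[OF has_derivative_mult[OF 1 2], of "(e, 0)"]
      by (simp add: q_eq F_def sum_b c'_def sum_distrib_left sum_distrib_right mult_ac)
  qed
  have split: "iter_partial (map (\<lambda>e. (e, 0)) (\<alpha> @ [e])) (F b c) (p, \<xi>) =
      (\<Sum>i\<in>Basis. iter_partial (map (\<lambda>e. (e, 0)) \<alpha>) (F (b' i) (c' i)) (p, \<xi>)) +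
      iter_partial (map (\<lambda>e. (e, 0)) \<alpha>) (F b (partial_deriv e c)) (p, \<xi>)" if p: "p \<in> S" for p \<xi>
  proof -
    let ?A = "map (\<lambda>e. (e, 0::'c)) \<alpha>"
    have A: "?A \<in> lists Basis" using e(2) by (auto simp: Basis_prod_def)
    have q: "(p, \<xi>) \<in> S \<times> UNIV" using p by simp
    have smooth_c': "smooth_on S (c' i)" for i using c' by (simp add: bounded_smooth_def)
    have smooth_dc: "smooth_on S (partial_deriv e c)" using dc by (simp add: bounded_smooth_def)
    have "iter_partial (?A @ [(e, 0)]) (F b c) (p, \<xi>) =
        iter_partial ?A (\<lambda>q. (\<Sum>i\<in>Basis. F (b' i) (c' i) q) + F b (partial_deriv e c) q) (p, \<xi>)"
      unfolding iter_partial_snoc using chain by (intro iter_partial_cong_open[OF open_SU _ q])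
    also have "\<dots> = iter_partial ?A (\<lambda>q. \<Sum>i\<in>Basis. F (b' i) (c' i) q) (p, \<xi>) +
        iter_partial ?A (F b (partial_deriv e c)) (p, \<xi>)"
      using smooth_F b' smooth_c' smooth_dc snoc.prems(2)
      by (intro iter_partial_add[OF open_SU _ _ A q] smooth_on_sum[OF open_SU]) auto
    also have "iter_partial ?A (\<lambda>q. \<Sum>i\<in>Basis. F (b' i) (c' i) q) (p, \<xi>) =
        (\<Sum>i\<in>Basis. iter_partial ?A (F (b' i) (c' i)) (p, \<xi>))"
      using smooth_F b' smooth_c' by (intro iter_partial_sum[OF open_SU _ _ A q]) auto
    finally show ?thesis by simp
  qed
  have "\<exists>C. \<forall>p\<in>K. \<forall>\<xi>. norm (iter_partial (map (\<lambda>e. (e, 0)) \<alpha>) (F (b' i) (c' i)) (p, \<xi>)) \<le> C * (1 + norm \<xi>) powr s"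
    if i: "i \<in> Basis" for i
    unfolding F_def
  proof (rule snoc.IH[OF e(2) b'[OF i] c'])
    fix \<gamma> :: "'a list" assume "\<gamma> \<in> lists Basis"
    then have "\<gamma> @ [i] \<in> lists Basis" using i by simp
    from snoc.prems(4)[OF this] show "\<exists>C. \<forall>x\<in>U. \<forall>\<xi>.
       norm (iter_partial (map (\<lambda>e. (e, 0)) \<gamma>) (b' i) (x, \<xi>)) \<le> C * (1 + norm \<xi>) powr s"
      by (simp add: b'_def iter_partial_snoc)
  qed
  then obtain C where C: "\<And>i p \<xi>. i \<in> Basis \<Longrightarrow> p \<in> K \<Longrightarrow>
      norm (iter_partial (map (\<lambda>e. (e, 0)) \<alpha>) (F (b' i) (c' i)) (p, \<xi>)) \<le> C i * (1 + norm \<xi>) powr s"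
    by metis
  obtain D where D: "\<And>p \<xi>. p \<in> K \<Longrightarrow>
      norm (iter_partial (map (\<lambda>e. (e, 0)) \<alpha>) (F b (partial_deriv e c)) (p, \<xi>)) \<le> D * (1 + norm \<xi>) powr s"
    using snoc.IH[OF e(2) snoc.prems(2) dc snoc.prems(4)] unfolding F_def by blast
  have "norm (iter_partial (map (\<lambda>e. (e, 0)) (\<alpha> @ [e])) (F b c) (p, \<xi>)) \<le> ((\<Sum>i\<in>Basis. C i) + D) * (1 + norm \<xi>) powr s"
    if p: "p \<in> K" for p \<xi>
  proof -
    have "p \<in> S" using p S(2) by blast
    then show ?thesis
      unfolding split[OF \<open>p \<in> S\<close>] ring_distribs sum_distrib_right
      using C[OF _ p] D[OF p]
      by (intro order_trans[OF norm_triangle_ineq] add_mono order_trans[OF norm_sum] sum_mono) auto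
  qed
  then have "\<exists>C. \<forall>p\<in>K. \<forall>\<xi>.
      norm (iter_partial (map (\<lambda>e. (e, 0)) (\<alpha> @ [e])) (F b c) (p, \<xi>)) \<le> C * (1 + norm \<xi>) powr s"
    by (intro exI[of _ "(\<Sum>i\<in>Basis. C i) + D"] ballI allI)
  then show ?case by (simp only: F_def)
qed

section \<open>Local diffeomorphisms\<close>

lemma frechet_derivative_jacobian:
  fixes chi :: "real^'d \<Rightarrow> real^'d"
  assumes "smooth_on \<Omega> chi" "x \<in> \<Omega>"
  shows "frechet_derivative chi (at x) = (\<lambda>h. jacobian chi (at x) *v h)"
proof -
  have "linear (frechet_derivative chi (at x))"
    using linear_frechet_derivative[OF smooth_on_differentiable[OF assms]] .
  then show ?thesis by (simp add: jacobian_def matrix_works fun_eq_iff)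
qed

lemma has_derivative_jacobian:
  fixes chi :: "real^'d \<Rightarrow> real^'d"
  assumes "smooth_on \<Omega> chi" "x \<in> \<Omega>"
  shows "(chi has_derivative (\<lambda>h. jacobian chi (at x) *v h)) (at x)"
  using smooth_on_has_derivative[OF assms] by (simp add: frechet_derivative_jacobian[OF assms])

lemma det_nonzero_iff_kernel:
  fixes A :: "real^'n^'n"
  shows "det A \<noteq> 0 \<longleftrightarrow> (\<forall>h. A *v h = 0 \<longrightarrow> h = 0)"
  by (simp add: invertible_det_nz[symmetric] invertible_left_inverse matrix_left_invertible_ker)

text \<open>
  The local inverse provided by the inverse function theorem has derivative
  \<open>(D chi)\<^sup>-\<^sup>1 \<circ> g\<close>, so each order of smoothness of \<open>g\<close> yields the next one.
\<close>

lemma smooth_local_inverse: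
  fixes chi g :: "real^'d \<Rightarrow> real^'d"
  assumes \<Omega>: "open \<Omega>" and chi: "smooth_on \<Omega> chi"
    and nz: "\<And>y. y \<in> \<Omega> \<Longrightarrow> det (jacobian chi (at y)) \<noteq> 0"
    and W: "open W" and gW: "\<And>y. y \<in> W \<Longrightarrow> g y \<in> \<Omega>"
    and g: "\<And>y. y \<in> W \<Longrightarrow> (g has_derivative (\<lambda>h. matrix_inv (jacobian chi (at (g y))) *v h)) (at y)"
  shows "smooth_on W g"
proof -
  have "diff_upto n W g" for n
  proof (induction n)
    case (Suc n)
    show ?case
    proof (rule diff_upto_SucI[OF W g])
      fix b :: "real^'d" assume "b \<in> Basis"
      then obtain j where b: "b = axis j 1" by (auto simp: Basis_vec_def)
      have "matrix_inv (jacobian chi (at (g y))) *v b =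
          (\<Sum>k\<in>UNIV. (matrix_inv (jacobian chi (at (g y))) $ k $ j) *\<^sub>R axis k 1)" for y
        unfolding b matrix_vector_mult_basis column_def
        by (simp add: vec_eq_iff axis_def if_distrib cong: if_cong)
      moreover have "diff_upto n W (\<lambda>y. \<Sum>k\<in>UNIV. (matrix_inv (jacobian chi (at (g y))) $ k $ j) *\<^sub>R (axis k 1 :: real^'d))"
      proof (rule diff_upto_sum[OF W], rule diff_upto_bilinear[OF W bounded_bilinear_scaleR])
        fix k :: 'd
        have "diff_upto n \<Omega> (\<lambda>x. matrix_inv (jacobian chi (at x)) $ k $ j)"
          using smooth_on_matrix_inv[OF \<Omega> smooth_on_jacobian[OF \<Omega> chi] nz] by (simp add: smooth_on_diff_upto)
        from diff_upto_compose[OF W gW this Suc]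
        show "diff_upto n W (\<lambda>y. matrix_inv (jacobian chi (at (g y))) $ k $ j)" .
      qed (rule diff_upto_const[OF W])
      ultimately show "diff_upto n W (\<lambda>y. matrix_inv (jacobian chi (at (g y))) *v b)" by simp
    qed
  qed simp
  then show ?thesis by (simp add: smooth_on_diff_upto)
qed

lemma local_diffeomorphism_iff_jacobian:
  fixes chi :: "real^'d \<Rightarrow> real^'d"
  assumes \<Omega>: "open \<Omega>" and chi: "smooth_on \<Omega> chi"
  shows "local_diffeomorphism \<Omega> chi \<longleftrightarrow> (\<forall>x\<in>\<Omega>. det (jacobian chi (at x)) \<noteq> 0)"
proof
  assume L: "local_diffeomorphism \<Omega> chi"
  show "\<forall>x\<in>\<Omega>. det (jacobian chi (at x)) \<noteq> 0"
  proof
    fix x assume x: "x \<in> \<Omega>"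
    obtain V W g where V: "open V" "x \<in> V" "homeomorphism V W chi g" "smooth_on W g"
      using L x unfolding local_diffeomorphism_def by blast
    have chi_x: "chi x \<in> W" and inv: "\<And>y. y \<in> V \<Longrightarrow> g (chi y) = y"
      using V(2,3) by (auto simp: homeomorphism_def)
    have "((\<lambda>y. g (chi y)) has_derivative
        (\<lambda>h. frechet_derivative g (at (chi x)) (jacobian chi (at x) *v h))) (at x)"
      by (rule has_derivative_compose[OF has_derivative_jacobian[OF chi x] smooth_on_has_derivative[OF V(4) chi_x]])
    then have "((\<lambda>y. y) has_derivative
        (\<lambda>h. frechet_derivative g (at (chi x)) (jacobian chi (at x) *v h))) (at x)"
      by (rule has_derivative_transform_within_open[OF _ V(1,2) inv])
    then have id: "(\<lambda>h. frechet_derivative g (at (chi x)) (jacobian chi (at x) *v h)) = (\<lambda>h. h)"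
      by (rule has_derivative_unique) (rule has_derivative_ident)
    have zero: "frechet_derivative g (at (chi x)) 0 = 0"
      by (rule linear_0[OF has_derivative_linear[OF smooth_on_has_derivative[OF V(4) chi_x]]])
    show "det (jacobian chi (at x)) \<noteq> 0"
      unfolding det_nonzero_iff_kernel
    proof (intro allI impI)
      fix h assume "jacobian chi (at x) *v h = 0"
      then show "h = 0" using fun_cong[OF id, of h] zero by simp
    qed
  qed
next
  assume nz: "\<forall>x\<in>\<Omega>. det (jacobian chi (at x)) \<noteq> 0"
  show "local_diffeomorphism \<Omega> chi"
    unfolding local_diffeomorphism_def
  proof
    fix x assume x: "x \<in> \<Omega>"
    define J where "J y = jacobian chi (at y)" for y
    define J' where "J' y = Blinfun (\<lambda>h. J y *v h)" for y
    have J': "blinfun_apply (J' y) = (\<lambda>h. J y *v h)" for y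
      unfolding J'_def by (intro bounded_linear_Blinfun_apply matrix_vector_mul_bounded_linear)
    have inv: "J y *v (matrix_inv (J y) *v h) = h" "matrix_inv (J y) *v (J y *v h) = h" if "y \<in> \<Omega>" for y h
      using matrix_mul_matrix_inv[of "J y"] nz that by (simp_all add: J_def matrix_vector_mul_assoc)
    have deriv: "(chi has_derivative blinfun_apply (J' y)) (at y)" if "y \<in> \<Omega>" for y
      unfolding J' J_def by (rule has_derivative_jacobian[OF chi that])
    have cont: "continuous_on \<Omega> J'"
    proof (rule continuous_on_blinfun_componentwise)
      fix i :: "real^'d" assume "i \<in> Basis"
      then have "continuous_on \<Omega> (partial_deriv i chi)"
        by (intro smooth_on_continuous_on smooth_on_partial_deriv[OF chi])
      then show "continuous_on \<Omega> (\<lambda>y. blinfun_apply (J' y) i)"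
        by (rule continuous_on_eq) (simp add: partial_deriv_eq[OF deriv])
    qed
    have left: "Blinfun (\<lambda>h. matrix_inv (J x) *v h) o\<^sub>L J' x = id_blinfun"
      by (rule blinfun_eqI) (simp add: J' inv[OF x] bounded_linear_Blinfun_apply matrix_vector_mul_bounded_linear)
    show "\<exists>V W g. open V \<and> x \<in> V \<and> V \<subseteq> \<Omega> \<and> open W \<and>
        homeomorphism V W chi g \<and> smooth_on V chi \<and> smooth_on W g"
    proof (rule inverse_function_theorem[OF \<Omega> deriv cont x left])
      fix V W g g'
      assume V: "open V" "V \<subseteq> \<Omega>" "x \<in> V" and W: "open W"
        and hom: "homeomorphism V W chi g"
        and g: "\<And>y. y \<in> W \<Longrightarrow> (g has_derivative (g' y)) (at y)"
          "\<And>y. y \<in> W \<Longrightarrow> g' y = inv (blinfun_apply (J' (g y)))"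
      have gW: "g y \<in> \<Omega>" if "y \<in> W" for y
        using hom V(2) that by (auto simp: homeomorphism_def)
      have "smooth_on W g"
      proof (rule smooth_local_inverse[OF \<Omega> chi _ W gW])
        fix y assume y: "y \<in> W"
        have "inv (blinfun_apply (J' (g y))) = (\<lambda>h. matrix_inv (J (g y)) *v h)"
          unfolding J' by (rule inv_unique_comp) (simp_all add: fun_eq_iff inv[OF gW[OF y]])
        then show "(g has_derivative (\<lambda>h. matrix_inv (jacobian chi (at (g y))) *v h)) (at y)"
          using g[OF y] by (simp add: J_def)
      qed (use nz in auto)
      then show ?thesis
        using V W hom smooth_on_subset[OF chi V(2)] by blast
    qed
  qed
qed

section \<open>The pulled back phase\<close>

lemma smooth_on_pullback_phase:
  fixes chi :: "real^'d \<Rightarrow> real^'d"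
  assumes \<Omega>: "open \<Omega>" and chi: "smooth_on \<Omega> chi"
  shows "smooth_on ((\<Omega> \<times> \<Omega>) \<times> UNIV) (pullback_phase chi)"
proof -
  have op: "open ((\<Omega> \<times> \<Omega>) \<times> (UNIV :: (real^'d) set))"
    using \<Omega> by (intro open_Times open_UNIV)
  have "smooth_on ((\<Omega> \<times> \<Omega>) \<times> UNIV) (\<lambda>p::((real^'d) \<times> (real^'d)) \<times> (real^'d). (chi (fst (fst p)) - chi (snd (fst p))) \<bullet> snd p)"
    by (intro smooth_on_inner smooth_on_diff op smooth_on_snd smooth_on_ident
        smooth_on_compose[OF op chi smooth_on_fst[OF op smooth_on_fst[OF op smooth_on_ident[OF op]]]]
        smooth_on_compose[OF op chi smooth_on_snd[OF op smooth_on_fst[OF op smooth_on_ident[OF op]]]]) auto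
  then show ?thesis by (simp add: pullback_phase_def case_prod_unfold)
qed

lemma homogeneous_pullback_phase:
  assumes "open \<Omega>" "smooth_on \<Omega> chi"
  shows "homogeneous_phase \<Omega> (pullback_phase chi)"
  using smooth_on_pullback_phase[OF assms] by (simp add: homogeneous_phase_def pullback_phase_def)

lemma D_xi_pullback_phase:
  assumes "open \<Omega>" "smooth_on \<Omega> chi" and x: "x \<in> \<Omega>" and y: "y \<in> \<Omega>"
  shows "D_xi (pullback_phase chi) ((x, y), \<xi>) = (\<lambda>\<eta>. (chi x - chi y) \<bullet> \<eta>)"
proof -
  let ?D = "frechet_derivative (pullback_phase chi) (at ((x, y), \<xi>))"
  have D: "(pullback_phase chi has_derivative ?D) (at ((x, y), \<xi>))"
    using x y by (intro smooth_on_has_derivative[OF smooth_on_pullback_phase[OF assms(1,2)]]) simp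
  have "((\<lambda>\<xi>. pullback_phase chi ((x, y), \<xi>)) has_derivative (\<lambda>\<eta>. ?D (0, \<eta>))) (at \<xi>)"
    by (rule has_derivative_compose[where f = "\<lambda>\<xi>. ((x, y), \<xi>)" and g = "pullback_phase chi"])
       (intro has_derivative_Pair has_derivative_const has_derivative_ident D)+
  moreover have "((\<lambda>\<xi>. pullback_phase chi ((x, y), \<xi>)) has_derivative (\<lambda>\<eta>. (chi x - chi y) \<bullet> \<eta>)) (at \<xi>)"
    by (simp add: pullback_phase_def has_derivative_inner_right)
  ultimately have "(\<lambda>\<eta>. ?D (0, \<eta>)) = (\<lambda>\<eta>. (chi x - chi y) \<bullet> \<eta>)"
    by (rule has_derivative_unique)
  then show ?thesis by (simp add: D_xi_def zero_prod_def)
qed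

lemma critical_set_pullback_phase:
  fixes chi :: "real^'d \<Rightarrow> real^'d"
  assumes "open \<Omega>" "smooth_on \<Omega> chi"
  shows "critical_set \<Omega> (pullback_phase chi) =
    {((x, y), \<xi>) |x y \<xi>. x \<in> \<Omega> \<and> y \<in> \<Omega> \<and> \<xi> \<noteq> 0 \<and> chi x = chi y}"
proof -
  have "(\<lambda>\<eta>. (chi x - chi y) \<bullet> \<eta>) = (\<lambda>\<eta>. 0) \<longleftrightarrow> chi x = chi y" for x y
  proof
    assume "(\<lambda>\<eta>. (chi x - chi y) \<bullet> \<eta>) = (\<lambda>\<eta>. 0)"
    from fun_cong[OF this, of "chi x - chi y"] show "chi x = chi y" by simp
  qed simp
  then show ?thesis
    by (auto simp: critical_set_def D_xi_pullback_phase[OF assms])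
qed

lemma C_set_pullback_phase:
  fixes chi :: "real^'d \<Rightarrow> real^'d"
  assumes "open \<Omega>" "smooth_on \<Omega> chi"
  shows "C_set \<Omega> (pullback_phase chi) = {(x, y). x \<in> \<Omega> \<and> y \<in> \<Omega> \<and> chi x = chi y}"
proof -
  have "(axis undefined 1 :: real^'d) \<noteq> 0" by (simp add: axis_eq_0_iff)
  then show ?thesis
    unfolding C_set_def critical_set_pullback_phase[OF assms] by (force simp: image_iff)
qed

lemma frechet_derivative_D_xi_pullback_phase:
  fixes chi :: "real^'d \<Rightarrow> real^'d"
  assumes \<Omega>: "open \<Omega>" and chi: "smooth_on \<Omega> chi" and x: "x \<in> \<Omega>" and y: "y \<in> \<Omega>"
  shows "frechet_derivative (\<lambda>q. D_xi (pullback_phase chi) q (axis j 1)) (at ((x, y), \<xi>)) v =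
    (jacobian chi (at x) *v fst (fst v) - jacobian chi (at y) *v snd (fst v)) $ j"
proof -
  let ?S = "(\<Omega> \<times> \<Omega>) \<times> (UNIV :: (real^'d) set)"
  let ?f = "\<lambda>q::((real^'d) \<times> (real^'d)) \<times> (real^'d). (chi (fst (fst q)) - chi (snd (fst q))) $ j"
  have "frechet_derivative (\<lambda>q. D_xi (pullback_phase chi) q (axis j 1)) (at ((x, y), \<xi>)) =
      frechet_derivative ?f (at ((x, y), \<xi>))"
  proof (rule frechet_derivative_cong_open)
    show "open ?S" using \<Omega> by (intro open_Times open_UNIV)
    show "((x, y), \<xi>) \<in> ?S" using x y by simp
    show "D_xi (pullback_phase chi) q (axis j 1) = ?f q" if "q \<in> ?S" for q
      using that by (auto simp: D_xi_pullback_phase[OF \<Omega> chi] inner_axis)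
  qed
  also have "\<dots> = (\<lambda>v. (jacobian chi (at x) *v fst (fst v) - jacobian chi (at y) *v snd (fst v)) $ j)"
  proof (rule frechet_derivative_at[symmetric])
    have 1: "((\<lambda>q::((real^'d) \<times> (real^'d)) \<times> (real^'d). chi (fst (fst q))) has_derivative
        (\<lambda>v. jacobian chi (at x) *v fst (fst v))) (at ((x, y), \<xi>))"
      by (rule has_derivative_compose[where f = "\<lambda>q. fst (fst q)" and g = chi])
         (use has_derivative_jacobian[OF chi x] in \<open>auto intro!: has_derivative_fst has_derivative_ident\<close>)
    have 2: "((\<lambda>q::((real^'d) \<times> (real^'d)) \<times> (real^'d). chi (snd (fst q))) has_derivative
        (\<lambda>v. jacobian chi (at y) *v snd (fst v))) (at ((x, y), \<xi>))"
      by (rule has_derivative_compose[where f = "\<lambda>q. snd (fst q)" and g = chi])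
         (use has_derivative_jacobian[OF chi y] in \<open>auto intro!: has_derivative_fst has_derivative_snd has_derivative_ident\<close>)
    show "(?f has_derivative (\<lambda>v. (jacobian chi (at x) *v fst (fst v) - jacobian chi (at y) *v snd (fst v)) $ j)) (at ((x, y), \<xi>))"
      by (rule bounded_linear.has_derivative[OF bounded_linear_vec_nth has_derivative_diff[OF 1 2]])
  qed
  finally show ?thesis by simp
qed

text \<open>
  A relation between the differentials is a covector annihilating the ranges of both
  \<open>D chi x\<close> and \<open>D chi y\<close>.  The critical set contains the whole diagonal, where this means
  that \<open>D chi x\<close> is not onto.
\<close>

lemma nondegenerate_pullback_phase_iff_jacobian:
  fixes chi :: "real^'d \<Rightarrow> real^'d"
  assumes \<Omega>: "open \<Omega>" and chi: "smooth_on \<Omega> chi"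
  shows "nondegenerate_phase \<Omega> (pullback_phase chi) \<longleftrightarrow> (\<forall>x\<in>\<Omega>. det (jacobian chi (at x)) \<noteq> 0)"
proof
  assume N: "nondegenerate_phase \<Omega> (pullback_phase chi)"
  show "\<forall>x\<in>\<Omega>. det (jacobian chi (at x)) \<noteq> 0"
  proof
    fix x assume x: "x \<in> \<Omega>"
    let ?J = "jacobian chi (at x)"
    define p where "p = ((x, x), axis undefined 1 :: real^'d)"
    have p: "p \<in> critical_set \<Omega> (pullback_phase chi)"
      using x unfolding p_def critical_set_pullback_phase[OF \<Omega> chi] by (simp add: axis_eq_0_iff)
    have "det (transpose ?J) \<noteq> 0"
      unfolding det_nonzero_iff_kernel
    proof (intro allI impI)
      fix r assume r: "transpose ?J *v r = 0"
      have "(\<Sum>j\<in>UNIV. r $ j * (?J *v h - ?J *v k) $ j) = 0" for h k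
      proof -
        have "(\<Sum>j\<in>UNIV. r $ j * (?J *v h - ?J *v k) $ j) = r \<bullet> (?J *v (h - k))"
          by (simp add: inner_vec_def matrix_vector_mult_diff_distrib)
        also have "\<dots> = 0"
          using r by (simp add: dot_lmul_matrix[symmetric] transpose_matrix_vector)
        finally show ?thesis .
      qed
      then have "\<forall>v. (\<Sum>j\<in>UNIV. r $ j * frechet_derivative (\<lambda>q. D_xi (pullback_phase chi) q (axis j 1)) (at p) v) = 0"
        unfolding p_def frechet_derivative_D_xi_pullback_phase[OF \<Omega> chi x x] by blast
      then have "\<forall>j. r $ j = 0"
        using N[unfolded nondegenerate_phase_def, rule_format, OF p, of "\<lambda>j. r $ j"] by blast
      then show "r = 0" by (simp add: vec_eq_iff)
    qed
    then show "det ?J \<noteq> 0" by simp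
  qed
next
  assume nz: "\<forall>x\<in>\<Omega>. det (jacobian chi (at x)) \<noteq> 0"
  show "nondegenerate_phase \<Omega> (pullback_phase chi)"
    unfolding nondegenerate_phase_def
  proof (intro ballI allI impI)
    fix p and r :: "'d \<Rightarrow> real" and i
    assume "p \<in> critical_set \<Omega> (pullback_phase chi)"
      and rel: "\<forall>v. (\<Sum>j\<in>UNIV. r j * frechet_derivative (\<lambda>q. D_xi (pullback_phase chi) q (axis j 1)) (at p) v) = 0"
    then obtain x y \<xi> where p: "p = ((x, y), \<xi>)" "x \<in> \<Omega>" "y \<in> \<Omega>"
      by (auto simp: critical_set_pullback_phase[OF \<Omega> chi])
    let ?J = "jacobian chi (at x)" and ?r = "\<chi> j. r j"
    have onto: "?J *v (matrix_inv ?J *v ?r) = ?r"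
      using matrix_mul_matrix_inv[of ?J] nz p(2) by (simp add: matrix_vector_mul_assoc)
    have annihilates: "(\<Sum>j\<in>UNIV. r j * (?J *v h) $ j) = 0" for h
      using rel[rule_format, of "((h, 0), 0)"]
      by (simp add: p frechet_derivative_D_xi_pullback_phase[OF \<Omega> chi p(2,3)])
    have "(\<Sum>j\<in>UNIV. r j * r j) = 0"
      using annihilates[of "matrix_inv ?J *v ?r"] unfolding onto by simp
    then show "r i = 0" by (simp add: sum_nonneg_eq_0_iff)
  qed
qed

section \<open>The pulled back operator\<close>

lemma smooth_on_det_jacobian:
  fixes chi :: "real^'d \<Rightarrow> real^'d"
  assumes "open \<Omega>" "smooth_on \<Omega> chi"
  shows "smooth_on \<Omega> (\<lambda>y. det (jacobian chi (at y)))"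
  by (intro smooth_on_det smooth_on_jacobian assms)

text \<open>Locally the determinant has constant sign, so its absolute value is \<open>det\<close> or \<open>- det\<close>.\<close>

lemma smooth_on_abs_jacobian_det:
  fixes chi :: "real^'d \<Rightarrow> real^'d"
  assumes \<Omega>: "open \<Omega>" and chi: "smooth_on \<Omega> chi"
    and nz: "\<And>y. y \<in> \<Omega> \<Longrightarrow> det (jacobian chi (at y)) \<noteq> 0"
  shows "smooth_on \<Omega> (abs_jacobian_det chi)"
proof -
  let ?d = "\<lambda>y. det (jacobian chi (at y))"
  let ?P = "\<Omega> \<inter> ?d -` {0<..}" and ?N = "\<Omega> \<inter> ?d -` {..<0}"
  have d: "smooth_on \<Omega> ?d" by (rule smooth_on_det_jacobian[OF \<Omega> chi])
  have P: "open ?P" and N: "open ?N"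
    by (intro continuous_open_preimage smooth_on_continuous_on[OF d] \<Omega> open_greaterThan open_lessThan)+
  have "smooth_on ?P (abs_jacobian_det chi)"
    by (rule smooth_on_cong[OF P _ smooth_on_subset[OF d]]) (auto simp: abs_jacobian_det_def)
  moreover have "smooth_on ?N (abs_jacobian_det chi)"
    by (rule smooth_on_cong[OF N _ smooth_on_subset[OF smooth_on_minus[OF \<Omega> d]]])
       (auto simp: abs_jacobian_det_def)
  ultimately have "smooth_on (?P \<union> ?N) (abs_jacobian_det chi)" by (rule smooth_on_Un)
  moreover have "\<Omega> \<subseteq> ?P \<union> ?N" using nz by (auto simp: linorder_neq_iff)
  ultimately show ?thesis by (rule smooth_on_subset)
qed

lemma continuous_on_abs_jacobian_det:
  fixes chi :: "real^'d \<Rightarrow> real^'d"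
  assumes "open \<Omega>" "smooth_on \<Omega> chi"
  shows "continuous_on \<Omega> (abs_jacobian_det chi)"
  unfolding abs_jacobian_det_def
  by (intro continuous_on_rabs smooth_on_continuous_on[OF smooth_on_det_jacobian[OF assms]])

text \<open>
  The Jacobian factor is independent of \<open>\<xi>\<close>, so it may be moved under the integral sign for
  every regularising factor.
\<close>

lemma pullback_Op_kernel:
  "pullback_kernel chi (Op_kernel a) = osc_kernel (pullback_phase chi) (pullback_amplitude chi a)"
proof (intro ext)
  fix \<theta> x y
  have "(\<integral>\<xi>. exp (\<i> * of_real ((chi x - chi y) \<bullet> \<xi>)) * (a (chi x, \<xi>) * of_real (abs_jacobian_det chi y)) * \<theta> \<xi> \<partial>lborel) =
      (\<integral>\<xi>. exp (\<i> * of_real ((chi x - chi y) \<bullet> \<xi>)) * a (chi x, \<xi>) * \<theta> \<xi> * of_real (abs_jacobian_det chi y) \<partial>lborel)"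
    by (intro Bochner_Integration.integral_cong refl) (simp add: mult_ac)
  also have "\<dots> = (\<integral>\<xi>. exp (\<i> * of_real ((chi x - chi y) \<bullet> \<xi>)) * a (chi x, \<xi>) * \<theta> \<xi> \<partial>lborel) * of_real (abs_jacobian_det chi y)"
    by (rule integral_mult_left_zero)
  finally show "pullback_kernel chi (Op_kernel a) \<theta> x y =
      osc_kernel (pullback_phase chi) (pullback_amplitude chi a) \<theta> x y"
    by (simp add: pullback_kernel_def Op_kernel_eq osc_kernel_def pullback_phase_def pullback_amplitude_def)
qed

lemma symbol_class_smooth: "a \<in> symbol_class m U \<Longrightarrow> smooth_on (U \<times> UNIV) a"
  by (simp add: symbol_class_def)

text \<open>The separated form with the identity map, for which \<^const>\<open>phase_transform\<close> is the Fourier transform.\<close>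

lemma Op_eq_kernel_operator:
  fixes a :: "(real^'d) \<times> (real^'d) \<Rightarrow> complex"
  assumes U: "open U" and a: "a \<in> symbol_class m U" and u: "u \<in> test_functions U" and x: "x \<in> U"
  shows "kernel_operator U (Op_kernel a) u x (Op a u x)"
proof -
  let ?om = "\<lambda>((x, y), \<xi>). (x - y) \<bullet> \<xi> :: real" and ?c = "\<lambda>((x, y), \<xi>). a (x, \<xi>)"
  have slice: "(\<lambda>\<xi>. a (x, \<xi>)) \<in> frequency_symbols m" by (rule symbol_class_slice[OF a x])
  obtain C where C: "\<And>\<xi>. norm (a (x, \<xi>)) \<le> C * (1 + norm \<xi>) powr m"
    using frequency_symbols_bound[OF slice] by blast
  have cont: "continuous_on UNIV (\<lambda>\<xi>. a (x, \<xi>))"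
    by (rule smooth_on_continuous_on[OF frequency_symbols_smooth[OF slice]])
  have "continuous_on (U \<times> UNIV) (\<lambda>p. a (x, snd p))"
    by (rule continuous_on_compose2[OF cont]) (auto intro: continuous_intros)
  then have c: "continuous_on (U \<times> UNIV) (\<lambda>(y, \<xi>). ?c ((x, y), \<xi>))"
    by (simp add: case_prod_unfold)
  have om: "continuous_on (U \<times> UNIV) (\<lambda>(y, \<xi>). ?om ((x, y), \<xi>))"
    by (simp add: case_prod_unfold) (intro continuous_intros)
  have id: "det (jacobian (\<lambda>y::real^'d. y) (at y)) \<noteq> 0" for y
    by (simp add: jacobian_def matrix_id[unfolded id_def] mat_def[symmetric] det_I)
  have "fourier_integral_operator U ?om ?c u x
    ((\<integral>\<xi>. exp (\<i> * of_real (x \<bullet> \<xi>)) * a (x, \<xi>) * phase_transform (\<lambda>y. y) (\<lambda>y. 1 * u y) \<xi> \<partial>lborel)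
      / of_real ((2 * pi) ^ CARD('d)))"
    by (rule fourier_integral_operator_separated[OF U smooth_on_ident[OF U] id cont C]) (use u in simp_all)
  then have "fourier_integral_operator U ?om ?c u x (Op a u x)"
    by (simp add: Op_def fourier_def phase_transform_def)
  then show ?thesis
    unfolding Op_kernel_def by (simp only: kernel_operator_osc_kernel[OF om c u])
qed

lemma pullback_operator_eq_fourier_integral_operator:
  fixes chi :: "real^'d \<Rightarrow> real^'d"
  assumes \<Omega>: "open \<Omega>" and a: "a \<in> symbol_class m \<Omega>'" and chi: "smooth_map \<Omega> \<Omega>' chi"
    and u: "u \<in> test_functions \<Omega>" and x: "x \<in> \<Omega>"
  shows "kernel_operator \<Omega> (pullback_kernel chi (Op_kernel a)) u x z \<longleftrightarrow>
    fourier_integral_operator \<Omega> (pullback_phase chi) (pullback_amplitude chi a) u x z"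
proof -
  have smooth: "smooth_on \<Omega> chi" and chi_x: "chi x \<in> \<Omega>'" using chi x by (auto simp: smooth_map_def)
  have cont: "continuous_on UNIV (\<lambda>\<xi>. a (chi x, \<xi>))"
    by (rule smooth_on_continuous_on[OF frequency_symbols_smooth[OF symbol_class_slice[OF a chi_x]]])
  have "continuous_on (\<Omega> \<times> UNIV) (\<lambda>p. (chi x - chi (fst p)) \<bullet> snd p)"
    by (intro continuous_intros continuous_on_compose2[OF smooth_on_continuous_on[OF smooth] continuous_on_fst]) auto
  then have om: "continuous_on (\<Omega> \<times> UNIV) (\<lambda>(y, \<xi>). pullback_phase chi ((x, y), \<xi>))"
    by (simp add: pullback_phase_def case_prod_unfold)
  have "continuous_on (\<Omega> \<times> UNIV) (\<lambda>p. a (chi x, snd p) * of_real (abs_jacobian_det chi (fst p)))"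
    by (intro continuous_intros continuous_on_compose2[OF cont continuous_on_snd]
        continuous_on_compose2[OF continuous_on_abs_jacobian_det[OF \<Omega> smooth] continuous_on_fst]) auto
  then have c: "continuous_on (\<Omega> \<times> UNIV) (\<lambda>(y, \<xi>). pullback_amplitude chi a ((x, y), \<xi>))"
    by (simp add: pullback_amplitude_def case_prod_unfold)
  show ?thesis
    unfolding pullback_Op_kernel by (rule kernel_operator_osc_kernel[OF om c u])
qed

text \<open>
  For a local diffeomorphism the Jacobian factor is smooth and may be absorbed into the test
  function.
\<close>

lemma fourier_integral_operator_defined:
  fixes chi :: "real^'d \<Rightarrow> real^'d"
  assumes \<Omega>: "open \<Omega>" and a: "a \<in> symbol_class m \<Omega>'" and chi: "smooth_map \<Omega> \<Omega>' chi"
    and L: "local_diffeomorphism \<Omega> chi" and u: "u \<in> test_functions \<Omega>" and x: "x \<in> \<Omega>"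
  shows "\<exists>z. fourier_integral_operator \<Omega> (pullback_phase chi) (pullback_amplitude chi a) u x z"
proof -
  have smooth: "smooth_on \<Omega> chi" and chi_x: "chi x \<in> \<Omega>'" using chi x by (auto simp: smooth_map_def)
  have nz: "\<And>y. y \<in> \<Omega> \<Longrightarrow> det (jacobian chi (at y)) \<noteq> 0"
    using L local_diffeomorphism_iff_jacobian[OF \<Omega> smooth] by blast
  have slice: "(\<lambda>\<xi>. a (chi x, \<xi>)) \<in> frequency_symbols m" by (rule symbol_class_slice[OF a chi_x])
  obtain C where C: "\<And>\<xi>. norm (a (chi x, \<xi>)) \<le> C * (1 + norm \<xi>) powr m"
    using frequency_symbols_bound[OF slice] by blast
  have cont: "continuous_on UNIV (\<lambda>\<xi>. a (chi x, \<xi>))"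
    by (rule smooth_on_continuous_on[OF frequency_symbols_smooth[OF slice]])
  have w: "(\<lambda>y. of_real (abs_jacobian_det chi y) * u y) \<in> test_functions \<Omega>"
    by (intro test_functions_mult smooth_on_of_real smooth_on_abs_jacobian_det \<Omega> smooth nz u)
  have "fourier_integral_operator \<Omega> (pullback_phase chi) (pullback_amplitude chi a) u x
    ((\<integral>\<xi>. exp (\<i> * of_real (chi x \<bullet> \<xi>)) * a (chi x, \<xi>) *
        phase_transform chi (\<lambda>y. of_real (abs_jacobian_det chi y) * u y) \<xi> \<partial>lborel)
      / of_real ((2 * pi) ^ CARD('d)))"
    by (rule fourier_integral_operator_separated[OF \<Omega> smooth nz cont C w])
       (simp_all add: pullback_phase_def pullback_amplitude_def)
  then show ?thesis by blast
qed

lemma kernels_converge_off_critical_set: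
  fixes chi :: "real^'d \<Rightarrow> real^'d"
  assumes a: "a \<in> symbol_class m \<Omega>'" and "chi x \<in> \<Omega>'" "chi x \<noteq> chi y"
  shows "\<exists>k. osc_value (\<lambda>\<theta>. Op_kernel a \<theta> (chi x) (chi y)) k \<and>
    osc_value (\<lambda>\<theta>. osc_kernel (pullback_phase chi) (pullback_amplitude chi a) \<theta> x y)
      (k * of_real (abs_jacobian_det chi y))"
proof -
  obtain k where k: "osc_value (\<lambda>\<theta>. Op_kernel a \<theta> (chi x) (chi y)) k"
    using Op_kernel_converges_off_diagonal[OF assms] by blast
  then have "osc_value (\<lambda>\<theta>. Op_kernel a \<theta> (chi x) (chi y) * of_real (abs_jacobian_det chi y))
      (k * of_real (abs_jacobian_det chi y))"
    unfolding osc_value_def by (intro ballI tendsto_mult tendsto_const) blast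
  with k show ?thesis
    by (auto simp: pullback_Op_kernel[symmetric] pullback_kernel_def)
qed

section \<open>The pulled back amplitude\<close>

lemma smooth_on_pullback_amplitude:
  fixes chi :: "real^'d \<Rightarrow> real^'d" and a :: "(real^'d) \<times> (real^'d) \<Rightarrow> complex"
  assumes \<Omega>: "open \<Omega>" and a: "smooth_on (\<Omega>' \<times> UNIV) a"
    and chi: "smooth_map \<Omega> \<Omega>' chi" and J: "smooth_on \<Omega> (abs_jacobian_det chi)"
  shows "smooth_on ((\<Omega> \<times> \<Omega>) \<times> UNIV) (pullback_amplitude chi a)"
proof -
  let ?S = "(\<Omega> \<times> \<Omega>) \<times> (UNIV :: (real^'d) set)"
  have S: "open ?S" using \<Omega> by (intro open_Times open_UNIV)
  have smooth: "smooth_on \<Omega> chi" and into: "\<And>x. x \<in> \<Omega> \<Longrightarrow> chi x \<in> \<Omega>'" using chi by (auto simp: smooth_map_def)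
  have "smooth_on ?S (\<lambda>q. chi (fst (fst q)))"
    by (rule smooth_on_compose[OF S smooth smooth_on_fst[OF S smooth_on_fst[OF S smooth_on_ident[OF S]]]]) auto
  then have 1: "smooth_on ?S (\<lambda>q. a (chi (fst (fst q)), snd q))"
    using into by (intro smooth_on_compose[OF S a smooth_on_Pair[OF S _ smooth_on_snd[OF S smooth_on_ident[OF S]]]]) auto
  have "smooth_on ?S (\<lambda>q. abs_jacobian_det chi (snd (fst q)))"
    by (rule smooth_on_compose[OF S J smooth_on_snd[OF S smooth_on_fst[OF S smooth_on_ident[OF S]]]]) auto
  from smooth_on_mult[OF S 1 smooth_on_of_real[OF S this]] show ?thesis
    by (simp add: pullback_amplitude_def case_prod_unfold)
qed

text \<open>
  Derivatives in \<open>\<xi>\<close> do not see the pull-back, so the estimates reduce to those for derivatives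
  in the base point.
\<close>

lemma pullback_amplitude_estimate:
  fixes chi :: "real^'d \<Rightarrow> real^'d" and a :: "(real^'d) \<times> (real^'d) \<Rightarrow> complex"
  assumes \<Omega>: "open \<Omega>" and U: "open \<Omega>'" and a: "a \<in> symbol_class m \<Omega>'"
    and chi: "smooth_map \<Omega> \<Omega>' chi" and J: "smooth_on \<Omega> (abs_jacobian_det chi)"
    and K: "K \<subseteq> \<Omega> \<times> \<Omega>"
    and dX: "\<And>e. e \<in> Basis \<Longrightarrow> bounded_smooth (\<Omega> \<times> \<Omega>) K (partial_deriv e (\<lambda>p. chi (fst p)))"
    and Jb: "bounded_smooth (\<Omega> \<times> \<Omega>) K (\<lambda>p. abs_jacobian_det chi (snd p))"
    and \<alpha>: "\<alpha> \<in> lists Basis" and \<beta>: "\<beta> \<in> lists Basis"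
  shows "\<exists>C. \<forall>p\<in>K. \<forall>\<xi>. norm (mixed_partial \<alpha> \<beta> (pullback_amplitude chi a) (p, \<xi>))
    \<le> C * (1 + norm \<xi>) powr (m - real (length \<beta>))"
proof -
  let ?S = "\<Omega> \<times> \<Omega>"
  let ?B = "map (\<lambda>b. (0, b)) \<beta>"
  define c where "c = (\<lambda>p::(real^'d) \<times> (real^'d). complex_of_real (abs_jacobian_det chi (snd p)))"
  define b where "b = iter_partial ?B a"
  have S: "open ?S" and SU: "open (?S \<times> (UNIV :: (real^'d) set))"
    using \<Omega> by (auto intro!: open_Times)
  have smooth: "smooth_on \<Omega> chi" and into: "\<And>x. x \<in> \<Omega> \<Longrightarrow> chi x \<in> \<Omega>'" using chi by (auto simp: smooth_map_def)
  have X: "smooth_on ?S (\<lambda>p. chi (fst p))"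
    by (rule smooth_on_compose[OF S smooth smooth_on_fst[OF S smooth_on_ident[OF S]]]) auto
  have a_smooth: "smooth_on (\<Omega>' \<times> UNIV) a" by (rule symbol_class_smooth[OF a])
  have amp: "smooth_on (?S \<times> UNIV) (pullback_amplitude chi a)"
    by (rule smooth_on_pullback_amplitude[OF \<Omega> a_smooth chi J])
  have b: "smooth_on (\<Omega>' \<times> UNIV) b"
    unfolding b_def using \<beta> by (intro smooth_on_iter_partial[OF a_smooth]) (auto simp: Basis_prod_def)
  have c: "bounded_smooth ?S K c"
    unfolding c_def by (rule bounded_smooth_linear_compose[OF S K bounded_linear_of_real Jb])
  have est: "\<exists>C. \<forall>x\<in>\<Omega>'. \<forall>\<xi>. norm (iter_partial (map (\<lambda>e. (e, 0)) \<gamma>) b (x, \<xi>))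
      \<le> C * (1 + norm \<xi>) powr (m - real (length \<beta>))" if "\<gamma> \<in> lists Basis" for \<gamma>
    using a that \<beta> unfolding symbol_class_def mixed_partial_def b_def iter_partial_append by blast
  have xi: "iter_partial ?B (pullback_amplitude chi a) q = b (chi (fst (fst q)), snd q) * c (fst q)"
    if q: "q \<in> ?S \<times> UNIV" for q
  proof -
    obtain x y \<xi> where q_eq: "q = ((x, y), \<xi>)" and x: "x \<in> \<Omega>" and y: "y \<in> \<Omega>" using q by auto
    let ?J = "complex_of_real (abs_jacobian_det chi y)"
    have "iter_partial ?B (pullback_amplitude chi a) ((x, y), \<xi>) =
        iter_partial \<beta> (\<lambda>\<xi>. pullback_amplitude chi a ((x, y), \<xi>)) \<xi>"
      using fun_cong[OF iter_partial_slice[OF amp _ \<beta>, of "(x, y)"], of \<xi>] x y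
      by (simp add: zero_prod_def)
    also have "\<dots> = iter_partial \<beta> (\<lambda>\<xi>. a (chi x, \<xi>) * ?J) \<xi>"
      by (simp add: pullback_amplitude_def)
    also have "\<dots> = iter_partial \<beta> (\<lambda>\<xi>. a (chi x, \<xi>)) \<xi> * ?J"
      by (rule iter_partial_linear_compose[OF open_UNIV bounded_linear_mult_left
            frequency_symbols_smooth[OF symbol_class_slice[OF a into[OF x]]] \<beta> UNIV_I])
    also have "\<dots> = b (chi x, \<xi>) * ?J"
      unfolding b_def iter_partial_slice[OF a_smooth into[OF x] \<beta>] ..
    finally show ?thesis by (simp add: q_eq c_def)
  qed
  have eq: "mixed_partial \<alpha> \<beta> (pullback_amplitude chi a) (p, \<xi>) =
      iter_partial (map (\<lambda>e. (e, 0)) \<alpha>) (\<lambda>q. b (chi (fst (fst q)), snd q) * c (fst q)) (p, \<xi>)"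
    if "p \<in> K" for p \<xi>
    unfolding mixed_partial_def iter_partial_append
    by (rule iter_partial_cong_open[OF SU xi]) (use that K in auto)
  show ?thesis
    using symbol_estimate_pullback[OF S K U X _ dX \<alpha> b c est] into eq by auto
qed

lemma pullback_amplitude_local_symbol:
  fixes chi :: "real^'d \<Rightarrow> real^'d"
  assumes \<Omega>: "open \<Omega>" and U: "open \<Omega>'" and a: "a \<in> symbol_class m \<Omega>'"
    and chi: "smooth_map \<Omega> \<Omega>' chi" and J: "smooth_on \<Omega> (abs_jacobian_det chi)"
  shows "pullback_amplitude chi a \<in> local_symbol_class m (\<Omega> \<times> \<Omega>)"
  unfolding local_symbol_class_def
proof (intro CollectI conjI allI impI ballI)
  show "smooth_on ((\<Omega> \<times> \<Omega>) \<times> UNIV) (pullback_amplitude chi a)"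
    by (rule smooth_on_pullback_amplitude[OF \<Omega> symbol_class_smooth[OF a] chi J])
  fix K :: "((real^'d) \<times> (real^'d)) set" and \<alpha> :: "((real^'d) \<times> (real^'d)) list" and \<beta> :: "(real^'d) list"
  assume K: "compact K \<and> K \<subseteq> \<Omega> \<times> \<Omega>"
    and \<alpha>: "\<alpha> \<in> lists Basis" and \<beta>: "\<beta> \<in> lists Basis"
  have S: "open (\<Omega> \<times> \<Omega>)" using \<Omega> by (intro open_Times)
  have smooth: "smooth_on \<Omega> chi" using chi by (simp add: smooth_map_def)
  have X: "smooth_on (\<Omega> \<times> \<Omega>) (\<lambda>p. chi (fst p))"
    by (rule smooth_on_compose[OF S smooth smooth_on_fst[OF S smooth_on_ident[OF S]]]) auto
  have Js: "smooth_on (\<Omega> \<times> \<Omega>) (\<lambda>p. abs_jacobian_det chi (snd p))"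
    by (rule smooth_on_compose[OF S J smooth_on_snd[OF S smooth_on_ident[OF S]]]) auto
  show "\<exists>C. \<forall>x\<in>K. \<forall>\<xi>. norm (mixed_partial \<alpha> \<beta> (pullback_amplitude chi a) (x, \<xi>))
      \<le> C * (1 + norm \<xi>) powr (m - real (length \<beta>))"
  proof (rule pullback_amplitude_estimate[OF \<Omega> U a chi J _ _ _ \<alpha> \<beta>])
    show "K \<subseteq> \<Omega> \<times> \<Omega>" using K by simp
    show "bounded_smooth (\<Omega> \<times> \<Omega>) K (partial_deriv e (\<lambda>p. chi (fst p)))" if "e \<in> Basis" for e
      using K by (intro bounded_smooth_compact smooth_on_partial_deriv[OF X that]) auto
    show "bounded_smooth (\<Omega> \<times> \<Omega>) K (\<lambda>p. abs_jacobian_det chi (snd p))"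
      using K by (intro bounded_smooth_compact Js) auto
  qed
qed

text \<open>
  Boundedness of the derivatives of \<open>chi\<close> bounds those of the determinant, and hence by
  \<open>norm_iter_partial_abs\<close> those of its absolute value.
\<close>

lemma pullback_amplitude_symbol:
  fixes chi :: "real^'d \<Rightarrow> real^'d"
  assumes \<Omega>: "open \<Omega>" and U: "open \<Omega>'" and a: "a \<in> symbol_class m \<Omega>'"
    and chi: "smooth_map \<Omega> \<Omega>' chi" and J: "smooth_on \<Omega> (abs_jacobian_det chi)"
    and bd: "bounded_derivatives_on \<Omega> chi"
  shows "pullback_amplitude chi a \<in> symbol_class m (\<Omega> \<times> \<Omega>)"
  unfolding symbol_class_def
proof (intro CollectI conjI ballI)
  show "smooth_on ((\<Omega> \<times> \<Omega>) \<times> UNIV) (pullback_amplitude chi a)"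
    by (rule smooth_on_pullback_amplitude[OF \<Omega> symbol_class_smooth[OF a] chi J])
  fix \<alpha> \<beta> assume \<alpha>: "\<alpha> \<in> lists (Basis :: ((real^'d) \<times> (real^'d)) set)"
    and \<beta>: "\<beta> \<in> lists (Basis :: (real^'d) set)"
  have S: "open (\<Omega> \<times> \<Omega>)" using \<Omega> by (intro open_Times)
  have smooth: "smooth_on \<Omega> chi" using chi by (simp add: smooth_map_def)
  have dchi: "bounded_smooth \<Omega> \<Omega> (partial_deriv e chi)" if e: "e \<in> Basis" for e
    unfolding bounded_smooth_def
  proof (intro conjI ballI)
    show "smooth_on \<Omega> (partial_deriv e chi)" by (rule smooth_on_partial_deriv[OF smooth e])
    fix bs :: "(real^'d) list" assume "bs \<in> lists Basis"
    then have "bs @ [e] \<in> lists Basis" "bs @ [e] \<noteq> []" using e by auto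
    then have "bounded (iter_partial (bs @ [e]) chi ` \<Omega>)"
      using bd unfolding bounded_derivatives_on_def by blast
    then show "bounded (iter_partial bs (partial_deriv e chi) ` \<Omega>)" by (simp add: iter_partial_snoc)
  qed
  have det: "bounded_smooth \<Omega> \<Omega> (\<lambda>y. det (jacobian chi (at y)))"
    unfolding det_def jacobian_nth
    by (intro bounded_smooth_sum bounded_smooth_mult bounded_smooth_prod bounded_smooth_const \<Omega> order_refl
        bounded_smooth_linear_compose[OF \<Omega> order_refl bounded_linear_vec_nth] dchi) (simp add: axis_in_Basis_iff)
  have Jb: "bounded_smooth \<Omega> \<Omega> (abs_jacobian_det chi)"
    unfolding bounded_smooth_def
  proof (intro conjI ballI)
    fix bs :: "(real^'d) list" assume bs: "bs \<in> lists Basis"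
    have "norm (iter_partial bs (abs_jacobian_det chi) y) = norm (iter_partial bs (\<lambda>y. det (jacobian chi (at y))) y)"
      if "y \<in> \<Omega>" for y
      using norm_iter_partial_abs[OF \<Omega> smooth_on_det_jacobian[OF \<Omega> smooth] _ bs that] J
      by (simp add: abs_jacobian_det_def[abs_def])
    moreover have "bounded (iter_partial bs (\<lambda>y. det (jacobian chi (at y))) ` \<Omega>)"
      using det bs unfolding bounded_smooth_def by blast
    ultimately show "bounded (iter_partial bs (abs_jacobian_det chi) ` \<Omega>)"
      by (simp add: bounded_iff)
  qed (rule J)
  show "\<exists>C. \<forall>x\<in>\<Omega> \<times> \<Omega>. \<forall>\<xi>. norm (mixed_partial \<alpha> \<beta> (pullback_amplitude chi a) (x, \<xi>))
      \<le> C * (1 + norm \<xi>) powr (m - real (length \<beta>))"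
  proof (rule pullback_amplitude_estimate[OF \<Omega> U a chi J order_refl _ _ \<alpha> \<beta>])
    show "bounded_smooth (\<Omega> \<times> \<Omega>) (\<Omega> \<times> \<Omega>) (\<lambda>p. abs_jacobian_det chi (snd p))"
      by (rule bounded_smooth_projection[OF S bounded_linear_snd _ _ Jb]) (auto simp: Basis_prod_def)
    fix e :: "(real^'d) \<times> (real^'d)" assume e: "e \<in> Basis"
    have chain: "partial_deriv (fst e) chi (fst p) = partial_deriv e (\<lambda>p. chi (fst p)) p" if "p \<in> \<Omega> \<times> \<Omega>" for p
    proof (rule partial_deriv_eq[symmetric])
      have "(chi has_derivative (\<lambda>h. partial_deriv h chi (fst p))) (at (fst p))"
        using that by (intro smooth_on_has_partial_deriv[OF smooth]) auto
      then show "((\<lambda>p. chi (fst p)) has_derivative (\<lambda>h. partial_deriv (fst h) chi (fst p))) (at p)"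
        by (rule has_derivative_compose[OF has_derivative_fst[OF has_derivative_ident]])
    qed
    have "bounded_smooth (\<Omega> \<times> \<Omega>) (\<Omega> \<times> \<Omega>) (\<lambda>p. partial_deriv (fst e) chi (fst p))"
    proof (cases "fst e = 0")
      case True
      have "0 = partial_deriv (fst e) chi (fst p)" if "p \<in> \<Omega> \<times> \<Omega>" for p
        unfolding True
        using that by (intro linear_0[OF has_derivative_linear[OF smooth_on_has_partial_deriv[OF smooth]], symmetric]) auto
      then show ?thesis by (rule bounded_smooth_cong[OF S order_refl _ bounded_smooth_zero[OF S]])
    next
      case False
      then have "fst e \<in> Basis" using e by (auto simp: Basis_prod_def)
      then show ?thesis
        by (intro bounded_smooth_projection[OF S bounded_linear_fst _ _ dchi]) (auto simp: Basis_prod_def)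
    qed
    then show "bounded_smooth (\<Omega> \<times> \<Omega>) (\<Omega> \<times> \<Omega>) (partial_deriv e (\<lambda>p. chi (fst p)))"
      by (rule bounded_smooth_cong[OF S order_refl, rotated]) (rule chain)
  qed
qed

theorem proposition4p1:
  fixes \<Omega> \<Omega>' :: "(real^'d) set"
    and m :: real
    and a :: "(real^'d) \<times> (real^'d) \<Rightarrow> complex"
    and chi :: "real^'d \<Rightarrow> real^'d"
  assumes "open \<Omega>" and "open \<Omega>'"
    and "a \<in> symbol_class m \<Omega>'"
    and "smooth_map \<Omega> \<Omega>' chi"
  shows
    \<comment> \<open>\<open>Op a\<close> is the operator on \<open>\<Omega>'\<close> with kernel \<open>Op_kernel a\<close>\<close>
    "(\<forall>u\<in>test_functions \<Omega>'. \<forall>x\<in>\<Omega>'. kernel_operator \<Omega>' (Op_kernel a) u x (Op a u x))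
     \<and>
     homogeneous_phase \<Omega> (pullback_phase chi)
     \<and>
     \<comment> \<open>the pull-back and the Fourier integral operator agree, as partial operators\<close>
     (\<forall>u\<in>test_functions \<Omega>. \<forall>x\<in>\<Omega>. \<forall>z.
        kernel_operator \<Omega> (pullback_kernel chi (Op_kernel a)) u x z \<longleftrightarrow>
        fourier_integral_operator \<Omega> (pullback_phase chi) (pullback_amplitude chi a) u x z)
     \<and>
     \<comment> \<open>they are defined on all test functions if \<open>chi\<close> is a local diffeomorphism\<close>
     (local_diffeomorphism \<Omega> chi \<longrightarrow>
        (\<forall>u\<in>test_functions \<Omega>. \<forall>x\<in>\<Omega>. \<exists>z.
           fourier_integral_operator \<Omega> (pullback_phase chi) (pullback_amplitude chi a) u x z))
     \<and>
     \<comment> \<open>for arbitrary \<open>chi\<close>, the kernels exist pointwise and agree where the phase is regular\<close>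
     (\<forall>(x, y)\<in>R_set \<Omega> (pullback_phase chi). \<exists>k.
        osc_value (\<lambda>\<theta>. Op_kernel a \<theta> (chi x) (chi y)) k \<and>
        osc_value (\<lambda>\<theta>. osc_kernel (pullback_phase chi) (pullback_amplitude chi a) \<theta> x y)
          (k * of_real (abs_jacobian_det chi y)))
     \<and>
     \<comment> \<open>symbol class of the amplitude, locally uniformly and uniformly in \<open>(x, y)\<close>\<close>
     (smooth_on \<Omega> (abs_jacobian_det chi) \<longrightarrow>
        pullback_amplitude chi a \<in> local_symbol_class m (\<Omega> \<times> \<Omega>))
     \<and>
     (smooth_on \<Omega> (abs_jacobian_det chi) \<and> bounded_derivatives_on \<Omega> chi \<longrightarrow>
        pullback_amplitude chi a \<in> symbol_class m (\<Omega> \<times> \<Omega>))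
     \<and>
     C_set \<Omega> (pullback_phase chi) = {(x, y). x \<in> \<Omega> \<and> y \<in> \<Omega> \<and> chi x = chi y}
     \<and>
     (nondegenerate_phase \<Omega> (pullback_phase chi) \<longleftrightarrow> local_diffeomorphism \<Omega> chi)"
proof -
  have smooth: "smooth_on \<Omega> chi" and into: "\<And>x. x \<in> \<Omega> \<Longrightarrow> chi x \<in> \<Omega>'"
    using assms(4) by (auto simp: smooth_map_def)
  have C: "C_set \<Omega> (pullback_phase chi) = {(x, y). x \<in> \<Omega> \<and> y \<in> \<Omega> \<and> chi x = chi y}"
    by (rule C_set_pullback_phase[OF assms(1) smooth])
  have kernels: "\<forall>(x, y)\<in>R_set \<Omega> (pullback_phase chi). \<exists>k.
        osc_value (\<lambda>\<theta>. Op_kernel a \<theta> (chi x) (chi y)) k \<and>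
        osc_value (\<lambda>\<theta>. osc_kernel (pullback_phase chi) (pullback_amplitude chi a) \<theta> x y)
          (k * of_real (abs_jacobian_det chi y))"
    unfolding R_set_def C
  proof (rule ballI)
    fix p assume "p \<in> \<Omega> \<times> \<Omega> - {(x, y). x \<in> \<Omega> \<and> y \<in> \<Omega> \<and> chi x = chi y}"
    then obtain x y where p: "p = (x, y)" and x: "x \<in> \<Omega>" and xy: "chi x \<noteq> chi y"
      by (cases p) auto
    show "case p of (x, y) \<Rightarrow> \<exists>k. osc_value (\<lambda>\<theta>. Op_kernel a \<theta> (chi x) (chi y)) k \<and>
        osc_value (\<lambda>\<theta>. osc_kernel (pullback_phase chi) (pullback_amplitude chi a) \<theta> x y)
          (k * of_real (abs_jacobian_det chi y))"
      unfolding p prod.case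
      by (rule kernels_converge_off_critical_set[where chi = chi and x = x and y = y, OF assms(3) into[OF x] xy])
  qed
  have nondegenerate: "nondegenerate_phase \<Omega> (pullback_phase chi) \<longleftrightarrow> local_diffeomorphism \<Omega> chi"
    unfolding nondegenerate_pullback_phase_iff_jacobian[OF assms(1) smooth]
      local_diffeomorphism_iff_jacobian[OF assms(1) smooth] ..
  show ?thesis
  proof (intro conjI C kernels nondegenerate)
    show "\<forall>u\<in>test_functions \<Omega>'. \<forall>x\<in>\<Omega>'. kernel_operator \<Omega>' (Op_kernel a) u x (Op a u x)"
      by (intro ballI Op_eq_kernel_operator[OF assms(2,3)])
    show "homogeneous_phase \<Omega> (pullback_phase chi)"
      by (rule homogeneous_pullback_phase[OF assms(1) smooth])
    show "\<forall>u\<in>test_functions \<Omega>. \<forall>x\<in>\<Omega>. \<forall>z.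
        kernel_operator \<Omega> (pullback_kernel chi (Op_kernel a)) u x z \<longleftrightarrow>
        fourier_integral_operator \<Omega> (pullback_phase chi) (pullback_amplitude chi a) u x z"
      by (intro ballI allI pullback_operator_eq_fourier_integral_operator[OF assms(1,3,4)])
    show "local_diffeomorphism \<Omega> chi \<longrightarrow> (\<forall>u\<in>test_functions \<Omega>. \<forall>x\<in>\<Omega>. \<exists>z.
        fourier_integral_operator \<Omega> (pullback_phase chi) (pullback_amplitude chi a) u x z)"
      by (intro impI ballI fourier_integral_operator_defined[OF assms(1,3,4)])
    show "smooth_on \<Omega> (abs_jacobian_det chi) \<longrightarrow>
        pullback_amplitude chi a \<in> local_symbol_class m (\<Omega> \<times> \<Omega>)"
      by (intro impI pullback_amplitude_local_symbol[OF assms])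
    show "smooth_on \<Omega> (abs_jacobian_det chi) \<and> bounded_derivatives_on \<Omega> chi \<longrightarrow>
        pullback_amplitude chi a \<in> symbol_class m (\<Omega> \<times> \<Omega>)"
      using pullback_amplitude_symbol[OF assms] by blast
  qed
qed

end
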